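(* Fix $\lambda\ge 1$, $\mu\in\mathbb{R}$, $\sigma>0$ and $\delta_1,\delta_2\in\mathbb{R}$. For each $n$, let $X_1,\ldots,X_n$ be i.i.d. with the $\mathrm{APD}_\lambda(\theta_{1,n},\theta_{2,n},\mu,\sigma)$ distribution, where $\theta_{1,n}=\frac12+\frac{\delta_1}{\sqrt n}(1+o(1))$ and $\theta_{2,n}=\lambda+\frac{\delta_2}{\sqrt n}(1+o(1))$ (the local alternatives $H_{1,n}(\delta_1,\delta_2)$). Let $Z^*(S_\lambda)$ and $Z^*(K_\lambda)$ be the statistics computed from $X_1,\ldots,X_n$ as defined in the context. Then, as $n\to\infty$, $$\begin{pmatrix} Z^*(S_\lambda)\\ Z^*(K_\lambda)\end{pmatrix}\xrightarrow{\ \mathcal{D}\ }\mathcal{N}_2\left(\begin{pmatrix}-\delta_1V_{1,\lambda}^{1/2}\\-\delta_2V_{2,\lambda}^{1/2}\end{pmatrix},\begin{pmatrix}1&0\\0&1\end{pmatrix}\right)\quad\text{and}\quad \big(Z^*(S_\lambda)\big)^2+\big(Z^*(K_\lambda)\big)^2\xrightarrow{\ \mathcal{D}\ }\chi^2_2\big(\delta_1^2V_{1,\lambda}+\delta_2^2V_{2,\lambda}\big),$$ where $$V_{1,\lambda}=4(1+\lambda)-\frac{4\lambda^2}{\Gamma(2-1/\lambda)\Gamma(1/\lambda)},\qquad V_{2,\lambda}=\frac{(1+1/\lambda)\psi_1(1+1/\lambda)-1}{\lambda^3}.$$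
   Context: $\mathrm{APD}_\lambda(\theta_1,\theta_2,\mu,\sigma)$, for $\theta_1\in(0,1)$, $\theta_2>0$, $\mu\in\mathbb{R}$, $\sigma>0$, is the distribution on $\mathbb{R}$ with density $f_\lambda(x\mid\theta_1,\theta_2,\mu,\sigma)=\frac{(\delta_{\theta_1,\theta_2}/\lambda)^{1/\theta_2}}{\sigma\Gamma(1+1/\theta_2)}\exp\left(-\frac1\lambda\frac{\delta_{\theta_1,\theta_2}}{A_{\theta_1,\theta_2}(y)}|y|^{\theta_2}\right)$, $y=(x-\mu)/\sigma$, where $\delta_{\theta_1,\theta_2}=\frac{2\theta_1^{\theta_2}(1-\theta_1)^{\theta_2}}{\theta_1^{\theta_2}+(1-\theta_1)^{\theta_2}}$ and $A_{\theta_1,\theta_2}(y)=\theta_1^{\theta_2}$ if $y<0$, $(1-\theta_1)^{\theta_2}$ if $y>0$. The $o(1)$ terms are deterministic sequences tending to $0$; $n$ is large enough that $\theta_{1,n}\in(0,1)$ and $\theta_{2,n}>0$. Estimators (computed from $X_1,\dots,X_n$): $\hat\mu_\lambda$ is the sample median if $\lambda=1$ (central order statistic if $n$ is odd, arithmetic mean of the two central order statistics if $n$ is even), and for $\lambda>1$ it is the unique solution $m$ of $\sum_{i=1}^n|X_i-m|^{\lambda-1}\mathrm{sign}(X_i-m)=0$ (the sample mean when $\lambda=2$). $\hat\sigma_\lambda=\left(\frac1n\sum_{i=1}^n|X_i-\hat\mu_\lambda|^\lambda\right)^{1/\lambda}$. With $\hat Y_i=\hat\sigma_\lambda^{-1}(X_i-\hat\mu_\lambda)$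 and the convention $|y|^\lambda\log|y|=0$ at $y=0$: $S_\lambda=\frac1n\sum_{i=1}^n|\hat Y_i|^\lambda\mathrm{sign}(\hat Y_i)$ and $K_\lambda=\frac1n\sum_{i=1}^n|\hat Y_i|^\lambda\log|\hat Y_i|$. $\psi=(\log\Gamma)'$ is the digamma function and $\psi_1=\psi'$ the trigamma function. Put $V_S=1+\lambda-\frac{\lambda^2}{\Gamma(2-1/\lambda)\Gamma(1/\lambda)}$, $E_K=\frac{\lambda+\log\lambda+\psi(1/\lambda)}{\lambda}$, $V_K=\frac{(1+1/\lambda)\psi_1(1+1/\lambda)-1}{\lambda}$. Then $Z^*(S_\lambda)=\sqrt n\,V_S^{-1/2}S_\lambda$ and $Z^*(K_\lambda)=\sqrt n\,V_K^{-1/2}(K_\lambda-E_K)$. $\chi_2^2(\xi)$ is the noncentral chi-square distribution with 2 degrees of freedom and noncentrality parameter $\xi$ (law of $\|N\|^2$ for $N\sim\mathcal N_2(m,I_2)$ with $\|m\|^2=\xi$); $\xrightarrow{\mathcal D}$ is convergence in distribution. *)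

theory Defs
  imports "HOL-Probability.Probability"
begin

section \<open>The asymmetric power distribution\<close>

definition apd_delta :: "real \<Rightarrow> real \<Rightarrow> real" where
  "apd_delta t1 t2 =
     2 * t1 powr t2 * (1 - t1) powr t2 / (t1 powr t2 + (1 - t1) powr t2)"

text \<open>The value at \<open>y = 0\<close> is immaterial: in the density it is multiplied by
  \<open>\<bar>0\<bar> powr t2 = 0\<close>.\<close>

definition apd_A :: "real \<Rightarrow> real \<Rightarrow> real \<Rightarrow> real" where
  "apd_A t1 t2 y = (if y < 0 then t1 powr t2 else (1 - t1) powr t2)"

definition apd_density :: "real \<Rightarrow> real \<Rightarrow> real \<Rightarrow> real \<Rightarrow> real \<Rightarrow> real \<Rightarrow> real" where
  "apd_density lam t1 t2 mu sig x =
     (let y = (x - mu) / sig in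
       (apd_delta t1 t2 / lam) powr (1 / t2) / (sig * Gamma (1 + 1 / t2)) *
       exp (- (1 / lam) * (apd_delta t1 t2 / apd_A t1 t2 y) * \<bar>y\<bar> powr t2))"

definition apd_sample ::
  "'a measure \<Rightarrow> nat \<Rightarrow> (nat \<Rightarrow> 'a \<Rightarrow> real) \<Rightarrow> real \<Rightarrow> real \<Rightarrow> real \<Rightarrow> real \<Rightarrow> real \<Rightarrow> bool" where
  "apd_sample M n X lam t1 t2 mu sig \<longleftrightarrow>
     prob_space M \<and>
     prob_space.indep_vars M (\<lambda>_. borel) X {1..n} \<and>
     (\<forall>i\<in>{1..n}. distributed M lborel (X i)
                   (\<lambda>x. ennreal (apd_density lam t1 t2 mu sig x)))"


section \<open>Estimators and statistics\<close>

text \<open>A data set is a function \<open>x\<close> on the indices \<open>1, \<dots>, n\<close>; values elsewhere are ignored.\<close>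

definition sample_median :: "nat \<Rightarrow> (nat \<Rightarrow> real) \<Rightarrow> real" where
  "sample_median n x =
     (let xs = sort (map x [1..<Suc n]) in
       if odd n then xs ! (n div 2) else (xs ! (n div 2 - 1) + xs ! (n div 2)) / 2)"

definition mu_hat :: "real \<Rightarrow> nat \<Rightarrow> (nat \<Rightarrow> real) \<Rightarrow> real" where
  "mu_hat lam n x =
     (if lam = 1 then sample_median n x
      else (THE m. (\<Sum>i=1..n. \<bar>x i - m\<bar> powr (lam - 1) * sgn (x i - m)) = 0))"

definition sigma_hat :: "real \<Rightarrow> nat \<Rightarrow> (nat \<Rightarrow> real) \<Rightarrow> real" where
  "sigma_hat lam n x =
     (1 / real n * (\<Sum>i=1..n. \<bar>x i - mu_hat lam n x\<bar> powr lam)) powr (1 / lam)"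

definition Y_hat :: "real \<Rightarrow> nat \<Rightarrow> (nat \<Rightarrow> real) \<Rightarrow> nat \<Rightarrow> real" where
  "Y_hat lam n x i = (x i - mu_hat lam n x) / sigma_hat lam n x"

definition S_stat :: "real \<Rightarrow> nat \<Rightarrow> (nat \<Rightarrow> real) \<Rightarrow> real" where
  "S_stat lam n x =
     1 / real n * (\<Sum>i=1..n. \<bar>Y_hat lam n x i\<bar> powr lam * sgn (Y_hat lam n x i))"

text \<open>Since \<open>0 powr lam = 0\<close>, the summand below is \<open>0\<close> when \<open>Y_hat lam n x i = 0\<close>.\<close>

definition K_stat :: "real \<Rightarrow> nat \<Rightarrow> (nat \<Rightarrow> real) \<Rightarrow> real" where
  "K_stat lam n x =
     1 / real n * (\<Sum>i=1..n. \<bar>Y_hat lam n x i\<bar> powr lam * ln \<bar>Y_hat lam n x i\<bar>)"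

text \<open>In the library, \<open>Digamma\<close> is the digamma function and \<open>Polygamma 1\<close> its derivative,
  the trigamma function.\<close>

definition V_S :: "real \<Rightarrow> real" where
  "V_S lam = 1 + lam - lam\<^sup>2 / (Gamma (2 - 1 / lam) * Gamma (1 / lam))"

definition E_K :: "real \<Rightarrow> real" where
  "E_K lam = (lam + ln lam + Digamma (1 / lam)) / lam"

definition V_K :: "real \<Rightarrow> real" where
  "V_K lam = ((1 + 1 / lam) * Polygamma 1 (1 + 1 / lam) - 1) / lam"

definition Z_S :: "real \<Rightarrow> nat \<Rightarrow> (nat \<Rightarrow> real) \<Rightarrow> real" where
  "Z_S lam n x = sqrt (real n) * V_S lam powr (- 1 / 2) * S_stat lam n x"

definition Z_K :: "real \<Rightarrow> nat \<Rightarrow> (nat \<Rightarrow> real) \<Rightarrow> real" where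
  "Z_K lam n x = sqrt (real n) * V_K lam powr (- 1 / 2) * (K_stat lam n x - E_K lam)"

definition V1 :: "real \<Rightarrow> real" where
  "V1 lam = 4 * (1 + lam) - 4 * lam\<^sup>2 / (Gamma (2 - 1 / lam) * Gamma (1 / lam))"

definition V2 :: "real \<Rightarrow> real" where
  "V2 lam = ((1 + 1 / lam) * Polygamma 1 (1 + 1 / lam) - 1) / lam ^ 3"


section \<open>Limit laws and convergence in distribution\<close>

text \<open>The library's \<open>weak_conv_m\<close> covers laws on the real line only. For random vectors we use
  convergence of the integrals of bounded continuous functions.\<close>

definition weak_conv_vec :: "(nat \<Rightarrow> (real ^ 'n) measure) \<Rightarrow> (real ^ 'n) measure \<Rightarrow> bool" where
  "weak_conv_vec N_seq N \<longleftrightarrow>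
     (\<forall>f :: real ^ 'n \<Rightarrow> real. continuous_on UNIV f \<longrightarrow> bounded (range f) \<longrightarrow>
        (\<lambda>n. \<integral>x. f x \<partial>N_seq n) \<longlonglongrightarrow> (\<integral>x. f x \<partial>N))"

text \<open>The normal law with mean \<open>m\<close> and (positive definite) covariance matrix \<open>C\<close>.\<close>

definition mv_normal :: "real ^ 'n \<Rightarrow> real ^ 'n ^ 'n \<Rightarrow> (real ^ 'n) measure" where
  "mv_normal m C = density lborel (\<lambda>x. ennreal
     (exp (- ((x - m) \<bullet> (matrix_inv C *v (x - m))) / 2) / sqrt ((2 * pi) ^ CARD('n) * det C)))"

text \<open>The law of \<open>\<parallel>N\<parallel>\<^sup>2\<close> for a normal \<open>N\<close> in the plane with identity covariance and a mean of
  squared norm \<open>xi\<close>. The definition fixes one such mean; the lemma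
  \<open>distr_norm_squared_mv_normal\<close> below shows that every other choice gives the same law.\<close>

definition noncentral_chisq2 :: "real \<Rightarrow> real measure" where
  "noncentral_chisq2 xi =
     distr (mv_normal (vector [sqrt xi, 0] :: real ^ 2) (mat 1)) borel (\<lambda>x. (norm x)\<^sup>2)"

lemma matrix_inv_mat_1: "matrix_inv (mat 1 :: real ^ 'n ^ 'n) = mat 1"
  by (simp add: matrix_inv_def)

lemma mv_normal_mat_1:
  fixes m :: "real ^ 'n"
  shows "mv_normal m (mat 1) =
    density lborel (\<lambda>x. ennreal (exp (- (norm (x - m))\<^sup>2 / 2) / sqrt ((2 * pi) ^ CARD('n))))"
  by (simp add: mv_normal_def matrix_inv_mat_1 power2_norm_eq_inner)

lemma distr_lborel_orthogonal:
  fixes T :: "real ^ 'n::{finite,wellorder} \<Rightarrow> real ^ 'n::_"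
  assumes T: "orthogonal_transformation T"
  shows "distr lborel borel T = lborel"
proof (rule lborel_eqI[symmetric])
  have lin: "linear T" and bij: "bij T"
    using T by (auto simp: orthogonal_transformation_linear orthogonal_transformation_bij)
  have [measurable]: "T \<in> borel_measurable borel"
    using lin by (intro borel_measurable_continuous_onI linear_continuous_on) (simp add: linear_linear)
  fix l u :: "real ^ 'n::_" assume le: "\<And>b. b \<in> Basis \<Longrightarrow> l \<bullet> b \<le> u \<bullet> b"
  have T': "orthogonal_transformation (inv T)"
    using T by (rule orthogonal_transformation_inv)
  have im: "T -` box l u = inv T ` box l u"
    using bij by (simp add: bij_vimage_eq_inv_image)
  have lm: "box l u \<in> lmeasurable" by simp
  have lm': "inv T ` box l u \<in> lmeasurable"
    using T' lm by (rule measurable_orthogonal_image)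
  have sb: "T -` box l u \<in> sets borel"
    using measurable_sets[of T borel borel "box l u"] by simp
  have "emeasure (distr lborel borel T) (box l u) = emeasure lborel (T -` box l u)"
    by (subst emeasure_distr) simp_all
  also have "\<dots> = emeasure lebesgue (inv T ` box l u)"
    using sb by (simp add: im)
  also have "\<dots> = ennreal (measure lebesgue (inv T ` box l u))"
    using lm' by (simp add: emeasure_eq_measure2 fmeasurableD2 emeasure_eq_ennreal_measure)
  also have "\<dots> = ennreal (measure lebesgue (box l u))"
    using measure_orthogonal_image[OF T' lm] by simp
  also have "\<dots> = ennreal (\<Prod>b\<in>Basis. (u - l) \<bullet> b)"
    using le by (simp add: measure_lborel_box_eq)
  finally show "emeasure (distr lborel borel T) (box l u) = (\<Prod>b\<in>Basis. (u - l) \<bullet> b)" .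
qed simp

lemma distr_norm_squared_mv_normal:
  fixes m :: "real ^ 2"
  shows "distr (mv_normal m (mat 1)) borel (\<lambda>x. (norm x)\<^sup>2) = noncentral_chisq2 ((norm m)\<^sup>2)"
proof -
  define e where "e = (vector [norm m, 0] :: real ^ 2)"
  have "norm e = norm m"
    by (simp add: e_def norm_vec_def L2_set_def UNIV_2)
  then obtain T where T: "orthogonal_transformation T" and Tm: "T m = e"
    using orthogonal_transformation_exists[of m e] by metis
  have lin: "linear T"
    using T by (rule orthogonal_transformation_linear)
  have [measurable]: "T \<in> borel_measurable borel"
    using lin by (intro borel_measurable_continuous_onI linear_continuous_on) (simp add: linear_linear)
  have nT: "norm (T x) = norm x" for x
    using T by (rule orthogonal_transformation_norm)
  have nd: "norm (T x - e) = norm (x - m)" for x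
    using nT[of "x - m"] lin Tm by (simp add: linear_diff)
  define g where "g = (\<lambda>(c::real^2) x. ennreal (exp (- (norm (x - c))\<^sup>2 / 2) / sqrt ((2 * pi)\<^sup>2)))"
  have [measurable]: "g c \<in> borel_measurable borel" for c
    unfolding g_def by measurable
  have mv: "mv_normal c (mat 1) = density lborel (g c)" for c
    by (simp add: mv_normal_mat_1 g_def)
  have "density lborel (g e) = density (distr lborel borel T) (g e)"
    using T by (simp add: distr_lborel_orthogonal)
  also have "\<dots> = distr (density lborel (\<lambda>x. g e (T x))) borel T"
    by (rule density_distr) measurable
  also have "(\<lambda>x. g e (T x)) = g m"
    by (simp add: g_def nd)
  finally have "distr (density lborel (g e)) borel (\<lambda>x. (norm x)\<^sup>2) =
      distr (density lborel (g m)) borel ((\<lambda>x. (norm x)\<^sup>2) \<circ> T)"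
    by (simp add: distr_distr)
  then show ?thesis
    by (simp add: noncentral_chisq2_def mv nT comp_def flip: e_def)
qed

end

theory Submission
  imports Defs "HOL-Real_Asymp.Real_Asymp"
begin

text \<open>
  Everything is computed directly under the local alternatives, without contiguity. After
  standardisation the observations have density proportional to \<open>q n\<close>, and
  \<open>sqrt n * (q n - pker)\<close> tends to \<open>score * pker\<close> with an integrable majorant, where
  \<open>pker y = exp (- \<bar>y\<bar>\<^sup>\<lambda> / \<lambda>)\<close> is the null kernel. For a monotone function \<open>f\<close> of polynomial growth,
  the process \<open>t \<mapsto> n\<^bsup>-1/2\<^esup> (\<Sum>i. f (Y\<^sub>i - t / sqrt n) - f (Y\<^sub>i))\<close> is monotone in \<open>t\<close> and converges
  pointwise in probability to \<open>- t * E0 (f * psi)\<close>, hence uniformly on compact sets. Applied to the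
  estimating function \<open>psi\<close> of the location, this yields the expansion of the estimator (the median
  included); applied to monotone pieces of the summands, it shows that the two statistics are, up to
  \<open>o\<^sub>P(1)\<close>, normalised sums of the influence functions \<open>sfun\<close> and \<open>kfun\<close>. These are the residuals of
  the score functions after projection on the scores of location and scale, so that means and variances
  of the limit are read off from Gamma integrals. A triangular central limit theorem for characteristic
  functions and the Cramer-Wold device finish the proof.
\<close>

subsection \<open>Weak convergence of random vectors\<close>

text \<open>For \<open>lam = 1\<close> the location estimator is the median and \<open>psi\<close>
  is the sign function, so the summands cannot be expanded by Taylor's formula. Expectations can: a
  shift of the argument of \<open>f\<close> is a shift of the kernel, and \<open>psi\<close> is
  minus the logarithmic derivative of \<open>pker\<close> off the origin. This is the source of the
  slope \<open>E0 (f * psi)\<close>, for discontinuous \<open>f\<close> as well. Parity decides what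
  survives: \<open>gfun\<close> and \<open>psi\<close> are odd, \<open>hfun\<close> and the scale
  score are even. To first order, estimating the location therefore affects only the first
  statistic; estimating the scale affects only the second, because the summands of the first are
  centred; each statistic responds to just one of \<open>d1\<close> and \<open>d2\<close>, and the
  two limits are uncorrelated. The factor 2 in the score is 4 / 2: the log-odds have slope 4 at 1 /
  2, and the weight 2 / (1 + exp (- x)) has slope 1 / 2 at 0.\<close>

inductive trig_poly :: "(real ^ 'n \<Rightarrow> real) \<Rightarrow> bool" where
  cos: "trig_poly (\<lambda>x. c * cos (a \<bullet> x + b))"
| add: "trig_poly f \<Longrightarrow> trig_poly g \<Longrightarrow> trig_poly (\<lambda>x. f x + g x)"

lemma trig_poly_const: "trig_poly (\<lambda>x. c)"
  using trig_poly.cos[of c 0 0] by simp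

lemma trig_poly_sum:
  "(\<And>i. i \<in> I \<Longrightarrow> trig_poly (f i)) \<Longrightarrow> trig_poly (\<lambda>x. \<Sum>i\<in>I. f i x)"
  by (induction I rule: infinite_finite_induct) (auto intro: trig_poly.add trig_poly_const)

text \<open>The product of two cosines is half the sum of the cosines of the sum and the difference
  of their arguments. Hence trigonometric polynomials form an algebra, and polynomials may be
  composed with sines.\<close>

lemma trig_poly_mult:
  assumes "trig_poly f" "trig_poly g"
  shows "trig_poly (\<lambda>x. f x * g x)"
  using assms(1)
proof induction
  case (cos c a b)
  show ?case
    using assms(2)
  proof induction
    case (cos c' a' b')
    have "(\<lambda>x. c * cos (a \<bullet> x + b) * (c' * cos (a' \<bullet> x + b'))) =
      (\<lambda>x. c * c' / 2 * cos ((a - a') \<bullet> x + (b - b')) + c * c' / 2 * cos ((a + a') \<bullet> x + (b + b')))"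
    proof
      fix x
      have 1: "(a - a') \<bullet> x + (b - b') = (a \<bullet> x + b) - (a' \<bullet> x + b')"
        and 2: "(a + a') \<bullet> x + (b + b') = (a \<bullet> x + b) + (a' \<bullet> x + b')"
        by (simp_all add: inner_diff_left inner_add_left)
      show "c * cos (a \<bullet> x + b) * (c' * cos (a' \<bullet> x + b')) =
        c * c' / 2 * cos ((a - a') \<bullet> x + (b - b')) + c * c' / 2 * cos ((a + a') \<bullet> x + (b + b'))"
        unfolding 1 2 cos_add cos_diff by (simp add: field_simps)
    qed
    then show ?case by (simp only:) (intro trig_poly.intros)
  next
    case (add f g)
    then show ?case by (simp add: distrib_left trig_poly.add)
  qed
next
  case (add f g)
  then show ?case by (simp add: distrib_right trig_poly.add)
qed

text \<open>A polynomial arises from linear functionals by sums and products. A linear functional of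
  the vector of sines is a combination of sines, and each sine is a cosine with phase - pi /
  2.\<close>

lemma trig_poly_compose:
  fixes g :: "real ^ 'n \<Rightarrow> real"
  assumes "real_polynomial_function g"
  shows "trig_poly (\<lambda>x :: real ^ 'n. g (\<chi> j. sin (c * x $ j)))"
  using assms
proof induction
  case (linear f)
  interpret bounded_linear f by fact
  have sin: "trig_poly (\<lambda>x::real^'n. f (axis j 1) * sin (c * x $ j))" for j
  proof -
    have "(\<lambda>x::real^'n. f (axis j 1) * sin (c * x $ j)) =
        (\<lambda>x. f (axis j 1) * cos ((c *\<^sub>R axis j 1) \<bullet> x + (- pi / 2)))"
      by (simp add: inner_axis' sin_cos_eq fun_eq_iff)
         (metis cos_minus minus_diff_eq)
    then show ?thesis by (simp only:) (rule trig_poly.cos)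
  qed
  have "f (\<chi> j. sin (c * x $ j)) = (\<Sum>j\<in>UNIV. f (axis j 1) * sin (c * x $ j))" for x :: "real^'n"
  proof -
    have "(\<chi> j. sin (c * x $ j)) = (\<Sum>j\<in>UNIV. sin (c * x $ j) *\<^sub>R axis j 1)"
      by (simp add: vec_eq_iff axis_def if_distrib cong: if_cong)
    then show ?thesis by (simp add: sum scaleR mult.commute)
  qed
  then show ?case using sin by (simp add: trig_poly_sum)
next
  case (const c)
  then show ?case by (rule trig_poly_const)
next
  case (add f g)
  then show ?case by (auto intro: trig_poly.add)
next
  case (mult f g)
  then show ?case by (auto intro: trig_poly_mult)
qed

text \<open>The sines of the rescaled coordinates are inverted by \<open>arcsin\<close> on the cube and bounded everywhere, so a
  polynomial approximation on \<open>[-1, 1]\<^sup>n\<close> yields a trigonometric one that stays bounded off the cube.\<close>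

lemma trig_poly_approx:
  fixes f :: "real ^ 'n \<Rightarrow> real"
  assumes f: "continuous_on UNIV f" and B: "\<And>x. \<bar>f x\<bar> \<le> B" and "L > 0" "e > 0"
  obtains q where "trig_poly q" "\<And>x. \<bar>q x\<bar> \<le> B + e" "\<And>x. (\<And>j. \<bar>x $ j\<bar> \<le> L) \<Longrightarrow> \<bar>f x - q x\<bar> \<le> e"
proof -
  define F where "F = (\<lambda>u::real^'n. f (\<chi> j. 2 * L / pi * arcsin (u $ j)))"
  let ?S = "cbox (\<chi> j. -1) (\<chi> j. 1) :: (real^'n) set"
  have cont: "continuous_on ?S F"
    unfolding F_def
    by (rule continuous_on_compose2[OF f])
       (auto intro!: continuous_intros simp: mem_box_cart)
  obtain g where g: "real_polynomial_function g" "\<And>x. x \<in> ?S \<Longrightarrow> \<bar>F x - g x\<bar> < e"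
    using Stone_Weierstrass_real_polynomial_function[OF compact_cbox cont \<open>e > 0\<close>] by metis
  define q where "q = (\<lambda>x::real^'n. g (\<chi> j. sin (pi / (2 * L) * x $ j)))"
  have S: "(\<chi> j. sin (pi / (2 * L) * x $ j)) \<in> ?S" for x :: "real^'n"
    by (simp add: mem_box_cart)
  show thesis
  proof
    show "trig_poly q" unfolding q_def by (rule trig_poly_compose) fact
    show "\<bar>q x\<bar> \<le> B + e" for x
    proof -
      have "\<bar>F y\<bar> \<le> B" for y unfolding F_def by (rule B)
      from this[of "\<chi> j. sin (pi / (2 * L) * x $ j)"] g(2)[OF S[of x]] show ?thesis
        unfolding q_def by linarith
    qed
    fix x :: "real^'n" assume x: "\<And>j. \<bar>x $ j\<bar> \<le> L"
    have a: "arcsin (sin (pi / (2 * L) * x $ j)) = pi / (2 * L) * x $ j" for j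
    proof (rule arcsin_sin)
      have "\<bar>pi / (2 * L) * x $ j\<bar> \<le> pi / (2 * L) * L"
        using x[of j] \<open>L > 0\<close> unfolding abs_mult by (intro mult_mono) auto
      then have "\<bar>pi / (2 * L) * x $ j\<bar> \<le> pi / 2" using \<open>L > 0\<close> by simp
      then show "- (pi / 2) \<le> pi / (2 * L) * x $ j" "pi / (2 * L) * x $ j \<le> pi / 2"
        by linarith+
    qed
    have "F (\<chi> j. sin (pi / (2 * L) * x $ j)) = f x"
      using \<open>L > 0\<close> unfolding F_def by (simp only: vec_lambda_beta a) simp
    then show "\<bar>f x - q x\<bar> \<le> e"
      using g(2)[OF S[of x]] by (simp add: q_def)
  qed
qed

lemma trig_poly_measurable: "trig_poly f \<Longrightarrow> f \<in> borel_measurable borel"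
  by (induction rule: trig_poly.induct) auto

lemma integrable_trig_poly:
  fixes P :: "(real ^ 'n) measure"
  assumes P: "prob_space P" "sets P = sets borel" and "trig_poly f"
  shows "integrable P f"
  using assms(3)
proof induction
  case (cos c a b)
  interpret prob_space P by fact
  have [measurable]: "(\<lambda>x. c * cos (a \<bullet> x + b)) \<in> borel_measurable P"
    unfolding measurable_cong_sets[OF P(2) refl] by measurable
  have "\<bar>c * cos t\<bar> \<le> \<bar>c\<bar>" for t
    using abs_cos_le_one[of t] by (simp add: abs_mult mult_left_le)
  then show ?case
    by (intro integrable_const_bound[where B="\<bar>c\<bar>"]) auto
qed auto

text \<open>The integral of cos (a \<bullet> x + b) is the real part of iexp b times the
  characteristic function at \<open>a\<close>, so convergence of characteristic functions is all
  that a trigonometric polynomial can see.\<close>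

lemma trig_poly_integral_tendsto:
  fixes N :: "nat \<Rightarrow> (real ^ 'n) measure"
  assumes N: "\<And>n. prob_space (N n)" "\<And>n. sets (N n) = sets borel"
    and N': "prob_space N'" "sets N' = sets borel"
    and char: "\<And>a. (\<lambda>n. \<integral>x. iexp (a \<bullet> x) \<partial>N n) \<longlonglongrightarrow> (\<integral>x. iexp (a \<bullet> x) \<partial>N')"
    and f: "trig_poly f"
  shows "(\<lambda>n. \<integral>x. f x \<partial>N n) \<longlonglongrightarrow> (\<integral>x. f x \<partial>N')"
  using f
proof induction
  case (cos c a b)
  have eq: "(\<integral>x. c * cos (a \<bullet> x + b) \<partial>P) = c * Re (iexp b * (\<integral>x. iexp (a \<bullet> x) \<partial>P))"
    if "prob_space P" and s: "sets P = sets borel" for P :: "(real^'n) measure"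
  proof -
    interpret prob_space P by fact
    have [measurable]: "(\<lambda>x. iexp (a \<bullet> x)) \<in> borel_measurable P"
      unfolding measurable_cong_sets[OF s refl] by measurable
    have int: "integrable P (\<lambda>x. iexp (a \<bullet> x))"
      by (intro integrable_const_bound[where B=1]) (auto simp: norm_exp_i_times)
    have "iexp b * (\<integral>x. iexp (a \<bullet> x) \<partial>P) = (\<integral>x. iexp b * iexp (a \<bullet> x) \<partial>P)"
      by simp
    also have "Re \<dots> = (\<integral>x. Re (iexp b * iexp (a \<bullet> x)) \<partial>P)"
      using int by (subst integral_Re) auto
    also have "\<dots> = (\<integral>x. cos (a \<bullet> x + b) \<partial>P)"
      by (intro Bochner_Integration.integral_cong)
         (simp_all add: cos_add cis_conv_exp[symmetric] cis.simps algebra_simps)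
    finally show ?thesis by simp
  qed
  show ?case
    unfolding eq[OF N] eq[OF N'] by (intro tendsto_intros char)
next
  case (add f g)
  then show ?case
    using integrable_trig_poly[OF N] integrable_trig_poly[OF N']
    by (simp add: tendsto_add)
qed

text \<open>The multivariate continuity theorem, reduced to dimension one. Levy's theorem for the
  coordinates controls the mass outside a large cube; on the cube \<open>f\<close> is uniformly
  close to a trigonometric polynomial, whose integrals converge.\<close>

theorem weak_conv_vec_charI:
  fixes N :: "nat \<Rightarrow> (real ^ 'n) measure"
  assumes N: "\<And>n. prob_space (N n)" "\<And>n. sets (N n) = sets borel"
    and N': "prob_space N'" "sets N' = sets borel"
    and char: "\<And>a. (\<lambda>n. \<integral>x. iexp (a \<bullet> x) \<partial>N n) \<longlonglongrightarrow> (\<integral>x. iexp (a \<bullet> x) \<partial>N')"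
  shows "weak_conv_vec N N'"
  unfolding weak_conv_vec_def
proof (intro allI impI)
  fix f :: "real ^ 'n \<Rightarrow> real"
  assume f: "continuous_on UNIV f" and "bounded (range f)"
  then obtain B where B: "\<And>x. \<bar>f x\<bar> \<le> B" by (auto simp: bounded_iff)
  then have "B \<ge> 0" using abs_ge_zero order_trans by blast
  interpret N: prob_space "N n" for n by fact
  interpret N': prob_space N' by fact
  note [measurable_cong] = N(2) N'(2)
  have [measurable]: "f \<in> borel_measurable borel"
    by (rule borel_measurable_continuous_onI) fact
  \<comment> \<open>A continuous replacement for the indicator of \<bar>t\<bar> > L, so that weak
    convergence of the marginals applies to it. It vanishes up to \<open>L\<close> and equals 1 from
    L + 1 on.\<close>
  define c where "c = (\<lambda>L t. min 1 (max 0 (\<bar>t\<bar> - L)) :: real)"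
  have c: "0 \<le> c L t" "c L t \<le> 1" "\<bar>t\<bar> > L + 1 \<Longrightarrow> c L t = 1" for L t
    by (auto simp: c_def)
  have [measurable]: "c L \<in> borel_measurable borel" for L unfolding c_def by measurable
  have marg: "(\<lambda>n. \<integral>x. c L (x $ j) \<partial>N n) \<longlonglongrightarrow> (\<integral>x. c L (x $ j) \<partial>N')" for L j
  proof -
    have [measurable]: "(\<lambda>x::real^'n. x $ j) \<in> borel_measurable borel" by simp
    have ch: "char (distr P borel (\<lambda>x. x $ j)) t = (\<integral>x. iexp ((axis j t) \<bullet> x) \<partial>P)"
      if s[measurable_cong]: "sets P = sets borel" for P :: "(real^'n) measure" and t
      unfolding char_def by (subst integral_distr) (auto simp: inner_axis')
    have rd: "real_distribution (distr (N n) borel (\<lambda>x. x $ j))" 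
      "real_distribution (distr N' borel (\<lambda>x. x $ j))" for n
      by (auto intro!: N.real_distribution_distr N'.real_distribution_distr)
    have "weak_conv_m (\<lambda>n. distr (N n) borel (\<lambda>x. x $ j)) (distr N' borel (\<lambda>x. x $ j))"
      by (rule levy_continuity) (auto simp: rd ch N N' intro: char)
    then have "(\<lambda>n. \<integral>t. c L t \<partial>distr (N n) borel (\<lambda>x. x $ j)) \<longlonglongrightarrow> (\<integral>t. c L t \<partial>distr N' borel (\<lambda>x. x $ j))"
      by (rule weak_conv_imp_integral_bdd_continuous_conv[rotated 2, where B=1])
         (use rd c in \<open>auto simp: c_def intro!: continuous_intros\<close>)
    then show ?thesis by (simp add: integral_distr)
  qed
  define T where "T = (\<lambda>L x. \<Sum>j\<in>UNIV. c L ((x::real^'n) $ j))"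
  have [measurable]: "T L \<in> borel_measurable borel" for L unfolding T_def by measurable
  have cint: "integrable (N n) (\<lambda>x. c L (x $ j))" "integrable N' (\<lambda>x. c L (x $ j))" for n L j
    by (auto intro!: N.integrable_const_bound[where B=1] N'.integrable_const_bound[where B=1] simp: c)
  have Tint: "integrable (N n) (T L)" "integrable N' (T L)" for n L
    unfolding T_def using cint by auto
  have Tconv: "(\<lambda>n. \<integral>x. T L x \<partial>N n) \<longlonglongrightarrow> (\<integral>x. T L x \<partial>N')" for L
    unfolding T_def by (simp add: cint) (intro tendsto_sum marg)
  have "(\<lambda>k. \<integral>x. T (real k) x \<partial>N') \<longlonglongrightarrow> (\<integral>x. 0 \<partial>N')"
  proof (rule integral_dominated_convergence[where w="\<lambda>_. real CARD('n)"])
    show "AE x in N'. (\<lambda>k. T (real k) x) \<longlonglongrightarrow> 0"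
    proof (intro AE_I2)
      fix x :: "real ^ 'n"
      obtain K where K: "norm x \<le> real K" using real_arch_simple by blast
      have "T (real k) x = 0" if "k \<ge> K" for k
        unfolding T_def
      proof (intro sum.neutral ballI)
        fix j have "\<bar>x $ j\<bar> \<le> real k" using component_le_norm_cart[of x j] K that by linarith
        then show "c (real k) (x $ j) = 0" by (simp add: c_def)
      qed
      then show "(\<lambda>k. T (real k) x) \<longlonglongrightarrow> 0"
        by (intro tendsto_eventually) (auto simp: eventually_sequentially)
    qed
    show "AE x in N'. norm (T (real k) x) \<le> real CARD('n)" for k
    proof (intro AE_I2)
      fix x
      have "T (real k) x \<le> (\<Sum>j\<in>(UNIV::'n set). 1)" unfolding T_def by (intro sum_mono c)
      moreover have "T (real k) x \<ge> 0" unfolding T_def by (intro sum_nonneg c)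
      ultimately show "norm (T (real k) x) \<le> real CARD('n)" by simp
    qed
  qed auto
  then have T0: "(\<lambda>k. \<integral>x. T (real k) x \<partial>N') \<longlonglongrightarrow> 0" by simp
  show "(\<lambda>n. \<integral>x. f x \<partial>N n) \<longlonglongrightarrow> (\<integral>x. f x \<partial>N')"
  proof (rule LIMSEQ_I)
    fix r :: real assume "r > 0"
    \<comment> \<open>The errors add up to 2 * (e + (2 * B + 1) * e) + e, which is below 4 * e * (2
      * B + 4).\<close>
    define e where "e = min 1 (r / (4 * (2 * B + 4)))"
    have e: "e > 0" "e \<le> 1" "e * (2 * B + 4) \<le> r / 4"
    proof -
      show "e > 0" "e \<le> 1" using \<open>r > 0\<close> \<open>B \<ge> 0\<close> by (auto simp: e_def add_nonneg_pos)
      have "e * (2 * B + 4) \<le> r / (4 * (2 * B + 4)) * (2 * B + 4)"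
        using \<open>B \<ge> 0\<close> by (intro mult_right_mono) (auto simp: e_def)
      also have "\<dots> = r / 4" using \<open>B \<ge> 0\<close> by (simp add: field_simps add_nonneg_eq_0_iff)
      finally show "e * (2 * B + 4) \<le> r / 4" .
    qed
    obtain k where k: "(\<integral>x. T (real k) x \<partial>N') < e"
      using order_tendstoD(2)[OF T0 e(1)] by (auto simp: eventually_sequentially)
    obtain q where q: "trig_poly q" "\<And>x. \<bar>q x\<bar> \<le> B + e"
        "\<And>x. (\<And>j. \<bar>x $ j\<bar> \<le> real k + 1) \<Longrightarrow> \<bar>f x - q x\<bar> \<le> e"
      using trig_poly_approx[OF f B _ e(1), of "real k + 1"] by auto
    \<comment> \<open>On the cube the approximation error is \<open>e\<close>. Off the cube some
      coordinate pushes \<open>T\<close> to at least 1, and the crude bound 2 * B + e is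
      enough.\<close>
    have bound: "\<bar>f x - q x\<bar> \<le> e + (2 * B + 1) * T (real k) x" for x
    proof (cases "\<forall>j. \<bar>x $ j\<bar> \<le> real k + 1")
      case True
      moreover have "T (real k) x \<ge> 0" unfolding T_def by (intro sum_nonneg c)
      ultimately show ?thesis using q(3)[of x] \<open>B \<ge> 0\<close> by (smt (verit) mult_nonneg_nonneg)
    next
      case False
      then obtain j where "\<bar>x $ j\<bar> > real k + 1" by (auto simp: not_le)
      then have "1 = c (real k) (x $ j)" by (simp add: c)
      also have "\<dots> \<le> T (real k) x" unfolding T_def by (intro member_le_sum c) auto
      finally have "1 \<le> T (real k) x" .
      then have "2 * B + 1 \<le> (2 * B + 1) * T (real k) x" using \<open>B \<ge> 0\<close> by (simp add: mult_le_cancel_left1)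
      moreover have "\<bar>f x - q x\<bar> \<le> 2 * B + e" using q(2)[of x] B[of x] by linarith
      ultimately show ?thesis using e by linarith
    qed
    have [measurable]: "q \<in> borel_measurable borel" using q(1) by (rule trig_poly_measurable)
    have main: "\<bar>(\<integral>x. f x \<partial>P) - (\<integral>x. q x \<partial>P)\<bar> \<le> e + (2 * B + 1) * (\<integral>x. T (real k) x \<partial>P)"
      if "prob_space P" and s[measurable_cong]: "sets P = sets borel" and T: "integrable P (T (real k))" for P
    proof -
      interpret prob_space P by fact
      have i: "integrable P f" "integrable P q"
        using B by (auto intro!: integrable_const_bound[where B=B] integrable_trig_poly[OF that(1,2) q(1)])
      have "\<bar>(\<integral>x. f x \<partial>P) - (\<integral>x. q x \<partial>P)\<bar> = \<bar>\<integral>x. f x - q x \<partial>P\<bar>" using i by simp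
      also have "\<dots> \<le> (\<integral>x. \<bar>f x - q x\<bar> \<partial>P)" by simp
      also have "\<dots> \<le> (\<integral>x. e + (2 * B + 1) * T (real k) x \<partial>P)"
        using i T bound by (intro integral_mono) auto
      also have "\<dots> = e + (2 * B + 1) * (\<integral>x. T (real k) x \<partial>P)"
        using T by (simp add: prob_space)
      finally show ?thesis .
    qed
    have "eventually (\<lambda>n. (\<integral>x. T (real k) x \<partial>N n) < e) sequentially"
      using order_tendstoD(2)[OF Tconv k] .
    moreover have "(\<lambda>n. \<integral>x. q x \<partial>N n) \<longlonglongrightarrow> (\<integral>x. q x \<partial>N')"
      by (rule trig_poly_integral_tendsto[OF N N' char q(1)])
    then have "eventually (\<lambda>n. \<bar>(\<integral>x. q x \<partial>N n) - (\<integral>x. q x \<partial>N')\<bar> < e) sequentially"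
      using e(1) by (auto simp: tendsto_iff dist_real_def)
    ultimately have "eventually (\<lambda>n. norm ((\<integral>x. f x \<partial>N n) - (\<integral>x. f x \<partial>N')) < r) sequentially"
    proof eventually_elim
      case (elim n)
      have 1: "\<bar>(\<integral>x. f x \<partial>N n) - (\<integral>x. q x \<partial>N n)\<bar> \<le> e + (2 * B + 1) * e"
        using main[OF N Tint(1)[of n k]] elim(1) \<open>B \<ge> 0\<close>
        by (smt (verit) mult_left_mono)
      have 2: "\<bar>(\<integral>x. f x \<partial>N') - (\<integral>x. q x \<partial>N')\<bar> \<le> e + (2 * B + 1) * e"
        using main[OF N' Tint(2)[of k]] k \<open>B \<ge> 0\<close>
        by (smt (verit) mult_left_mono)
      have "2 * (e + (2 * B + 1) * e) + e < 4 * (e * (2 * B + 4))"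
        using e(1) \<open>B \<ge> 0\<close> by (simp add: algebra_simps add_pos_nonneg)
      also have "4 * (e * (2 * B + 4)) \<le> r" using e(3) by linarith
      finally have "2 * (e + (2 * B + 1) * e) + e < r" .
      moreover define D where "D = e + (2 * B + 1) * e"
      ultimately have "2 * D + e < r" by simp
      then show ?case using 1 2 elim(2) unfolding D_def[symmetric] real_norm_def by linarith
    qed
    then show "\<exists>no. \<forall>n\<ge>no. norm ((\<integral>x. f x \<partial>N n) - (\<integral>x. f x \<partial>N')) < r"
      by (auto simp: eventually_sequentially)
  qed
qed

section \<open>Elementary bounds for exponentials and logarithms\<close>

lemma power_le_fact_exp:
  fixes x :: real
  assumes "x \<ge> 0"
  shows "x ^ n \<le> fact n * exp x"
proof -
  have "x ^ n / fact n = (\<Sum>k\<in>{n}. inverse (fact k) * x ^ k)"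
    by (simp add: field_simps)
  also have "\<dots> \<le> (\<Sum>k. inverse (fact k) * x ^ k)"
    using assms by (intro sum_le_suminf summable_exp) auto
  also have "\<dots> = exp x" by (simp add: exp_def divide_inverse scaleR_conv_of_real)
  finally show ?thesis by (simp add: field_simps)
qed

lemma exp_abs_ln_le:
  fixes t r :: real
  assumes "t > 0" 
  shows "exp (r * \<bar>ln t\<bar>) \<le> t powr r + t powr (- r)"
  using assms by (cases "ln t \<ge> 0") (auto simp: powr_def)

text \<open>With u = r * \<bar>ln t\<bar>, the bound of u ^ j by j! * exp u trades a power of the
  logarithm for two powers of \<open>t\<close> with an arbitrarily small exponent.\<close>

lemma abs_ln_power_le:
  fixes t r :: real
  assumes "t > 0" "r > 0"
  shows "\<bar>ln t\<bar> ^ j \<le> fact j / r ^ j * (t powr r + t powr (- r))"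
proof -
  have "(r * \<bar>ln t\<bar>) ^ j \<le> fact j * exp (r * \<bar>ln t\<bar>)"
    using assms by (intro power_le_fact_exp) auto
  also have "\<dots> \<le> fact j * (t powr r + t powr (- r))"
    using assms by (intro mult_left_mono exp_abs_ln_le) auto
  finally show ?thesis using assms by (simp add: power_mult_distrib field_simps)
qed

lemma abs_exp_diff_le: "\<bar>exp a - exp b\<bar> \<le> \<bar>a - b\<bar> * exp (max a b)" for a b :: real
proof -
  have *: "exp a - exp b \<le> (a - b) * exp a" for a b :: real
  proof -
    have "exp a * (1 + (b - a)) \<le> exp a * exp (b - a)"
      by (intro mult_left_mono exp_ge_add_one_self) auto
    then show ?thesis by (simp add: exp_diff algebra_simps)
  qed
  show ?thesis
    using *[of a b] *[of b a] by (cases "a \<ge> b") (auto simp: max_def abs_if)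
qed

subsection \<open>Logarithmic moments of the Gamma distribution\<close>

text \<open>The \<open>j\<close>-th derivative of the Gamma function on the positive axis, as the
  differentiated Euler integral.\<close>

definition Gamma_ln :: "nat \<Rightarrow> real \<Rightarrow> real" where
  "Gamma_ln j a = (LINT t:{0<..}|lborel. t powr (a - 1) * ln t ^ j * exp (- t))"

lemma Gamma_integral_set:
  fixes a :: real
  assumes "a > 0"
  shows "set_integrable lborel {0<..} (\<lambda>t. t powr (a - 1) * exp (- t))"
    and "(LINT t:{0<..}|lborel. t powr (a - 1) * exp (- t)) = Gamma a"
proof -
  let ?f = "\<lambda>t::real. indicator {0<..} t *\<^sub>R (t powr (a - 1) * exp (- t))"
  have "(\<integral>\<^sup>+t. ennreal (?f t) \<partial>lborel) = (\<integral>\<^sup>+t. ennreal (indicator {0..} t * t powr (a - 1) / exp t) \<partial>lborel)"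
    by (intro nn_integral_cong) (auto simp: indicator_def exp_minus field_simps)
  also have "\<dots> = ennreal (Gamma a)" using Gamma_conv_nn_integral_real[OF assms] by simp
  finally have *: "(\<integral>\<^sup>+t. ennreal (?f t) \<partial>lborel) = ennreal (Gamma a)" .
  have "has_bochner_integral lborel ?f (Gamma a)"
    by (rule has_bochner_integral_nn_integral[OF _ _ _ *])
       (use assms in \<open>auto simp: Gamma_real_pos less_imp_le\<close>)
  then show "set_integrable lborel {0<..} (\<lambda>t. t powr (a - 1) * exp (- t))"
    and "(LINT t:{0<..}|lborel. t powr (a - 1) * exp (- t)) = Gamma a"
    unfolding set_integrable_def set_lebesgue_integral_def
    by (auto simp: has_bochner_integral_iff)
qed

lemma Gamma_ln_0: "a > 0 \<Longrightarrow> Gamma_ln 0 a = Gamma a"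
  by (simp add: Gamma_ln_def Gamma_integral_set)

lemma set_integrable_Gamma_abs_ln:
  fixes a :: real
  assumes "a > 0"
  shows "set_integrable lborel {0<..} (\<lambda>t. t powr (a - 1) * \<bar>ln t\<bar> ^ j * exp (- t))"
proof -
  \<comment> \<open>Both shapes a - r and a + r of the majorising Gamma integrals must be
    positive.\<close>
  define r where "r = a / 2"
  have r: "r > 0" "a - r > 0" "a + r > 0" using assms by (auto simp: r_def)
  have i: "set_integrable lborel {0<..} (\<lambda>t. fact j / r ^ j *
      (t powr (a + r - 1) * exp (- t) + t powr (a - r - 1) * exp (- t)))"
    by (intro set_integrable_mult_right set_integral_add Gamma_integral_set r)
  show ?thesis
  proof (rule set_integrable_bound[OF i])
    show "set_borel_measurable lborel {0<..} (\<lambda>t. t powr (a - 1) * \<bar>ln t\<bar> ^ j * exp (- t))"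
      unfolding set_borel_measurable_def by measurable
    show "AE t\<in>{0<..} in lborel. norm (t powr (a - 1) * \<bar>ln t\<bar> ^ j * exp (- t)) \<le>
       norm (fact j / r ^ j * (t powr (a + r - 1) * exp (- t) + t powr (a - r - 1) * exp (- t)))"
    proof (intro AE_I2 impI)
      fix t :: real assume "t \<in> {0<..}"
      then have t: "t > 0" by simp
      have "t powr (a - 1) * \<bar>ln t\<bar> ^ j * exp (- t) \<le>
          t powr (a - 1) * (fact j / r ^ j * (t powr r + t powr (- r))) * exp (- t)"
        using t r by (intro mult_right_mono mult_left_mono abs_ln_power_le) auto
      also have "\<dots> = fact j / r ^ j * (t powr (a + r - 1) * exp (- t) + t powr (a - r - 1) * exp (- t))"
        using t by (simp add: algebra_simps flip: powr_add)
      finally show "norm (t powr (a - 1) * \<bar>ln t\<bar> ^ j * exp (- t)) \<le>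
       norm (fact j / r ^ j * (t powr (a + r - 1) * exp (- t) + t powr (a - r - 1) * exp (- t)))"
        using t r by (simp add: abs_mult)
    qed
  qed
qed

lemma set_integrable_Gamma_ln:
  fixes a :: real
  assumes "a > 0"
  shows "set_integrable lborel {0<..} (\<lambda>t. t powr (a - 1) * ln t ^ j * exp (- t))"
  by (rule set_integrable_bound[OF set_integrable_Gamma_abs_ln[OF assms]])
     (auto simp: set_borel_measurable_def abs_mult power_abs intro!: AE_I2)

text \<open>Differentiation under the integral sign along an arbitrary null sequence of increments.
  As long as they stay below r = a / 2, the difference quotients of \<open>t powr b\<close> are
  dominated by \<bar>ln t\<bar> times the powers with exponents a + r - 1 and a - r - 1, whose Gamma
  integrals converge.\<close>

lemma has_field_derivative_Gamma_ln:
  assumes a: "a > 0"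
  shows "(Gamma_ln j has_real_derivative Gamma_ln (Suc j) a) (at a)"
  unfolding DERIV_def tendsto_at_iff_sequentially
proof (intro allI impI)
  fix H :: "nat \<Rightarrow> real" assume H: "\<forall>i. H i \<in> UNIV - {0}" and H0: "H \<longlonglongrightarrow> 0"
  define r where "r = a / 2"
  have r: "r > 0" "a - r > 0" "a + r > 0" using a by (auto simp: r_def)
  obtain N where N: "\<And>i. i \<ge> N \<Longrightarrow> \<bar>H i\<bar> < r"
    using tendstoD[OF H0 r(1)] by (auto simp: eventually_sequentially dist_real_def)
  \<comment> \<open>Dropping the first \<open>N\<close> increments makes the majorant valid for
    every index.\<close>
  define K where "K = (\<lambda>i. H (i + N))"
  have K: "K \<longlonglongrightarrow> 0" "\<And>i. K i \<noteq> 0" "\<And>i. \<bar>K i\<bar> < r"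
    using LIMSEQ_ignore_initial_segment[OF H0] H N by (auto simp: K_def)
  define f where "f = (\<lambda>b t::real. t powr (b - 1) * ln t ^ j * exp (- t))"
  define g where "g = (\<lambda>i t. indicator {0<..} t * ((f (a + K i) t - f a t) / K i))"
  define D where "D = (\<lambda>t. indicator {0<..} t *\<^sub>R (t powr (a - 1) * ln t ^ Suc j * exp (- t)))"
  define w where "w = (\<lambda>t. indicator {0<..} t *\<^sub>R (t powr (a + r - 1) * \<bar>ln t\<bar> ^ Suc j * exp (- t)
    + t powr (a - r - 1) * \<bar>ln t\<bar> ^ Suc j * exp (- t)))"
  have diff: "(Gamma_ln j (a + K i) - Gamma_ln j a) / K i = (\<integral>t. g i t \<partial>lborel)" for i
  proof -
    have "a + K i > 0" using K(3)[of i] r by linarith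
    then have "Gamma_ln j (a + K i) - Gamma_ln j a = (LINT t:{0<..}|lborel. f (a + K i) t - f a t)"
      unfolding Gamma_ln_def f_def using a by (subst set_integral_diff) (auto intro: set_integrable_Gamma_ln)
    then show ?thesis by (simp add: g_def set_lebesgue_integral_def)
  qed
  have lim: "(\<lambda>i. \<integral>t. g i t \<partial>lborel) \<longlonglongrightarrow> (\<integral>t. D t \<partial>lborel)"
  proof (rule integral_dominated_convergence[where w=w])
    show "integrable lborel w"
      unfolding w_def set_integrable_def[symmetric]
      by (intro set_integral_add set_integrable_Gamma_abs_ln r)
    show "AE t in lborel. (\<lambda>i. g i t) \<longlonglongrightarrow> D t"
    proof (intro AE_I2)
      fix t :: real
      show "(\<lambda>i. g i t) \<longlonglongrightarrow> D t"
      proof (cases "t > 0")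
        case True
        then have "((\<lambda>b. f b t) has_real_derivative t powr (a - 1) * ln t ^ Suc j * exp (- t)) (at a)"
          unfolding f_def by (auto intro!: derivative_eq_intros)
        then have "((\<lambda>h. (f (a + h) t - f a t) / h) \<longlongrightarrow> t powr (a - 1) * ln t ^ Suc j * exp (- t)) (at 0)"
          by (simp add: DERIV_def)
        then have "(\<lambda>i. (f (a + K i) t - f a t) / K i) \<longlonglongrightarrow> t powr (a - 1) * ln t ^ Suc j * exp (- t)"
          using K(1,2) unfolding tendsto_at_iff_sequentially comp_def by simp
        then show ?thesis using True by (simp add: g_def D_def)
      qed (simp add: g_def D_def)
    qed
    show "AE t in lborel. norm (g i t) \<le> w t" for i
    proof (intro AE_I2)
      fix t :: real
      show "norm (g i t) \<le> w t"
      proof (cases "t > 0")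
        case True
        have "\<bar>exp (K i * ln t) - exp 0\<bar> \<le> \<bar>K i * ln t - 0\<bar> * exp (max (K i * ln t) 0)"
          by (rule abs_exp_diff_le)
        also have "\<dots> \<le> \<bar>K i * ln t\<bar> * exp (r * \<bar>ln t\<bar>)"
        proof -
          have "K i * ln t \<le> \<bar>K i\<bar> * \<bar>ln t\<bar>" by (simp flip: abs_mult)
          also have "\<dots> \<le> r * \<bar>ln t\<bar>" using K(3)[of i] by (intro mult_right_mono) auto
          finally show ?thesis using r by (intro mult_mono) auto
        qed
        also have "\<dots> \<le> \<bar>K i * ln t\<bar> * (t powr r + t powr (- r))"
          using True by (intro mult_left_mono exp_abs_ln_le) auto
        finally have *: "\<bar>exp (K i * ln t) - 1\<bar> \<le> \<bar>K i\<bar> * (\<bar>ln t\<bar> * (t powr r + t powr (- r)))"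
          by (simp add: abs_mult mult.assoc)
        have "(f (a + K i) t - f a t) / K i = t powr (a - 1) * ln t ^ j * exp (- t) * ((exp (K i * ln t) - 1) / K i)"
        proof -
          have "t powr (a + K i - 1) = t powr (a - 1) * exp (K i * ln t)"
            using True by (simp add: powr_def flip: exp_add) (simp add: algebra_simps)
          then show ?thesis unfolding f_def by (simp add: algebra_simps diff_divide_distrib)
        qed
        also have "\<bar>\<dots>\<bar> = t powr (a - 1) * \<bar>ln t\<bar> ^ j * exp (- t) * (\<bar>exp (K i * ln t) - 1\<bar> / \<bar>K i\<bar>)"
          by (simp add: abs_mult power_abs)
        also have "\<dots> \<le> t powr (a - 1) * \<bar>ln t\<bar> ^ j * exp (- t) * (\<bar>ln t\<bar> * (t powr r + t powr (- r)))"
          using * K(2)[of i] by (intro mult_left_mono) (auto simp: divide_le_eq mult.commute)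
        also have "\<dots> = w t"
        proof -
          have "t powr (a + r - 1) = t powr (a - 1) * t powr r" "t powr (a - r - 1) = t powr (a - 1) * t powr (- r)"
            by (simp_all add: algebra_simps flip: powr_add)
          then show ?thesis using True by (simp add: w_def algebra_simps)
        qed
        finally show ?thesis using True by (simp add: g_def)
      qed (simp add: g_def w_def)
    qed
  qed (auto simp: f_def g_def D_def)
  have "(\<lambda>i. (Gamma_ln j (a + K i) - Gamma_ln j a) / K i) \<longlonglongrightarrow> Gamma_ln (Suc j) a"
    unfolding diff using lim unfolding D_def Gamma_ln_def set_lebesgue_integral_def .
  then have "(\<lambda>i. (Gamma_ln j (a + H i) - Gamma_ln j a) / H i) \<longlonglongrightarrow> Gamma_ln (Suc j) a"
    unfolding K_def by (rule LIMSEQ_offset)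
  then show "((\<lambda>h. (Gamma_ln j (a + h) - Gamma_ln j a) / h) \<circ> H) \<longlonglongrightarrow> Gamma_ln (Suc j) a"
    by (simp add: comp_def)
qed

lemma Gamma_ln_1:
  assumes a: "a > 0"
  shows "Gamma_ln 1 a = Gamma a * Digamma a"
proof -
  have "(Gamma has_real_derivative Gamma_ln (Suc 0) a) (at a)"
    by (rule has_field_derivative_transform_within_open[OF has_field_derivative_Gamma_ln[OF a, of 0], of "{0<..}"])
       (use a in \<open>auto simp: Gamma_ln_0\<close>)
  moreover have "(Gamma has_real_derivative Gamma a * Digamma a) (at a)"
    using a by (intro has_field_derivative_Gamma) (auto elim!: nonpos_Ints_cases)
  ultimately show ?thesis using DERIV_unique by force
qed

lemma Gamma_ln_2:
  assumes a: "a > 0"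
  shows "Gamma_ln 2 a = Gamma a * ((Digamma a)\<^sup>2 + Polygamma 1 a)"
proof -
  have np: "a \<notin> \<int>\<^sub>\<le>\<^sub>0" using a by (auto elim!: nonpos_Ints_cases)
  have "((\<lambda>a. Gamma a * Digamma a) has_real_derivative Gamma_ln (Suc 1) a) (at a)"
    by (rule has_field_derivative_transform_within_open[OF has_field_derivative_Gamma_ln[OF a, of 1], of "{0<..}"])
       (use a in \<open>auto simp: Gamma_ln_1[unfolded One_nat_def]\<close>)
  moreover have "((\<lambda>a. Gamma a * Digamma a) has_real_derivative
      Gamma a * Digamma a * Digamma a + Polygamma (Suc 0) a * Gamma a) (at a)"
    by (rule DERIV_mult[OF has_field_derivative_Gamma[OF np] has_field_derivative_Polygamma[OF np]])
  ultimately have "Gamma_ln (Suc 1) a = Gamma a * Digamma a * Digamma a + Polygamma (Suc 0) a * Gamma a"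
    using DERIV_unique by blast
  then show ?thesis by (simp add: power2_eq_square numeral_2_eq_2 algebra_simps)
qed

subsection \<open>The symmetric power kernel\<close>

definition pker :: "real \<Rightarrow> real \<Rightarrow> real" where
  "pker lam y = exp (- (\<bar>y\<bar> powr lam / lam))"

lemma pker_measurable [measurable]: "pker lam \<in> borel_measurable borel"
  unfolding pker_def by measurable

lemma pker_pos: "pker lam y > 0"
  by (simp add: pker_def)

text \<open>The substitution t = y powr lam / lam on the positive half-line turns the kernel into
  the Gamma weight of shape 1 / lam; evenness doubles the result.\<close>

lemma has_bochner_integral_pker:
  fixes lam :: real
  assumes lam: "lam > 0" and F [measurable]: "F \<in> borel_measurable borel"
    and int: "set_integrable lborel {0<..} (\<lambda>t. t powr (1 / lam - 1) * F t * exp (- t))"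
  shows "has_bochner_integral lborel (\<lambda>y. F (\<bar>y\<bar> powr lam / lam) * pker lam y)
    (2 * lam powr (1 / lam - 1) * (LINT t:{0<..}|lborel. t powr (1 / lam - 1) * F t * exp (- t)))"
proof -
  define f where "f = (\<lambda>t. lam powr (1 / lam - 1) * (t powr (1 / lam - 1) * F t * exp (- t)))"
  define G where "G = (\<lambda>y. F (y powr lam / lam) * exp (- (y powr lam / lam)))"
  let ?g = "\<lambda>y::real. y powr lam / lam" and ?h = "\<lambda>y::real. y powr (lam - 1)"
  have [measurable]: "f \<in> borel_measurable borel" "G \<in> borel_measurable borel"
    unfolding f_def G_def by measurable
  have inti: "set_integrable lborel {0<..} f"
    unfolding f_def by (intro set_integrable_mult_right int)
  then have f_abs: "f absolutely_integrable_on {0<..}"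
    unfolding set_integrable_def by (subst integrable_completion) auto
  have der: "(?g has_real_derivative ?h y) (at y within {0<..})" if "y \<in> {0<..}" for y
    using that lam by (auto intro!: derivative_eq_intros)
  have inj: "inj_on ?g {0<..}"
    using lam by (auto intro!: inj_on_inverseI[of _ "\<lambda>t. (lam * t) powr (1 / lam)"] simp: powr_powr)
  have img: "?g ` {0<..} = {0<..}"
  proof (intro equalityI subsetI)
    fix t :: real assume "t \<in> {0<..}"
    then show "t \<in> ?g ` {0<..}"
      using lam by (intro image_eqI[of _ _ "(lam * t) powr (1 / lam)"]) (auto simp: powr_powr)
  qed (use lam in auto)
  have eq: "\<bar>?h y\<bar> *\<^sub>R f (?g y) = G y" if "y \<in> {0<..}" for y
  proof -
    have y: "y > 0" using that by simp
    \<comment> \<open>The derivative of the substitution cancels the power factor of the Gamma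
      weight exactly.\<close>
    have "?h y * (lam powr (1 / lam - 1) * ?g y powr (1 / lam - 1)) = 1"
    proof -
      have "lam powr (1 / lam - 1) * ?g y powr (1 / lam - 1) = (y powr lam) powr (1 / lam - 1)"
        using lam y by (subst powr_mult[symmetric]) auto
      also have "\<dots> = y powr (1 - lam)"
        using lam by (simp add: powr_powr algebra_simps)
      finally show ?thesis using y by (simp flip: powr_add)
    qed
    then show ?thesis
      unfolding f_def G_def using y by (simp add: algebra_simps)
  qed
  have "(\<lambda>y. \<bar>?h y\<bar> *\<^sub>R f (?g y)) absolutely_integrable_on {0<..} \<and>
      integral {0<..} (\<lambda>y. \<bar>?h y\<bar> *\<^sub>R f (?g y)) = integral {0<..} f"
    using has_absolute_integral_change_of_variables_1'[OF _ der inj, of f "integral {0<..} f"] f_abs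
    unfolding img by simp
  then have A: "(\<lambda>y. \<bar>?h y\<bar> *\<^sub>R f (?g y)) absolutely_integrable_on {0<..}"
    and B: "integral {0<..} (\<lambda>y. \<bar>?h y\<bar> *\<^sub>R f (?g y)) = integral {0<..} f" by auto
  have "G absolutely_integrable_on {0<..}"
    using A by (subst set_integrable_cong[OF refl refl eq[symmetric]]) auto
  then have Gi: "set_integrable lborel {0<..} G"
    unfolding set_integrable_def by (subst (asm) integrable_completion) auto
  have "(LINT y:{0<..}|lborel. G y) = integral {0<..} G"
    by (rule set_borel_integral_eq_integral(2)[OF Gi])
  also have "\<dots> = integral {0<..} f"
    using B by (subst (asm) integral_cong[OF eq]) auto
  also have "\<dots> = (LINT t:{0<..}|lborel. f t)"
    by (rule set_borel_integral_eq_integral(2)[OF inti, symmetric])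
  also have "\<dots> = lam powr (1 / lam - 1) * (LINT t:{0<..}|lborel. t powr (1 / lam - 1) * F t * exp (- t))"
    unfolding f_def by simp
  finally have Gint: "(LINT y:{0<..}|lborel. G y) =
      lam powr (1 / lam - 1) * (LINT t:{0<..}|lborel. t powr (1 / lam - 1) * F t * exp (- t))" .
  have "has_bochner_integral lborel (\<lambda>y. indicator {0<..} y *\<^sub>R G y) (LINT y:{0<..}|lborel. G y)"
    using Gi unfolding set_integrable_def set_lebesgue_integral_def
    by (simp add: has_bochner_integral_integrable)
  then have "has_bochner_integral lborel (\<lambda>y. indicator {0..} y *\<^sub>R (F (\<bar>y\<bar> powr lam / lam) * pker lam y))
      (LINT y:{0<..}|lborel. G y)"
  proof (rule has_bochner_integral_cong_AE[THEN iffD1, rotated -1])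
    \<comment> \<open>The change of variables lives on the open half-line, the rule for even
      functions on the closed one; they differ by a null set.\<close>
    have "AE y in lborel. y \<noteq> (0::real)" by (rule AE_lborel_singleton)
    then show "AE y in lborel. indicator {0<..} y *\<^sub>R G y = 
        indicator {0..} y *\<^sub>R (F (\<bar>y\<bar> powr lam / lam) * pker lam y)"
      by eventually_elim (auto simp: indicator_def G_def pker_def)
  qed auto
  from has_bochner_integral_even_function[OF this] show ?thesis
    unfolding Gint by (simp add: pker_def mult.assoc)
qed

subsection \<open>Functions of polynomial growth\<close>

text \<open>A class that contains every summand and every score below, is closed under sums,
  products, shifts and reflection, and is integrable against the envelope. Measurability is part of
  it so that membership is the only side condition to carry.\<close>

definition poly_growth :: "(real \<Rightarrow> real) \<Rightarrow> bool" where
  "poly_growth f \<longleftrightarrow> f \<in> borel_measurable borel \<and> (\<exists>C k. \<forall>y. \<bar>f y\<bar> \<le> C * (1 + \<bar>y\<bar>) ^ k)"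

lemma poly_growth_measurable: "poly_growth f \<Longrightarrow> f \<in> borel_measurable borel"
  by (simp add: poly_growth_def)

lemma poly_growthE:
  assumes "poly_growth f"
  obtains C k where "C \<ge> 0" "\<And>y. \<bar>f y\<bar> \<le> C * (1 + \<bar>y\<bar>) ^ k"
proof -
  from assms obtain C k where *: "\<And>y. \<bar>f y\<bar> \<le> C * (1 + \<bar>y\<bar>) ^ k"
    by (auto simp: poly_growth_def)
  from *[of 0] have "C \<ge> 0" by auto
  with * that show thesis by blast
qed

lemma poly_growthI:
  "f \<in> borel_measurable borel \<Longrightarrow> (\<And>y. \<bar>f y\<bar> \<le> C * (1 + \<bar>y\<bar>) ^ k) \<Longrightarrow> poly_growth f"
  unfolding poly_growth_def by blast

lemma poly_growth_const [intro]: "poly_growth (\<lambda>y. c)"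
  by (rule poly_growthI[of _ "\<bar>c\<bar>" 0]) auto

lemma poly_growth_mult [intro]:
  assumes "poly_growth f" "poly_growth g"
  shows "poly_growth (\<lambda>y. f y * g y)"
proof -
  note [measurable] = assms[THEN poly_growth_measurable]
  obtain C k where f: "C \<ge> 0" "\<And>y. \<bar>f y\<bar> \<le> C * (1 + \<bar>y\<bar>) ^ k"
    using poly_growthE[OF assms(1)] by metis
  obtain D l where g: "D \<ge> 0" "\<And>y. \<bar>g y\<bar> \<le> D * (1 + \<bar>y\<bar>) ^ l"
    using poly_growthE[OF assms(2)] by metis
  have "\<bar>f y * g y\<bar> \<le> (C * D) * (1 + \<bar>y\<bar>) ^ (k + l)" for y
    using mult_mono[OF f(2)[of y] g(2)[of y]] f(1) g(1)
    by (simp add: abs_mult power_add algebra_simps)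
  then show ?thesis
    using assms by (intro poly_growthI[of _ "C * D" "k + l"]) measurable
qed

lemma poly_growth_add [intro]:
  assumes "poly_growth f" "poly_growth g"
  shows "poly_growth (\<lambda>y. f y + g y)"
proof -
  note [measurable] = assms[THEN poly_growth_measurable]
  obtain C k where f: "C \<ge> 0" "\<And>y. \<bar>f y\<bar> \<le> C * (1 + \<bar>y\<bar>) ^ k"
    using poly_growthE[OF assms(1)] by metis
  obtain D l where g: "D \<ge> 0" "\<And>y. \<bar>g y\<bar> \<le> D * (1 + \<bar>y\<bar>) ^ l"
    using poly_growthE[OF assms(2)] by metis
  have "\<bar>f y + g y\<bar> \<le> (C + D) * (1 + \<bar>y\<bar>) ^ (k + l)" for y
  proof -
    have "C * (1 + \<bar>y\<bar>) ^ k \<le> C * (1 + \<bar>y\<bar>) ^ (k + l)" "D * (1 + \<bar>y\<bar>) ^ l \<le> D * (1 + \<bar>y\<bar>) ^ (k + l)"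
      using f(1) g(1) by (auto intro!: mult_left_mono power_increasing)
    with f(2)[of y] g(2)[of y] show ?thesis unfolding distrib_right by linarith
  qed
  then show ?thesis
    using assms by (intro poly_growthI[of _ "C + D" "k + l"]) measurable
qed

lemma poly_growth_uminus: "poly_growth f \<Longrightarrow> poly_growth (\<lambda>y. - f y)"
  using poly_growth_mult[OF poly_growth_const[of "-1"]] by simp

lemma poly_growth_diff [intro]: "poly_growth f \<Longrightarrow> poly_growth g \<Longrightarrow> poly_growth (\<lambda>y. f y - g y)"
  using poly_growth_add[of f "\<lambda>y. - g y"] poly_growth_uminus by simp

lemma poly_growth_power [intro]: "poly_growth f \<Longrightarrow> poly_growth (\<lambda>y. f y ^ n)"
  by (induction n) auto

lemma poly_growth_abs [intro]: 
  assumes "poly_growth f"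
  shows "poly_growth (\<lambda>y. \<bar>f y\<bar>)"
  using assms by (auto simp: poly_growth_def)

lemma poly_growth_dominated:
  assumes "poly_growth g" "f \<in> borel_measurable borel" "\<And>y. \<bar>f y\<bar> \<le> \<bar>g y\<bar>"
  shows "poly_growth f"
proof -
  obtain C k where "\<And>y. \<bar>g y\<bar> \<le> C * (1 + \<bar>y\<bar>) ^ k"
    using poly_growthE[OF assms(1)] by metis
  then have "\<bar>f y\<bar> \<le> C * (1 + \<bar>y\<bar>) ^ k" for y
    using assms(3)[of y] order_trans by blast
  then show ?thesis by (rule poly_growthI[OF assms(2)])
qed

lemma powr_le_power_nat:
  fixes x a :: real
  assumes "a \<ge> 0" "x \<ge> 0" "a \<le> real k"
  shows "x powr a \<le> (1 + x) ^ k"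
proof -
  have "x powr a \<le> (1 + x) powr a" using assms by (intro powr_mono2) auto
  also have "\<dots> \<le> (1 + x) powr real k" using assms by (intro powr_mono) auto
  also have "\<dots> = (1 + x) ^ k" using assms by (simp add: powr_realpow)
  finally show ?thesis .
qed

lemma poly_growth_powr [intro]: "a \<ge> 0 \<Longrightarrow> poly_growth (\<lambda>y. \<bar>y\<bar> powr a)"
  using powr_le_power_nat[of a _ "nat \<lceil>a\<rceil>"] 
  by (intro poly_growthI[of _ 1 "nat \<lceil>a\<rceil>"]) (auto simp: of_nat_ceiling)

lemma poly_growth_sgn [intro]: "poly_growth sgn"
  by (rule poly_growthI[of _ 1 0]) (auto simp: sgn_if)

text \<open>For \<bar>y\<bar> \<ge> 1 the logarithm is at most \<bar>y\<bar>; near 0 half a power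
  absorbs it. The bound is uniform in the exponent because it is applied to exponents that vary with
  \<open>n\<close>.\<close>

lemma abs_powr_ln_le:
  fixes y a b :: real
  assumes "a \<ge> 1 / 2" "a \<le> real k"
  shows "\<bar>y\<bar> powr a * \<bar>ln \<bar>y\<bar>\<bar> \<le> 4 * (1 + \<bar>y\<bar>) ^ (k + 1)"
proof (cases "y = 0")
  case False
  show ?thesis
  proof (cases "\<bar>y\<bar> \<ge> 1")
    case True
    have "\<bar>y\<bar> powr a * \<bar>ln \<bar>y\<bar>\<bar> \<le> (1 + \<bar>y\<bar>) ^ k * (1 + \<bar>y\<bar>)"
    proof (intro mult_mono powr_le_power_nat)
      show "\<bar>ln \<bar>y\<bar>\<bar> \<le> 1 + \<bar>y\<bar>" using ln_bound[of "\<bar>y\<bar>"] True False by simp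
    qed (use assms in auto)
    also have "\<dots> \<le> 4 * (1 + \<bar>y\<bar>) ^ (k + 1)" by simp
    finally show ?thesis .
  next
    case ny: False
    have "\<bar>y\<bar> powr a * \<bar>ln \<bar>y\<bar>\<bar> \<le> \<bar>y\<bar> powr (1/2) * (fact 1 / (1/2) ^ 1 * (\<bar>y\<bar> powr (1/2) + \<bar>y\<bar> powr (- (1/2))))"
      using abs_ln_power_le[of "\<bar>y\<bar>" "1/2" 1] False ny assms
      by (intro mult_mono powr_mono') auto
    also have "\<dots> = 2 * (\<bar>y\<bar> powr (1/2 + 1/2) + \<bar>y\<bar> powr (1/2 + - (1/2)))"
      unfolding powr_add by (simp add: algebra_simps)
    also have "\<dots> \<le> 4" using False ny by simp
    also have "\<dots> \<le> 4 * (1 + \<bar>y\<bar>) ^ (k + 1)" by (simp add: one_le_power del: power_Suc)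
    finally show ?thesis .
  qed
qed simp

lemma poly_growth_powr_ln [intro]:
  assumes "a \<ge> 1"
  shows "poly_growth (\<lambda>y. \<bar>y\<bar> powr a * ln \<bar>y\<bar>)"
  using abs_powr_ln_le[of a "nat \<lceil>a\<rceil>"] assms
  by (intro poly_growthI[of _ 4 "nat \<lceil>a\<rceil> + 1"]) (auto simp: of_nat_ceiling abs_mult)

subsection \<open>An integrable envelope\<close>

text \<open>The exponents \<open>th n\<close> vary with \<open>n\<close> and may fall below
  \<open>lam\<close>, even below 1. The square root gives a single tail that dominates exp (- c *
  \<bar>y\<bar> powr s) for all s \<ge> 1 / 2 at once, up to a constant factor.\<close>

definition env :: "real \<Rightarrow> real \<Rightarrow> real" where
  "env c y = exp (- c * sqrt \<bar>y\<bar>)"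

lemma env_measurable [measurable]: "env c \<in> borel_measurable borel"
  unfolding env_def by measurable

lemma env_nonneg: "env c y \<ge> 0"
  by (simp add: env_def)

lemma integrable_inverse_square: "integrable lborel (\<lambda>y::real. inverse (1 + y\<^sup>2))"
  using integrable_inverse_1_plus_square
  by (simp add: set_integrable_def)

lemma integrable_power_env:
  assumes c: "c > 0"
  shows "integrable lborel (\<lambda>y. (1 + \<bar>y\<bar>) ^ k * env c y)"
proof -
  \<comment> \<open>With z = sqrt (1 + \<bar>y\<bar>), the power z ^ m is (1 + \<bar>y\<bar>) ^ (k +
    2). Bounding exp (- c * z) by m! / (c * z) ^ m thus leaves an inverse square after
    multiplication by (1 + \<bar>y\<bar>) ^ k.\<close>
  define m where "m = 2 * (k + 2)"
  define A where "A = exp c * fact m / c ^ m"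
  have bound: "(1 + \<bar>y\<bar>) ^ k * env c y \<le> A * inverse (1 + y\<^sup>2)" for y
  proof -
    define z where "z = sqrt (1 + \<bar>y\<bar>)"
    have z: "z \<ge> 1" "z\<^sup>2 = 1 + \<bar>y\<bar>" by (auto simp: z_def)
    have "z \<le> sqrt \<bar>y\<bar> + 1"
      unfolding z_def using sqrt_add_le_add_sqrt[of "\<bar>y\<bar>" 1] by (simp add: add.commute)
    then have "env c y \<le> exp (c - c * z)"
      using mult_left_mono[of z "sqrt \<bar>y\<bar> + 1" c] c by (simp add: env_def algebra_simps)
    also have "\<dots> \<le> A * inverse (z ^ m)"
    proof -
      have "(c * z) ^ m \<le> fact m * exp (c * z)" using c z by (intro power_le_fact_exp) auto
      then show ?thesis
        using c z by (simp add: A_def exp_diff field_simps power_mult_distrib)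
    qed
    finally have e: "env c y \<le> A * inverse (z ^ m)" .
    have zm: "z ^ m = (1 + \<bar>y\<bar>) ^ (k + 2)"
      unfolding m_def power_mult z(2) ..
    have "(1 + \<bar>y\<bar>) ^ k * env c y \<le> (1 + \<bar>y\<bar>) ^ k * (A * inverse ((1 + \<bar>y\<bar>) ^ (k + 2)))"
      using e unfolding zm by (intro mult_left_mono) auto
    also have "\<dots> = A * inverse ((1 + \<bar>y\<bar>)\<^sup>2)"
      unfolding power_add by (simp add: field_simps)
    also have "\<dots> \<le> A * inverse (1 + y\<^sup>2)"
      using c by (intro mult_left_mono le_imp_inverse_le)
        (simp_all add: A_def power2_sum add_pos_nonneg)
    finally show ?thesis .
  qed
  show ?thesis
  proof (rule Bochner_Integration.integrable_bound[OF integrable_mult_right[OF integrable_inverse_square, of A]])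
    show "AE y in lborel. norm ((1 + \<bar>y\<bar>) ^ k * env c y) \<le> norm (A * inverse (1 + y\<^sup>2))"
    proof (intro AE_I2)
      fix y :: real
      have "norm ((1 + \<bar>y\<bar>) ^ k * env c y) = (1 + \<bar>y\<bar>) ^ k * env c y"
        by (simp add: env_nonneg abs_mult)
      also note bound[of y]
      also have "A * inverse (1 + y\<^sup>2) \<le> norm (A * inverse (1 + y\<^sup>2))" by simp
      finally show "norm ((1 + \<bar>y\<bar>) ^ k * env c y) \<le> norm (A * inverse (1 + y\<^sup>2))" .
    qed
  qed auto
qed

lemma integrable_poly_growth_env:
  assumes "poly_growth f" "c > 0"
  shows "integrable lborel (\<lambda>y. f y * env c y)"
proof -
  obtain C k where f: "C \<ge> 0" "\<And>y. \<bar>f y\<bar> \<le> C * (1 + \<bar>y\<bar>) ^ k"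
    using poly_growthE[OF assms(1)] by metis
  have [measurable]: "f \<in> borel_measurable borel" by (rule poly_growth_measurable) fact
  have "\<bar>f y\<bar> * env c y \<le> C * ((1 + \<bar>y\<bar>) ^ k * env c y)" for y
    using mult_right_mono[OF f(2)[of y] env_nonneg[of c y]] by (simp add: mult.assoc)
  then show ?thesis
    by (intro Bochner_Integration.integrable_bound[OF integrable_mult_right[OF integrable_power_env[OF assms(2), of k], of C]])
       (use f(1) in \<open>auto simp: env_nonneg abs_mult intro!: AE_I2\<close>)
qed

section \<open>Dominated convergence, the delta method for sequences, and calculus of absolute
  powers\<close>

lemma dominated_convergence_eventually:
  fixes f :: "nat \<Rightarrow> 'a \<Rightarrow> real"
  assumes "\<And>n. f n \<in> borel_measurable M" "g \<in> borel_measurable M" "integrable M w"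
    and "AE x in M. (\<lambda>n. f n x) \<longlonglongrightarrow> g x"
    and ev: "\<forall>\<^sub>F n in sequentially. \<forall>x. \<bar>f n x\<bar> \<le> w x"
  shows "(\<lambda>n. \<integral>x. f n x \<partial>M) \<longlonglongrightarrow> (\<integral>x. g x \<partial>M)"
proof -
  obtain N where N: "\<And>n x. n \<ge> N \<Longrightarrow> \<bar>f n x\<bar> \<le> w x"
    using ev by (auto simp: eventually_sequentially)
  have "(\<lambda>n. \<integral>x. f (n + N) x \<partial>M) \<longlonglongrightarrow> (\<integral>x. g x \<partial>M)"
  proof (rule integral_dominated_convergence[where w=w])
    show "AE x in M. (\<lambda>n. f (n + N) x) \<longlonglongrightarrow> g x"
      using assms(4) by eventually_elim (rule LIMSEQ_ignore_initial_segment)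
  qed (use assms N in auto)
  then show ?thesis by (rule LIMSEQ_offset)
qed

text \<open>Caratheodory's form of the derivative writes f z - f a as g z * (z - a) with
  \<open>g\<close> continuous at \<open>a\<close>, which reduces the claim to a product of limits
  and needs no case distinction for x n = a.\<close>

lemma delta_method:
  fixes f :: "real \<Rightarrow> real"
  assumes f: "(f has_real_derivative D) (at a)" and r: "filterlim r at_top sequentially"
    and x: "(\<lambda>n. r n * (x n - a)) \<longlonglongrightarrow> v"
  shows "x \<longlonglongrightarrow> a" and "(\<lambda>n. r n * (f (x n) - f a)) \<longlonglongrightarrow> D * v"
proof -
  have r0: "(\<lambda>n. inverse (r n)) \<longlonglongrightarrow> 0" 
    using r by (rule tendsto_inverse_0_at_top)
  have "(\<lambda>n. inverse (r n) * (r n * (x n - a)) + a) \<longlonglongrightarrow> 0 * v + a"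
    by (intro tendsto_intros r0 x)
  moreover have "\<forall>\<^sub>F n in sequentially. inverse (r n) * (r n * (x n - a)) + a = x n"
    using filterlim_at_top_dense[THEN iffD1, OF r, rule_format, of 0]
    by eventually_elim (simp add: field_simps)
  ultimately show xa: "x \<longlonglongrightarrow> a" by (simp add: tendsto_cong)
  obtain g where g: "\<And>z. f z - f a = g z * (z - a)" "isCont g a" "g a = D"
    using f by (auto simp: CARAT_DERIV)
  have "(\<lambda>n. g (x n)) \<longlonglongrightarrow> D"
    using isCont_tendsto_compose[OF g(2) xa] g(3) by simp
  then have "(\<lambda>n. g (x n) * (r n * (x n - a))) \<longlonglongrightarrow> D * v"
    by (intro tendsto_mult x)
  then show "(\<lambda>n. r n * (f (x n) - f a)) \<longlonglongrightarrow> D * v"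
    by (simp add: g(1) algebra_simps)
qed

lemma filterlim_sqrt_nat: "filterlim (\<lambda>n. sqrt (real n)) at_top sequentially"
  by (intro filterlim_compose[OF sqrt_at_top filterlim_real_sequentially])

text \<open>Mean value theorem. As s - 1 \<ge> 0, the derivative is largest at the larger endpoint;
  the smaller endpoint may be 0, where only continuity is used.\<close>

lemma abs_powr_diff_le:
  fixes a b s :: real
  assumes "a \<ge> 0" "b \<ge> 0" "s \<ge> 1"
  shows "\<bar>a powr s - b powr s\<bar> \<le> s * \<bar>a - b\<bar> * max a b powr (s - 1)"
proof -
  have *: "b powr s - a powr s \<le> s * (b - a) * b powr (s - 1)" if "0 \<le> a" "a < b" for a b :: real
  proof -
    have "\<exists>l z. a < z \<and> z < b \<and> ((\<lambda>z. z powr s) has_real_derivative l) (at z) \<and>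
        b powr s - a powr s = (b - a) * l"
    proof (rule MVT[OF \<open>a < b\<close>])
      show "continuous_on {a..b} (\<lambda>z. z powr s)"
        using that \<open>s \<ge> 1\<close> by (auto intro!: continuous_on_powr')
      show "(\<lambda>z. z powr s) differentiable (at x)" if "a < x" "x < b" for x
        using that \<open>0 \<le> a\<close> by (auto intro!: derivative_eq_intros exI simp: real_differentiable_def)
    qed
    then obtain l z where z: "a < z" "z < b" "((\<lambda>z. z powr s) has_real_derivative l) (at z)"
      "b powr s - a powr s = (b - a) * l" by blast
    have "((\<lambda>z. z powr s) has_real_derivative s * z powr (s - 1)) (at z)"
      using z \<open>0 \<le> a\<close> by (auto intro!: derivative_eq_intros)
    with z(3) have l: "l = s * z powr (s - 1)" using DERIV_unique by blast
    have "z powr (s - 1) \<le> b powr (s - 1)" using z that assms by (intro powr_mono2) auto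
    then show ?thesis unfolding z(4) l using that assms by (simp add: mult_left_mono mult.left_commute)
  qed
  consider "a < b" | "b < a" | "a = b" by linarith
  then show ?thesis
  proof cases
    case 1
    have "a powr s \<le> b powr s" using 1 assms by (intro powr_mono2) auto
    then show ?thesis using *[of a b] assms 1 by (simp add: max_def)
  next
    case 2
    have "b powr s \<le> a powr s" using 2 assms by (intro powr_mono2) auto
    then show ?thesis using *[of b a] assms 2 by (simp add: max_def)
  qed auto
qed

lemma has_real_derivative_abs_powr:
  fixes z s :: real
  assumes "z \<noteq> 0"
  shows "((\<lambda>z. \<bar>z\<bar> powr s) has_real_derivative s * (\<bar>z\<bar> powr (s - 1) * sgn z)) (at z)"
proof (cases "z > 0")
  case True
  have "((\<lambda>z. z powr s) has_real_derivative s * (\<bar>z\<bar> powr (s - 1) * sgn z)) (at z)"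
    using True by (auto intro!: derivative_eq_intros)
  then show ?thesis
    by (rule has_field_derivative_transform_within_open[of _ _ _ "{0<..}"]) (use True in auto)
next
  case False
  then have "z < 0" using assms by simp
  have "((\<lambda>z. (- z) powr s) has_real_derivative s * (\<bar>z\<bar> powr (s - 1) * sgn z)) (at z)"
    using \<open>z < 0\<close> by (auto intro!: derivative_eq_intros)
  then show ?thesis
    by (rule has_field_derivative_transform_within_open[of _ _ _ "{..<0}"]) (use \<open>z < 0\<close> in auto)
qed

lemma powr_ge_sqrt: 
  fixes y s :: real
  assumes "s \<ge> 1 / 2"
  shows "\<bar>y\<bar> powr s \<ge> sqrt \<bar>y\<bar> - 1"
proof (cases "\<bar>y\<bar> \<ge> 1")
  case True
  have "sqrt \<bar>y\<bar> = \<bar>y\<bar> powr (1/2)" by (simp add: powr_half_sqrt)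
  also have "\<dots> \<le> \<bar>y\<bar> powr s" using True assms by (intro powr_mono) auto
  finally show ?thesis by simp
next
  case False
  then have "sqrt \<bar>y\<bar> \<le> 1" by simp
  then show ?thesis by (smt (verit) powr_ge_zero)
qed

subsection \<open>Local alternatives\<close>

text \<open>The rates are those of the local alternatives; 4 * d1 is the limit for the log-odds of 1
  / 2 + d1 / sqrt n.\<close>

locale power_kernel =
  fixes lam d1 d2 :: real and th ell :: "nat \<Rightarrow> real"
  assumes lam: "lam \<ge> 1"
    and th: "(\<lambda>n. sqrt (real n) * (th n - lam)) \<longlonglongrightarrow> d2"
    and ell: "(\<lambda>n. sqrt (real n) * ell n) \<longlonglongrightarrow> 4 * d1"
begin

text \<open>With \<open>ell n = ln (t1 / (1 - t1))\<close> and \<open>th n = t2\<close>, \<open>kap\<close> is the quotient \<open>apd_delta t1 t2 / apd_A t1 t2 y\<close>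
  for \<open>y \<noteq> 0\<close>, and \<open>q n\<close> is the density up to its normalising constant.\<close>

definition kap :: "nat \<Rightarrow> real \<Rightarrow> real" where
  "kap n y = 2 / (1 + exp (- (sgn y * (th n * ell n))))"

definition q :: "nat \<Rightarrow> real \<Rightarrow> real" where
  "q n y = exp (- (kap n y * \<bar>y\<bar> powr th n / lam))"

abbreviation envl :: "real \<Rightarrow> real" where "envl \<equiv> env (1 / (2 * lam))"

text \<open>Off the origin this is minus the logarithmic derivative of \<open>pker\<close>, that is,
  the location score and also the estimating function of the location; for lam = 1 it is the
  sign.\<close>

definition psi :: "real \<Rightarrow> real" where "psi y = \<bar>y\<bar> powr (lam - 1) * sgn y"
definition gfun :: "real \<Rightarrow> real" where "gfun y = \<bar>y\<bar> powr lam * sgn y"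
definition hfun :: "real \<Rightarrow> real" where "hfun y = \<bar>y\<bar> powr lam * ln \<bar>y\<bar>"
text \<open>The limit of sqrt n * ln (q n y / pker lam y) for y \<noteq> 0: the derivative of the
  logarithmic kernel in the direction of the alternative. It is not centred, since normalising
  constants are left out.\<close>

definition score :: "real \<Rightarrow> real" where "score y = - 2 * d1 * gfun y - d2 / lam * hfun y"

lemma poly_growth_psi: "poly_growth psi"
  unfolding psi_def using lam by (intro poly_growth_mult poly_growth_powr poly_growth_sgn) auto
lemma poly_growth_gfun: "poly_growth gfun"
  unfolding gfun_def using lam by (intro poly_growth_mult poly_growth_powr poly_growth_sgn) auto
lemma poly_growth_hfun: "poly_growth hfun"
  unfolding hfun_def using lam by auto
lemma poly_growth_score: "poly_growth score"
  unfolding score_def by (intro poly_growth_diff poly_growth_mult poly_growth_const poly_growth_gfun poly_growth_hfun)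

lemma kap_measurable [measurable]: "kap n \<in> borel_measurable borel"
  unfolding kap_def by measurable
lemma q_measurable [measurable]: "q n \<in> borel_measurable borel"
  unfolding q_def by measurable

lemma th_tendsto: "th \<longlonglongrightarrow> lam"
  by (rule delta_method(1)[OF DERIV_ident filterlim_sqrt_nat th])

lemma sqrt_kap: "(\<lambda>n. sqrt (real n) * (kap n y - 1)) \<longlonglongrightarrow> 2 * lam * d1 * sgn y"
proof -
  have "(\<lambda>n. sgn y * (th n * (sqrt (real n) * ell n))) \<longlonglongrightarrow> sgn y * (lam * (4 * d1))"
    by (intro tendsto_intros th_tendsto ell)
  then have x: "(\<lambda>n. sqrt (real n) * (sgn y * (th n * ell n) - 0)) \<longlonglongrightarrow> sgn y * (lam * (4 * d1))"
    by (simp add: mult_ac)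
  \<comment> \<open>The logistic weight has slope 1 / 2 at 0, which turns lam * (4 * d1) into 2 *
    lam * d1.\<close>
  have d: "((\<lambda>x::real. 2 / (1 + exp (- x))) has_real_derivative 1 / 2) (at 0)"
    by (auto intro!: derivative_eq_intros simp: add_pos_pos power2_eq_square)
  from delta_method(2)[OF d filterlim_sqrt_nat x] show ?thesis
    by (simp add: kap_def mult_ac)
qed

lemma kap_tendsto: "(\<lambda>n. kap n y) \<longlonglongrightarrow> 1"
  by (rule delta_method(1)[OF DERIV_ident filterlim_sqrt_nat sqrt_kap])

text \<open>\<open>kap n\<close> depends on \<open>y\<close> only through its sign, so three
  pointwise limits already give uniformity.\<close>

lemma kap_uniform:
  obtains C where "C \<ge> 0" "\<forall>\<^sub>F n in sequentially. \<forall>y. 1 / 2 \<le> kap n y \<and> kap n y \<le> 2 \<and> sqrt (real n) * \<bar>kap n y - 1\<bar> \<le> C"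
proof
  let ?C = "2 * lam * \<bar>d1\<bar> + 1"
  show "?C \<ge> 0" using lam by simp
  have ev: "\<forall>\<^sub>F n in sequentially. 1 / 2 \<le> kap n y \<and> kap n y \<le> 2 \<and> sqrt (real n) * \<bar>kap n y - 1\<bar> \<le> ?C" for y
  proof -
    have "(\<lambda>n. \<bar>sqrt (real n) * (kap n y - 1)\<bar>) \<longlonglongrightarrow> \<bar>2 * lam * d1 * sgn y\<bar>"
      by (intro tendsto_intros sqrt_kap)
    moreover have "\<bar>2 * lam * d1 * sgn y\<bar> < ?C" using lam by (auto simp: abs_mult sgn_if add_nonneg_pos)
    ultimately have "\<forall>\<^sub>F n in sequentially. \<bar>sqrt (real n) * (kap n y - 1)\<bar> < ?C"
      by (rule order_tendstoD)
    moreover have "\<forall>\<^sub>F n in sequentially. 1 / 2 < kap n y" "\<forall>\<^sub>F n in sequentially. kap n y < 2"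
      using order_tendstoD(1)[OF kap_tendsto[of y], of "1 / 2"] order_tendstoD(2)[OF kap_tendsto[of y], of 2] by auto
    ultimately show ?thesis by eventually_elim (auto simp: abs_mult)
  qed
  show "\<forall>\<^sub>F n in sequentially. \<forall>y. 1 / 2 \<le> kap n y \<and> kap n y \<le> 2 \<and> sqrt (real n) * \<bar>kap n y - 1\<bar> \<le> ?C"
    using ev[of 1] ev[of "-1"] ev[of 0]
  proof eventually_elim
    case (elim n)
    have "kap n y = kap n 1 \<or> kap n y = kap n (-1) \<or> kap n y = kap n 0" for y
      by (auto simp: kap_def sgn_if)
    with elim show ?case by metis
  qed
qed

text \<open>The delta method is used for the exponent, t \<mapsto> \<bar>y\<bar> powr t, and again
  for the exponential. The origin is a null set for all later integrals.\<close>

lemma q_pointwise: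
  assumes "y \<noteq> 0"
  shows "(\<lambda>n. sqrt (real n) * (q n y - pker lam y)) \<longlonglongrightarrow> score y * pker lam y"
    and "(\<lambda>n. q n y) \<longlonglongrightarrow> pker lam y"
proof -
  have dp: "((\<lambda>t. \<bar>y\<bar> powr t) has_real_derivative \<bar>y\<bar> powr lam * ln \<bar>y\<bar>) (at lam)"
    using assms by (auto intro!: derivative_eq_intros)
  note p = delta_method[OF dp filterlim_sqrt_nat th]
  have pw: "(\<lambda>n. \<bar>y\<bar> powr th n) \<longlonglongrightarrow> \<bar>y\<bar> powr lam"
    using assms by (intro tendsto_intros th_tendsto) auto
  have "(\<lambda>n. - ((sqrt (real n) * (kap n y - 1)) * \<bar>y\<bar> powr th n + sqrt (real n) * (\<bar>y\<bar> powr th n - \<bar>y\<bar> powr lam)) / lam)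
      \<longlonglongrightarrow> - ((2 * lam * d1 * sgn y) * \<bar>y\<bar> powr lam + \<bar>y\<bar> powr lam * ln \<bar>y\<bar> * d2) / lam"
    using lam by (intro tendsto_intros sqrt_kap pw p(2)) auto
  also have "- ((2 * lam * d1 * sgn y) * \<bar>y\<bar> powr lam + \<bar>y\<bar> powr lam * ln \<bar>y\<bar> * d2) / lam = score y"
    using lam by (simp add: score_def gfun_def hfun_def field_simps)
  finally have "(\<lambda>n. sqrt (real n) * (- (kap n y * \<bar>y\<bar> powr th n / lam) - (- (\<bar>y\<bar> powr lam / lam)))) \<longlonglongrightarrow> score y"
    using lam by (simp add: field_simps)
  from delta_method(2)[OF DERIV_exp filterlim_sqrt_nat this]
  show 1: "(\<lambda>n. sqrt (real n) * (q n y - pker lam y)) \<longlonglongrightarrow> score y * pker lam y"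
    by (simp add: q_def pker_def mult.commute)
  show "(\<lambda>n. q n y) \<longlonglongrightarrow> pker lam y"
    by (rule delta_method(1)[OF DERIV_ident filterlim_sqrt_nat 1])
qed

lemma exp_powr_le_env:
  assumes "s \<ge> 1 / 2" "c \<ge> 1 / 2"
  shows "exp (- (c * \<bar>y\<bar> powr s / lam)) \<le> exp (1 / (2 * lam)) * envl y"
proof -
  have "1 / 2 * (sqrt \<bar>y\<bar> - 1) \<le> 1 / 2 * \<bar>y\<bar> powr s"
    using powr_ge_sqrt[OF assms(1), of y] by simp
  also have "\<dots> \<le> c * \<bar>y\<bar> powr s"
    using assms by (intro mult_right_mono) auto
  finally have "1 / 2 * (sqrt \<bar>y\<bar> - 1) / lam \<le> c * \<bar>y\<bar> powr s / lam"
    using lam by (intro divide_right_mono) auto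
  then show ?thesis
    by (simp add: env_def diff_divide_distrib mult.commute flip: exp_add)
qed

lemma pker_le_env: "pker lam y \<le> exp (1 / (2 * lam)) * envl y"
  unfolding pker_def using exp_powr_le_env[of lam 1 y] lam by simp

text \<open>The difference of two exponentials is at most the difference of the exponents times the
  larger exponential, and both \<open>q n\<close> and \<open>pker\<close> lie below the envelope.
  The exponents differ by a change of \<open>kap\<close> and a change of the power, each of order 1
  / sqrt n times a polynomial.\<close>

lemma q_dominated:
  obtains C k where "C \<ge> 0" 
    "\<forall>\<^sub>F n in sequentially. \<forall>y. q n y \<le> C * envl y \<and> 
       sqrt (real n) * \<bar>q n y - pker lam y\<bar> \<le> C * (1 + \<bar>y\<bar>) ^ k * envl y"
proof -
  obtain C1 where C1: "C1 \<ge> 0"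
    "\<forall>\<^sub>F n in sequentially. \<forall>y. 1 / 2 \<le> kap n y \<and> kap n y \<le> 2 \<and> sqrt (real n) * \<bar>kap n y - 1\<bar> \<le> C1"
    by (rule kap_uniform) blast
  define C2 where "C2 = \<bar>d2\<bar> + 1"
  define K where "K = nat \<lceil>lam\<rceil> + 1"
  have K: "lam + 1 \<le> real K" unfolding K_def by (simp add: of_nat_ceiling)
  define E where "E = exp (1 / (2 * lam))"
  define C where "C = E * (C1 + 8 * C2 + 1)"
  have E: "E \<ge> 1" using lam by (simp add: E_def)
  have "(\<lambda>n. \<bar>sqrt (real n) * (th n - lam)\<bar>) \<longlonglongrightarrow> \<bar>d2\<bar>" by (intro tendsto_intros th)
  then have e1: "\<forall>\<^sub>F n in sequentially. \<bar>sqrt (real n) * (th n - lam)\<bar> < C2"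
    by (rule order_tendstoD) (simp add: C2_def)
  have e2: "\<forall>\<^sub>F n in sequentially. 1 / 2 < th n" "\<forall>\<^sub>F n in sequentially. th n < lam + 1"
    using order_tendstoD(1)[OF th_tendsto, of "1 / 2"] order_tendstoD(2)[OF th_tendsto, of "lam + 1"] lam by auto
  show thesis
  proof (rule that[of C "K + 1"])
    show "C \<ge> 0" using E C1 by (simp add: C_def C2_def)
    show "\<forall>\<^sub>F n in sequentially. \<forall>y. q n y \<le> C * envl y \<and> 
       sqrt (real n) * \<bar>q n y - pker lam y\<bar> \<le> C * (1 + \<bar>y\<bar>) ^ (K + 1) * envl y"
      using C1(2) e1 e2
    proof eventually_elim
      case (elim n)
      show ?case
      proof (intro allI conjI)
        fix y
        have qe: "q n y \<le> E * envl y"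
          unfolding q_def E_def using elim by (intro exp_powr_le_env) auto
        have pe: "pker lam y \<le> E * envl y"
          unfolding E_def by (rule pker_le_env)
        have "E \<le> C" using E C1 by (simp add: C_def C2_def mult_le_cancel_left1)
        then show "q n y \<le> C * envl y"
          using qe mult_right_mono[OF _ env_nonneg] order_trans by blast
        let ?a = "kap n y * \<bar>y\<bar> powr th n / lam" and ?b = "\<bar>y\<bar> powr lam / lam"
        have A: "sqrt (real n) * \<bar>\<bar>y\<bar> powr th n - \<bar>y\<bar> powr lam\<bar> \<le> 8 * C2 * (1 + \<bar>y\<bar>) ^ (K + 1)"
        proof (cases "y = 0")
          case False
          \<comment> \<open>Whichever of the two powers is larger; which one it is depends on
            whether \<bar>y\<bar> exceeds 1.\<close>
          define mx where "mx = (if th n * ln \<bar>y\<bar> \<ge> lam * ln \<bar>y\<bar> then th n else lam)"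
          have mx: "max (th n * ln \<bar>y\<bar>) (lam * ln \<bar>y\<bar>) = mx * ln \<bar>y\<bar>" "mx \<ge> 1/2" "mx \<le> real K"
            using elim lam K by (auto simp: mx_def max_def)
          have "\<bar>\<bar>y\<bar> powr th n - \<bar>y\<bar> powr lam\<bar> \<le> \<bar>th n * ln \<bar>y\<bar> - lam * ln \<bar>y\<bar>\<bar> * exp (max (th n * ln \<bar>y\<bar>) (lam * ln \<bar>y\<bar>))"
            using False by (simp add: powr_def abs_exp_diff_le)
          also have "\<dots> = \<bar>th n - lam\<bar> * (\<bar>y\<bar> powr mx * \<bar>ln \<bar>y\<bar>\<bar>)"
            using False unfolding mx by (simp add: powr_def abs_mult flip: left_diff_distrib)
          also have "\<dots> \<le> \<bar>th n - lam\<bar> * (4 * (1 + \<bar>y\<bar>) ^ (K + 1))"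
            by (intro mult_left_mono abs_powr_ln_le mx) auto
          finally have "sqrt (real n) * \<bar>\<bar>y\<bar> powr th n - \<bar>y\<bar> powr lam\<bar> \<le> sqrt (real n) * (\<bar>th n - lam\<bar> * (4 * (1 + \<bar>y\<bar>) ^ (K + 1)))"
            by (intro mult_left_mono) auto
          also have "\<dots> = \<bar>sqrt (real n) * (th n - lam)\<bar> * (4 * (1 + \<bar>y\<bar>) ^ (K + 1))"
            by (simp add: abs_mult)
          also have "\<dots> \<le> C2 * (4 * (1 + \<bar>y\<bar>) ^ (K + 1))"
            using elim by (intro mult_right_mono) auto
          also have "\<dots> \<le> 8 * C2 * (1 + \<bar>y\<bar>) ^ (K + 1)"
            using mult_right_mono[of "C2 * 4" "8 * C2" "(1 + \<bar>y\<bar>) ^ (K + 1)"] by (simp add: C2_def mult.assoc del: power_Suc)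
          finally show ?thesis .
        qed (simp add: C2_def)
        have B: "sqrt (real n) * \<bar>kap n y - 1\<bar> * \<bar>y\<bar> powr th n \<le> C1 * (1 + \<bar>y\<bar>) ^ (K + 1)"
        proof -
          have "\<bar>y\<bar> powr th n \<le> (1 + \<bar>y\<bar>) ^ K"
            using elim K by (intro powr_le_power_nat) auto
          also have "\<dots> \<le> (1 + \<bar>y\<bar>) ^ (K + 1)" by (intro power_increasing) auto
          finally show ?thesis using elim C1 by (intro mult_mono) auto
        qed
        have "sqrt (real n) * \<bar>(- ?a) - (- ?b)\<bar> = sqrt (real n) * \<bar>(kap n y - 1) * \<bar>y\<bar> powr th n + (\<bar>y\<bar> powr th n - \<bar>y\<bar> powr lam)\<bar> / lam"
          using lam by (simp add: field_simps abs_if)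
        also have "\<dots> \<le> sqrt (real n) * \<bar>(kap n y - 1) * \<bar>y\<bar> powr th n + (\<bar>y\<bar> powr th n - \<bar>y\<bar> powr lam)\<bar>"
          using lam mult_left_mono[of 1 lam "sqrt (real n) * \<bar>(kap n y - 1) * \<bar>y\<bar> powr th n + (\<bar>y\<bar> powr th n - \<bar>y\<bar> powr lam)\<bar>"]
          by (simp add: pos_divide_le_eq)
        also have "\<dots> \<le> sqrt (real n) * (\<bar>kap n y - 1\<bar> * \<bar>y\<bar> powr th n + \<bar>\<bar>y\<bar> powr th n - \<bar>y\<bar> powr lam\<bar>)"
          by (intro mult_left_mono order_trans[OF abs_triangle_ineq]) (auto simp: abs_mult)
        also have "\<dots> \<le> (C1 + 8 * C2) * (1 + \<bar>y\<bar>) ^ (K + 1)"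
          using A B by (simp add: distrib_left distrib_right mult.assoc)
        finally have D: "sqrt (real n) * \<bar>(- ?a) - (- ?b)\<bar> \<le> (C1 + 8 * C2) * (1 + \<bar>y\<bar>) ^ (K + 1)" .
        have "\<bar>q n y - pker lam y\<bar> \<le> \<bar>(- ?a) - (- ?b)\<bar> * exp (max (- ?a) (- ?b))"
          unfolding q_def pker_def by (rule abs_exp_diff_le)
        also have "exp (max (- ?a) (- ?b)) \<le> E * envl y"
          using qe pe unfolding q_def pker_def by (auto simp: max_def)
        finally have "\<bar>q n y - pker lam y\<bar> \<le> \<bar>(- ?a) - (- ?b)\<bar> * (E * envl y)"
          by (simp add: mult_left_mono)
        then have "sqrt (real n) * \<bar>q n y - pker lam y\<bar> \<le> sqrt (real n) * (\<bar>(- ?a) - (- ?b)\<bar> * (E * envl y))"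
          by (intro mult_left_mono) auto
        also have "\<dots> = sqrt (real n) * \<bar>(- ?a) - (- ?b)\<bar> * (E * envl y)" by simp
        also have "\<dots> \<le> (C1 + 8 * C2) * (1 + \<bar>y\<bar>) ^ (K + 1) * (E * envl y)"
          using E by (intro mult_right_mono D) (auto simp: env_nonneg)
        also have "\<dots> = E * (C1 + 8 * C2) * (1 + \<bar>y\<bar>) ^ (K + 1) * envl y"
          by simp
        also have "\<dots> \<le> C * (1 + \<bar>y\<bar>) ^ (K + 1) * envl y"
          unfolding C_def using E by (intro mult_right_mono mult_left_mono) (auto simp: env_nonneg)
        finally show "sqrt (real n) * \<bar>q n y - pker lam y\<bar> \<le> C * (1 + \<bar>y\<bar>) ^ (K + 1) * envl y" .
      qed
    qed
  qed
qed

lemma q_dominated_mult: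
  assumes bd: "poly_growth b" "\<forall>\<^sub>F n in sequentially. \<forall>y. \<bar>f n y\<bar> \<le> b y"
  obtains w where "integrable lborel w" "\<forall>\<^sub>F n in sequentially. \<forall>y. \<bar>f n y * q n y\<bar> \<le> w y"
    "\<forall>\<^sub>F n in sequentially. \<forall>y. \<bar>f n y * (sqrt (real n) * (q n y - pker lam y))\<bar> \<le> w y"
proof -
  obtain C k where Ck: "C \<ge> 0" 
    "\<forall>\<^sub>F n in sequentially. \<forall>y. q n y \<le> C * envl y \<and> 
       sqrt (real n) * \<bar>q n y - pker lam y\<bar> \<le> C * (1 + \<bar>y\<bar>) ^ k * envl y"
    by (rule q_dominated) blast
  let ?w = "\<lambda>y. (\<bar>b y\<bar> * (C * (1 + \<bar>y\<bar>) ^ k)) * envl y"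
  have "poly_growth (\<lambda>y. C * (1 + \<bar>y\<bar>) ^ k)"
    by (rule poly_growthI[of _ C k]) (use Ck(1) in auto)
  then have int: "integrable lborel ?w"
    using lam by (intro integrable_poly_growth_env poly_growth_mult[OF poly_growth_abs[OF bd(1)]]) auto
  have ev: "\<forall>\<^sub>F n in sequentially. \<forall>y. \<bar>f n y * q n y\<bar> \<le> ?w y \<and>
      \<bar>f n y * (sqrt (real n) * (q n y - pker lam y))\<bar> \<le> ?w y"
    using bd(2) Ck(2)
  proof eventually_elim
    case (elim n)
    show ?case
    proof
      fix y
      have fb: "\<bar>f n y\<bar> \<le> \<bar>b y\<bar>" using elim by (auto intro: order_trans[OF _ abs_ge_self])
      have "q n y \<le> C * envl y" using elim by blast
      also have "\<dots> \<le> C * (1 + \<bar>y\<bar>) ^ k * envl y"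
        using Ck(1) by (intro mult_right_mono) (auto simp: env_nonneg mult_le_cancel_left1 one_le_power)
      finally have "\<bar>f n y\<bar> * q n y \<le> \<bar>b y\<bar> * (C * (1 + \<bar>y\<bar>) ^ k * envl y)"
        using fb by (intro mult_mono) (auto simp: q_def)
      moreover have "\<bar>f n y\<bar> * (sqrt (real n) * \<bar>q n y - pker lam y\<bar>) \<le> \<bar>b y\<bar> * (C * (1 + \<bar>y\<bar>) ^ k * envl y)"
        using fb elim by (intro mult_mono[of "\<bar>f n y\<bar>"]) auto
      ultimately show "\<bar>f n y * q n y\<bar> \<le> ?w y \<and> \<bar>f n y * (sqrt (real n) * (q n y - pker lam y))\<bar> \<le> ?w y"
        by (simp add: abs_mult q_def mult_ac)
    qed
  qed
  from ev have "\<forall>\<^sub>F n in sequentially. \<forall>y. \<bar>f n y * q n y\<bar> \<le> ?w y"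
    by eventually_elim blast
  moreover from ev have "\<forall>\<^sub>F n in sequentially. \<forall>y. \<bar>f n y * (sqrt (real n) * (q n y - pker lam y))\<bar> \<le> ?w y"
    by eventually_elim blast
  ultimately show thesis by (rule that[OF int])
qed

lemma ev_integrable_q:
  assumes f [measurable]: "\<And>n. f n \<in> borel_measurable borel"
    and bd: "poly_growth b" "\<forall>\<^sub>F n in sequentially. \<forall>y. \<bar>f n y\<bar> \<le> b y"
  shows "\<forall>\<^sub>F n in sequentially. integrable lborel (\<lambda>y. f n y * q n y)"
proof -
  obtain w where w: "integrable lborel w" "\<forall>\<^sub>F n in sequentially. \<forall>y. \<bar>f n y * q n y\<bar> \<le> w y"
    by (rule q_dominated_mult[where f=f, OF bd]) blast
  from w(2) show ?thesis
  proof eventually_elim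
    case (elim n)
    have "norm (f n y * q n y) \<le> norm (w y)" for y
      using elim[rule_format, of y] by simp
    then show ?case
      by (intro Bochner_Integration.integrable_bound[OF w(1)] AE_I2) simp_all
  qed
qed

text \<open>The integrand may vary with \<open>n\<close>: besides fixed functions, this covers the
  increments of a function under a vanishing shift. Their limit \<open>g\<close> is 0, so that
  exchanging \<open>q n\<close> for \<open>pker\<close> changes their mean by o(1 / sqrt n).\<close>

lemma q_lim:
  assumes f [measurable]: "\<And>n. f n \<in> borel_measurable borel" and g [measurable]: "g \<in> borel_measurable borel"
    and bd: "poly_growth b" "\<forall>\<^sub>F n in sequentially. \<forall>y. \<bar>f n y\<bar> \<le> b y"
    and lim: "AE y in lborel. (\<lambda>n. f n y) \<longlonglongrightarrow> g y"
  shows "(\<lambda>n. \<integral>y. f n y * q n y \<partial>lborel) \<longlonglongrightarrow> (\<integral>y. g y * pker lam y \<partial>lborel)"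
    and "(\<lambda>n. sqrt (real n) * (\<integral>y. f n y * (q n y - pker lam y) \<partial>lborel)) \<longlonglongrightarrow> (\<integral>y. g y * score y * pker lam y \<partial>lborel)"
proof -
  note [measurable] = poly_growth_measurable[OF poly_growth_score]
  obtain w where w: "integrable lborel w" "\<forall>\<^sub>F n in sequentially. \<forall>y. \<bar>f n y * q n y\<bar> \<le> w y"
    "\<forall>\<^sub>F n in sequentially. \<forall>y. \<bar>f n y * (sqrt (real n) * (q n y - pker lam y))\<bar> \<le> w y"
    by (rule q_dominated_mult[where f=f, OF bd]) blast
  have nz: "AE y in lborel. y \<noteq> (0::real)" by (rule AE_lborel_singleton)
  show "(\<lambda>n. \<integral>y. f n y * q n y \<partial>lborel) \<longlonglongrightarrow> (\<integral>y. g y * pker lam y \<partial>lborel)"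
  proof (rule dominated_convergence_eventually[OF _ _ w(1) _ w(2)])
    show "AE y in lborel. (\<lambda>n. f n y * q n y) \<longlonglongrightarrow> g y * pker lam y"
      using lim nz by eventually_elim (intro tendsto_mult q_pointwise)
  qed measurable
  have "(\<lambda>n. \<integral>y. f n y * (sqrt (real n) * (q n y - pker lam y)) \<partial>lborel) \<longlonglongrightarrow> (\<integral>y. g y * (score y * pker lam y) \<partial>lborel)"
  proof (rule dominated_convergence_eventually[OF _ _ w(1) _ w(3)])
    show "AE y in lborel. (\<lambda>n. f n y * (sqrt (real n) * (q n y - pker lam y))) \<longlonglongrightarrow> g y * (score y * pker lam y)"
      using lim nz by eventually_elim (intro tendsto_mult q_pointwise)
  qed measurable
  then show "(\<lambda>n. sqrt (real n) * (\<integral>y. f n y * (q n y - pker lam y) \<partial>lborel)) \<longlonglongrightarrow> (\<integral>y. g y * score y * pker lam y \<partial>lborel)"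
    by (simp add: mult_ac)
qed

lemma integrable_pker:
  assumes "poly_growth f"
  shows "integrable lborel (\<lambda>y. f y * pker lam y)"
proof -
  note [measurable] = poly_growth_measurable[OF assms]
  have pos: "1 / (2 * lam) > 0" using lam by simp
  have "integrable lborel (\<lambda>y. (\<bar>f y\<bar> * exp (1 / (2 * lam))) * envl y)"
    using pos assms by (intro integrable_poly_growth_env poly_growth_mult poly_growth_abs poly_growth_const) auto
  then show ?thesis
  proof (rule Bochner_Integration.integrable_bound)
    show "AE y in lborel. norm (f y * pker lam y) \<le> norm (\<bar>f y\<bar> * exp (1 / (2 * lam)) * envl y)"
    proof (intro AE_I2)
      fix y
      have "\<bar>f y\<bar> * pker lam y \<le> \<bar>f y\<bar> * (exp (1 / (2 * lam)) * envl y)"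
        by (intro mult_left_mono pker_le_env) auto
      then show "norm (f y * pker lam y) \<le> norm (\<bar>f y\<bar> * exp (1 / (2 * lam)) * envl y)"
        using pker_pos[of lam y] by (simp add: abs_mult env_nonneg mult.assoc)
    qed
  qed measurable
qed

text \<open>Translation invariance of Lebesgue measure moves the shift from \<open>f\<close> to the
  kernel, whose derivative off the origin is - psi * pker. No smoothness of \<open>f\<close>
  enters.\<close>

lemma shift_lim:
  assumes f: "poly_growth f" and h: "(\<lambda>n. sqrt (real n) * h n) \<longlonglongrightarrow> t"
  shows "(\<lambda>n. sqrt (real n) * (\<integral>y. (f (y - h n) - f y) * pker lam y \<partial>lborel)) \<longlonglongrightarrow> - t * (\<integral>y. f y * psi y * pker lam y \<partial>lborel)"
proof -
  note [measurable] = poly_growth_measurable[OF f] poly_growth_measurable[OF poly_growth_psi]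
  have pos: "1 / (2 * lam) > 0" using lam by simp
  have h0: "h \<longlonglongrightarrow> 0"
    using delta_method(1)[OF DERIV_ident filterlim_sqrt_nat, of h 0 t] h by simp
  have hb: "\<forall>\<^sub>F n in sequentially. \<bar>h n\<bar> < 1"
    using tendstoD[OF h0, of 1] by (simp add: dist_real_def)
  define C2 where "C2 = \<bar>t\<bar> + 1"
  have "(\<lambda>n. \<bar>sqrt (real n) * h n\<bar>) \<longlonglongrightarrow> \<bar>t\<bar>" by (intro tendsto_intros h)
  then have hs: "\<forall>\<^sub>F n in sequentially. \<bar>sqrt (real n) * h n\<bar> < C2"
    by (rule order_tendstoD) (simp add: C2_def)
  define K where "K = nat \<lceil>lam\<rceil>"
  have K: "lam \<le> real K" unfolding K_def by (simp add: of_nat_ceiling)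
  \<comment> \<open>One factor exp (1 / (2 * lam)) comes from \<open>pker_le_env\<close>, a second
    one pays for the shift.\<close>
  define E where "E = exp (1 / lam)"
  let ?c = "1 / (2 * lam)"
  \<comment> \<open>The square root is subadditive, so a shift by at most 1 costs the envelope only
    a constant factor.\<close>
  have shifted: "exp (- (\<bar>y + x\<bar> powr lam / lam)) \<le> E * envl y" if "\<bar>x\<bar> \<le> 1" for x y
  proof -
    have "pker lam (y + x) \<le> exp (1 / (2 * lam)) * env ?c (y + x)" by (rule pker_le_env)
    also have "\<dots> \<le> E * envl y"
    proof -
      have "sqrt \<bar>y\<bar> \<le> sqrt (\<bar>y + x\<bar> + \<bar>x\<bar>)" by simp
      also have "\<dots> \<le> sqrt \<bar>y + x\<bar> + sqrt \<bar>x\<bar>" by (rule sqrt_add_le_add_sqrt) auto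
      also have "\<dots> \<le> sqrt \<bar>y + x\<bar> + 1" using that by simp
      finally have "?c * sqrt \<bar>y\<bar> \<le> ?c * (sqrt \<bar>y + x\<bar> + 1)" using pos by (intro mult_left_mono) auto
      then have "1 / (2 * lam) + (- ?c * sqrt \<bar>y + x\<bar>) \<le> 1 / lam + (- ?c * sqrt \<bar>y\<bar>)"
        using add_divide_distrib[of 1 1 "2 * lam"] by (simp add: distrib_left)
      then show ?thesis unfolding E_def env_def exp_add[symmetric] by simp
    qed
    finally show ?thesis by (simp add: pker_def)
  qed
  have bound: "\<bar>pker lam (y + x) - pker lam y\<bar> \<le> \<bar>x\<bar> * ((2 + \<bar>y\<bar>) ^ K * (E * envl y))" if x: "\<bar>x\<bar> \<le> 1" for x y
  proof -
    have "\<bar>pker lam (y + x) - pker lam y\<bar> \<le> \<bar>- (\<bar>y + x\<bar> powr lam / lam) - - (\<bar>y\<bar> powr lam / lam)\<bar> * 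
        exp (max (- (\<bar>y + x\<bar> powr lam / lam)) (- (\<bar>y\<bar> powr lam / lam)))"
      unfolding pker_def by (rule abs_exp_diff_le)
    also have "\<dots> \<le> (\<bar>x\<bar> * (2 + \<bar>y\<bar>) ^ K) * (E * envl y)"
    proof (intro mult_mono)
      have "\<bar>- (\<bar>y + x\<bar> powr lam / lam) - - (\<bar>y\<bar> powr lam / lam)\<bar> = \<bar>\<bar>y + x\<bar> powr lam - \<bar>y\<bar> powr lam\<bar> / lam"
        using lam by (simp add: field_simps abs_if)
      also have "\<dots> \<le> (lam * \<bar>\<bar>y + x\<bar> - \<bar>y\<bar>\<bar> * max \<bar>y + x\<bar> \<bar>y\<bar> powr (lam - 1)) / lam"
        using lam by (intro divide_right_mono abs_powr_diff_le) auto
      also have "\<dots> = \<bar>\<bar>y + x\<bar> - \<bar>y\<bar>\<bar> * max \<bar>y + x\<bar> \<bar>y\<bar> powr (lam - 1)" using lam by simp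
      also have "\<dots> \<le> \<bar>x\<bar> * (2 + \<bar>y\<bar>) ^ K"
      proof (intro mult_mono)
        have "max \<bar>y + x\<bar> \<bar>y\<bar> powr (lam - 1) \<le> (1 + \<bar>y\<bar>) powr (lam - 1)"
          using x lam by (intro powr_mono2) auto
        also have "\<dots> \<le> (1 + (1 + \<bar>y\<bar>)) ^ K" using lam K by (intro powr_le_power_nat) auto
        finally show "max \<bar>y + x\<bar> \<bar>y\<bar> powr (lam - 1) \<le> (2 + \<bar>y\<bar>) ^ K" by simp
      qed auto
      finally show "\<bar>- (\<bar>y + x\<bar> powr lam / lam) - - (\<bar>y\<bar> powr lam / lam)\<bar> \<le> \<bar>x\<bar> * (2 + \<bar>y\<bar>) ^ K" .
      show "exp (max (- (\<bar>y + x\<bar> powr lam / lam)) (- (\<bar>y\<bar> powr lam / lam))) \<le> E * envl y"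
        using shifted[OF x, of y] shifted[of 0 y] by (auto simp: max_def)
    qed auto
    finally show ?thesis by (simp add: mult.assoc)
  qed
  define w where "w = (\<lambda>y. (\<bar>f y\<bar> * (C2 * (2 + \<bar>y\<bar>) ^ K * E)) * envl y)"
  have wi: "integrable lborel w"
    unfolding w_def
  proof (intro integrable_poly_growth_env poly_growth_mult poly_growth_abs poly_growth_const f pos poly_growth_power poly_growth_add)
    show "poly_growth (\<lambda>x. x)" by (rule poly_growthI[of _ 1 1]) auto
  qed
  have main: "(\<lambda>n. \<integral>y. f y * (sqrt (real n) * (pker lam (y + h n) - pker lam y)) \<partial>lborel) \<longlonglongrightarrow> (\<integral>y. f y * (- psi y * pker lam y * t) \<partial>lborel)"
  proof (rule dominated_convergence_eventually[OF _ _ wi])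
    show "AE y in lborel. (\<lambda>n. f y * (sqrt (real n) * (pker lam (y + h n) - pker lam y))) \<longlonglongrightarrow> f y * (- psi y * pker lam y * t)"
      using AE_lborel_singleton[of "0::real"]
    proof eventually_elim
      case (elim y)
      have d: "(pker lam has_real_derivative - psi y * pker lam y) (at y)"
      proof -
        have "((\<lambda>y. - (\<bar>y\<bar> powr lam / lam)) has_real_derivative - psi y) (at y)"
          using DERIV_minus[OF DERIV_cdivide[OF has_real_derivative_abs_powr[OF elim, of lam], of lam]] lam
          by (simp add: psi_def)
        from DERIV_chain2[OF DERIV_exp this] show ?thesis
          unfolding pker_def by (simp add: mult.commute)
      qed
      have "(\<lambda>n. sqrt (real n) * (pker lam (y + h n) - pker lam y)) \<longlonglongrightarrow> - psi y * pker lam y * t"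
        by (rule delta_method(2)[OF d filterlim_sqrt_nat]) (use h in simp)
      then show ?case by (rule tendsto_mult_left)
    qed
    show "\<forall>\<^sub>F n in sequentially. \<forall>y. \<bar>f y * (sqrt (real n) * (pker lam (y + h n) - pker lam y))\<bar> \<le> w y"
      using hb hs
    proof eventually_elim
      case (elim n)
      show ?case
      proof
        fix y
        have "sqrt (real n) * \<bar>pker lam (y + h n) - pker lam y\<bar> \<le> sqrt (real n) * (\<bar>h n\<bar> * ((2 + \<bar>y\<bar>) ^ K * (E * envl y)))"
          using elim by (intro mult_left_mono bound) auto
        also have "\<dots> = \<bar>sqrt (real n) * h n\<bar> * ((2 + \<bar>y\<bar>) ^ K * (E * envl y))" by (simp add: abs_mult)
        also have "\<dots> \<le> C2 * ((2 + \<bar>y\<bar>) ^ K * (E * envl y))"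
          using elim by (intro mult_right_mono) (auto simp: E_def env_nonneg)
        finally have "\<bar>f y\<bar> * (sqrt (real n) * \<bar>pker lam (y + h n) - pker lam y\<bar>) \<le> \<bar>f y\<bar> * (C2 * ((2 + \<bar>y\<bar>) ^ K * (E * envl y)))"
          by (intro mult_left_mono) auto
        then show "\<bar>f y * (sqrt (real n) * (pker lam (y + h n) - pker lam y))\<bar> \<le> w y"
          by (simp add: abs_mult w_def mult_ac)
      qed
    qed
  qed measurable
  \<comment> \<open>The change of variables; both pieces of the difference are integrable
    separately, so it may be split.\<close>
  have tr: "\<forall>\<^sub>F n in sequentially. (\<integral>y. f y * (sqrt (real n) * (pker lam (y + h n) - pker lam y)) \<partial>lborel) =
      sqrt (real n) * (\<integral>y. (f (y - h n) - f y) * pker lam y \<partial>lborel)"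
    using hb
  proof eventually_elim
    case (elim n)
    have i0: "integrable lborel (\<lambda>y. f y * pker lam y)" by (rule integrable_pker[OF f])
    have "integrable lborel (\<lambda>y. (f y * E) * envl y)"
      by (intro integrable_poly_growth_env poly_growth_mult f poly_growth_const pos)
    then have i1: "integrable lborel (\<lambda>y. f y * pker lam (y + h n))"
    proof (rule Bochner_Integration.integrable_bound)
      show "AE y in lborel. norm (f y * pker lam (y + h n)) \<le> norm (f y * E * envl y)"
      proof (intro AE_I2)
        fix y
        have "\<bar>f y\<bar> * pker lam (y + h n) \<le> \<bar>f y\<bar> * (E * envl y)"
          unfolding pker_def using elim by (intro mult_left_mono shifted) auto
        then show "norm (f y * pker lam (y + h n)) \<le> norm (f y * E * envl y)"
          using pker_pos[of lam "y + h n"] by (simp add: abs_mult env_nonneg mult.assoc E_def)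
      qed
    qed measurable
    have sh: "integrable lborel (\<lambda>y. f (y - h n) * pker lam y)" 
        "(\<integral>y. f (y - h n) * pker lam y \<partial>lborel) = (\<integral>y. f y * pker lam (y + h n) \<partial>lborel)"
    proof -
      show "(\<integral>y. f (y - h n) * pker lam y \<partial>lborel) = (\<integral>y. f y * pker lam (y + h n) \<partial>lborel)"
        by (subst lborel_integral_real_affine[where c=1 and t="h n"]) (auto simp: add.commute)
      show "integrable lborel (\<lambda>y. f (y - h n) * pker lam y)"
        using lborel_integrable_real_affine[OF i1, of 1 "- h n"] by (simp add: add.commute)
    qed
    have "(\<integral>y. (f (y - h n) - f y) * pker lam y \<partial>lborel) = (\<integral>y. f y * (pker lam (y + h n) - pker lam y) \<partial>lborel)"
      using i0 i1 sh by (simp add: left_diff_distrib right_diff_distrib)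
    then show ?case
      by (simp only: mult.left_commute[of "sqrt (real n)"] flip: integral_mult_right_zero)
  qed
  have "(\<lambda>n. sqrt (real n) * (\<integral>y. (f (y - h n) - f y) * pker lam y \<partial>lborel)) \<longlonglongrightarrow> (\<integral>y. f y * (- psi y * pker lam y * t) \<partial>lborel)"
    by (rule Lim_transform_eventually[OF main tr])
  also have "(\<integral>y. f y * (- psi y * pker lam y * t) \<partial>lborel) = - t * (\<integral>y. f y * psi y * pker lam y \<partial>lborel)"
    by (subst Bochner_Integration.integral_mult_right_zero[symmetric]) (simp add: mult_ac)
  finally show ?thesis .
qed

end

subsection \<open>Triangular arrays\<close>

text \<open>The variables are not centred: under the alternatives their means are only of order 1 /
  sqrt n. Counting m * m on the diagonal as well gives a complete square, harmless for an upper
  bound.\<close>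

lemma (in prob_space) second_moment_sum_iid:
  fixes X :: "nat \<Rightarrow> 'a \<Rightarrow> real"
  assumes indep: "indep_vars (\<lambda>_. borel) X I" and I: "finite I"
    and sq: "\<And>i. i \<in> I \<Longrightarrow> integrable M (\<lambda>\<omega>. (X i \<omega>)\<^sup>2)"
    and m: "\<And>i. i \<in> I \<Longrightarrow> expectation (X i) = m" and s: "\<And>i. i \<in> I \<Longrightarrow> expectation (\<lambda>\<omega>. (X i \<omega>)\<^sup>2) = s"
  shows "integrable M (\<lambda>\<omega>. (\<Sum>i\<in>I. X i \<omega>)\<^sup>2)"
    and "expectation (\<lambda>\<omega>. (\<Sum>i\<in>I. X i \<omega>)\<^sup>2) \<le> real (card I) * s + (real (card I) * m)\<^sup>2"
proof -
  have rv: "random_variable borel (X i)" if "i \<in> I" for i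
    using indep that by (auto simp: indep_vars_def)
  have i1: "integrable M (X i)" if "i \<in> I" for i
    using square_integrable_imp_integrable[OF rv[OF that] sq[OF that]] .
  have pair: "integrable M (\<lambda>\<omega>. X i \<omega> * X j \<omega>) \<and>
      expectation (\<lambda>\<omega>. X i \<omega> * X j \<omega>) = (if i = j then s else m * m)" if ij: "i \<in> I" "j \<in> I" for i j
  proof (cases "i = j")
    case True
    then show ?thesis using sq s ij by (simp flip: power2_eq_square)
  next
    case False
    have "indep_vars (\<lambda>_. borel) X {i, j}"
      using ij by (intro indep_vars_subset[OF indep]) auto
    moreover have "\<And>k. k \<in> {i, j} \<Longrightarrow> integrable M (X k)" using i1 ij by blast
    ultimately show ?thesis
      using False ij m indep_vars_lebesgue_integral[of "{i, j}" X] indep_vars_integrable[of "{i, j}" X] by simp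
  qed
  have sq_sum: "(\<Sum>i\<in>I. X i \<omega>)\<^sup>2 = (\<Sum>i\<in>I. \<Sum>j\<in>I. X i \<omega> * X j \<omega>)" for \<omega>
    by (simp add: power2_eq_square sum_product)
  show "integrable M (\<lambda>\<omega>. (\<Sum>i\<in>I. X i \<omega>)\<^sup>2)"
    unfolding sq_sum using pair by (intro Bochner_Integration.integrable_sum) auto
  have "expectation (\<lambda>\<omega>. (\<Sum>i\<in>I. X i \<omega>)\<^sup>2) = (\<Sum>i\<in>I. \<Sum>j\<in>I. if i = j then s else m * m)"
    unfolding sq_sum using pair by (simp add: Bochner_Integration.integral_sum Bochner_Integration.integrable_sum)
  also have "\<dots> \<le> (\<Sum>i\<in>I. \<Sum>j\<in>I. (if i = j then s else 0) + m * m)"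
    by (intro sum_mono) auto
  also have "\<dots> = real (card I) * s + (real (card I) * m)\<^sup>2"
    using I by (simp add: sum.distrib power2_eq_square algebra_simps)
  finally show "expectation (\<lambda>\<omega>. (\<Sum>i\<in>I. X i \<omega>)\<^sup>2) \<le> real (card I) * s + (real (card I) * m)\<^sup>2" .
qed

subsection \<open>Events of high probability\<close>

text \<open>The parameters are admissible only for large \<open>n\<close>, so the spaces are
  probability spaces only from some index on.\<close>

locale prob_array =
  fixes M :: "nat \<Rightarrow> 'a measure"
  assumes ev_prob: "\<forall>\<^sub>F n in sequentially. prob_space (M n)"
begin

text \<open>The event \<open>A\<close> need not be all of \<open>{\<omega>. P \<omega>}\<close>, so no measurability of \<open>P\<close> is required; this allows
  uncountable suprema.\<close>

definition likely :: "nat \<Rightarrow> real \<Rightarrow> ('a \<Rightarrow> bool) \<Rightarrow> bool" where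
  "likely n \<eta> P \<longleftrightarrow> (\<exists>A\<in>sets (M n). measure (M n) A \<ge> 1 - \<eta> \<and> (\<forall>\<omega>\<in>A. P \<omega>))"

definition whp :: "(nat \<Rightarrow> 'a \<Rightarrow> bool) \<Rightarrow> bool" where
  "whp P \<longleftrightarrow> (\<forall>\<eta>>0. \<forall>\<^sub>F n in sequentially. likely n \<eta> (P n))"

text \<open>Convergence to 0 in probability, in the inner sense of \<open>likely\<close>;
  \<open>tight_seq\<close> is boundedness in probability in the same sense.\<close>

definition small :: "(nat \<Rightarrow> 'a \<Rightarrow> real) \<Rightarrow> bool" where
  "small R \<longleftrightarrow> (\<forall>\<epsilon>>0. whp (\<lambda>n \<omega>. \<bar>R n \<omega>\<bar> \<le> \<epsilon>))"

definition tight_seq :: "(nat \<Rightarrow> 'a \<Rightarrow> real) \<Rightarrow> bool" where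
  "tight_seq R \<longleftrightarrow> (\<forall>\<eta>>0. \<exists>K. \<forall>\<^sub>F n in sequentially. likely n \<eta> (\<lambda>\<omega>. \<bar>R n \<omega>\<bar> \<le> K))"

lemma likely_mono:
  assumes "likely n \<eta> P" "\<And>\<omega>. \<omega> \<in> space (M n) \<Longrightarrow> P \<omega> \<Longrightarrow> Q \<omega>"
  shows "likely n \<eta> Q"
  using assms unfolding likely_def by (meson sets.sets_into_space subsetD)

lemma likely_combine:
  assumes N: "prob_space (M n)" and PQ: "likely n (\<eta> / 2) P" "likely n (\<eta> / 2) Q"
    and R: "\<And>\<omega>. P \<omega> \<Longrightarrow> Q \<omega> \<Longrightarrow> R \<omega>"
  shows "likely n \<eta> R"
proof -
  interpret prob_space "M n" by fact
  obtain A B where AB: "A \<in> events" "B \<in> events" "prob A \<ge> 1 - \<eta> / 2" "prob B \<ge> 1 - \<eta> / 2"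
    "\<forall>\<omega>\<in>A. P \<omega>" "\<forall>\<omega>\<in>B. Q \<omega>"
    using PQ unfolding likely_def by blast
  have "prob (A \<union> B) + prob (A \<inter> B) = prob A + prob B"
    using AB by (subst measure_Un3) (auto simp: fmeasurable_eq_sets)
  moreover have "prob (A \<union> B) \<le> 1" by simp
  ultimately have "prob (A \<inter> B) \<ge> 1 - \<eta>" using AB(3,4) by linarith
  with AB R show ?thesis
    unfolding likely_def by (intro bexI[of _ "A \<inter> B"]) auto
qed

lemma whp_mono:
  assumes "whp P" "\<forall>\<^sub>F n in sequentially. \<forall>\<omega>\<in>space (M n). P n \<omega> \<longrightarrow> Q n \<omega>"
  shows "whp Q"
  unfolding whp_def
proof (intro allI impI)
  fix \<eta> :: real assume "\<eta> > 0"
  with assms(1) have "\<forall>\<^sub>F n in sequentially. likely n \<eta> (P n)" by (simp add: whp_def)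
  with assms(2) show "\<forall>\<^sub>F n in sequentially. likely n \<eta> (Q n)"
  proof eventually_elim
    case (elim n)
    from elim(2) show ?case by (rule likely_mono) (use elim(1) in blast)
  qed
qed

lemma whp_conj:
  assumes "whp P" "whp Q"
  shows "whp (\<lambda>n \<omega>. P n \<omega> \<and> Q n \<omega>)"
  unfolding whp_def
proof (intro allI impI)
  fix \<eta> :: real assume "\<eta> > 0"
  then have h: "\<eta> / 2 > 0" by simp
  show "\<forall>\<^sub>F n in sequentially. likely n \<eta> (\<lambda>\<omega>. P n \<omega> \<and> Q n \<omega>)"
    using ev_prob assms[unfolded whp_def, THEN spec, THEN mp, OF h]
  proof eventually_elim
    case (elim n)
    show ?case by (rule likely_combine[OF elim]) auto
  qed
qed

lemma whp_True: "whp (\<lambda>n \<omega>. True)"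
  unfolding whp_def
proof (intro allI impI)
  fix \<eta> :: real assume "\<eta> > 0"
  then show "\<forall>\<^sub>F n in sequentially. likely n \<eta> (\<lambda>\<omega>. True)"
    using ev_prob unfolding likely_def
    by (auto elim!: eventually_mono intro!: bexI[of _ "space _"] simp: prob_space.prob_space)
qed

lemma whp_ball:
  assumes "finite I" "\<And>i. i \<in> I \<Longrightarrow> whp (P i)"
  shows "whp (\<lambda>n \<omega>. \<forall>i\<in>I. P i n \<omega>)"
  using assms by (induction I) (auto intro: whp_True whp_conj)

lemma whp_mono2:
  assumes "whp P" "whp Q" "\<forall>\<^sub>F n in sequentially. \<forall>\<omega>\<in>space (M n). P n \<omega> \<longrightarrow> Q n \<omega> \<longrightarrow> R n \<omega>"
  shows "whp R"
  using whp_conj[OF assms(1,2)] by (rule whp_mono) (use assms(3) in eventually_elim, blast)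

lemma smallD: "small R \<Longrightarrow> \<epsilon> > 0 \<Longrightarrow> whp (\<lambda>n \<omega>. \<bar>R n \<omega>\<bar> \<le> \<epsilon>)"
  by (simp add: small_def)

lemma small_cong:
  assumes "small R" "\<forall>\<^sub>F n in sequentially. \<forall>\<omega>\<in>space (M n). R n \<omega> = R' n \<omega>"
  shows "small R'"
  unfolding small_def using whp_mono[OF smallD[OF assms(1)]] assms(2)
  by (smt (verit) eventually_mono)

lemma small_add:
  assumes "small R" "small T"
  shows "small (\<lambda>n \<omega>. R n \<omega> + T n \<omega>)"
  unfolding small_def
proof (intro allI impI)
  fix \<epsilon> :: real assume "\<epsilon> > 0"
  then have "\<epsilon> / 2 > 0" by simp
  then show "whp (\<lambda>n \<omega>. \<bar>R n \<omega> + T n \<omega>\<bar> \<le> \<epsilon>)"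
    by (intro whp_mono2[OF smallD[OF assms(1) \<open>\<epsilon> / 2 > 0\<close>] smallD[OF assms(2) \<open>\<epsilon> / 2 > 0\<close>]])
       (auto intro!: always_eventually)
qed

text \<open>The localisation principle: on an event of probability close to 1 the variable
  \<open>T\<close> stays in a fixed interval, and there a bound for each fixed \<open>K\<close> is
  enough. It is the way estimates that are uniform on compact sets are evaluated at an
  estimator.\<close>

lemma small_of_tight:
  assumes T: "tight_seq T"
    and R: "\<And>K \<epsilon>. \<epsilon> > 0 \<Longrightarrow> whp (\<lambda>n \<omega>. \<bar>T n \<omega>\<bar> \<le> K \<longrightarrow> \<bar>R n \<omega>\<bar> \<le> \<epsilon>)"
  shows "small R"
  unfolding small_def whp_def
proof (intro allI impI)
  fix \<epsilon> \<eta> :: real assume "\<epsilon> > 0" "\<eta> > 0"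
  then have h: "\<eta> / 2 > 0" by simp
  with T obtain K where K: "\<forall>\<^sub>F n in sequentially. likely n (\<eta> / 2) (\<lambda>\<omega>. \<bar>T n \<omega>\<bar> \<le> K)"
    unfolding tight_seq_def by blast
  show "\<forall>\<^sub>F n in sequentially. likely n \<eta> (\<lambda>\<omega>. \<bar>R n \<omega>\<bar> \<le> \<epsilon>)"
    using ev_prob K R[OF \<open>\<epsilon> > 0\<close>, of K, unfolded whp_def, THEN spec, THEN mp, OF h]
  proof eventually_elim
    case (elim n)
    show ?case by (rule likely_combine[OF elim]) auto
  qed
qed

lemma small_mult_tight:
  assumes T: "tight_seq T" and R: "small R"
  shows "small (\<lambda>n \<omega>. T n \<omega> * R n \<omega>)"
proof (rule small_of_tight[OF T])
  fix K \<epsilon> :: real assume "\<epsilon> > 0"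
  define \<delta> where "\<delta> = \<epsilon> / (\<bar>K\<bar> + 1)"
  have "\<delta> > 0" using \<open>\<epsilon> > 0\<close> by (simp add: \<delta>_def)
  show "whp (\<lambda>n \<omega>. \<bar>T n \<omega>\<bar> \<le> K \<longrightarrow> \<bar>T n \<omega> * R n \<omega>\<bar> \<le> \<epsilon>)"
  proof (rule whp_mono[OF smallD[OF R \<open>\<delta> > 0\<close>]], intro always_eventually allI ballI impI)
    fix n \<omega> assume "\<bar>R n \<omega>\<bar> \<le> \<delta>" "\<bar>T n \<omega>\<bar> \<le> K"
    then have "\<bar>T n \<omega>\<bar> * \<bar>R n \<omega>\<bar> \<le> (\<bar>K\<bar> + 1) * \<delta>" by (intro mult_mono) auto
    also have "\<dots> = \<epsilon>" by (simp add: \<delta>_def)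
    finally show "\<bar>T n \<omega> * R n \<omega>\<bar> \<le> \<epsilon>" by (simp add: abs_mult)
  qed
qed

lemma small_imp_tight: "small R \<Longrightarrow> tight_seq R"
  unfolding small_def tight_seq_def whp_def by (meson zero_less_one)

lemma tight_const: "tight_seq (\<lambda>n \<omega>. c)"
  using whp_True unfolding tight_seq_def whp_def by (auto intro!: exI[of _ "\<bar>c\<bar>"])

lemma small_cmult: "small R \<Longrightarrow> small (\<lambda>n \<omega>. c * R n \<omega>)"
  by (rule small_mult_tight[OF tight_const])

lemma small_diff: "small R \<Longrightarrow> small T \<Longrightarrow> small (\<lambda>n \<omega>. R n \<omega> - T n \<omega>)"
  using small_add[of R "\<lambda>n \<omega>. -1 * T n \<omega>"] small_cmult[of T "-1"] by simp

lemma tight_add: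
  assumes "tight_seq R" "tight_seq T"
  shows "tight_seq (\<lambda>n \<omega>. R n \<omega> + T n \<omega>)"
  unfolding tight_seq_def
proof (intro allI impI)
  fix \<eta> :: real assume "\<eta> > 0"
  then have h: "\<eta> / 2 > 0" by simp
  obtain K where K: "\<forall>\<^sub>F n in sequentially. likely n (\<eta> / 2) (\<lambda>\<omega>. \<bar>R n \<omega>\<bar> \<le> K)"
    using assms(1) h unfolding tight_seq_def by blast
  obtain L where L: "\<forall>\<^sub>F n in sequentially. likely n (\<eta> / 2) (\<lambda>\<omega>. \<bar>T n \<omega>\<bar> \<le> L)"
    using assms(2) h unfolding tight_seq_def by blast
  from ev_prob K L have "\<forall>\<^sub>F n in sequentially. likely n \<eta> (\<lambda>\<omega>. \<bar>R n \<omega> + T n \<omega>\<bar> \<le> K + L)"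
  proof eventually_elim
    case (elim n)
    show ?case by (rule likely_combine[OF elim]) auto
  qed
  then show "\<exists>K. \<forall>\<^sub>F n in sequentially. likely n \<eta> (\<lambda>\<omega>. \<bar>R n \<omega> + T n \<omega>\<bar> \<le> K)" by blast
qed

lemma tight_cmult:
  assumes "tight_seq T"
  shows "tight_seq (\<lambda>n \<omega>. c * T n \<omega>)"
  unfolding tight_seq_def
proof (intro allI impI)
  fix \<eta> :: real assume "\<eta> > 0"
  then obtain K where K: "\<forall>\<^sub>F n in sequentially. likely n \<eta> (\<lambda>\<omega>. \<bar>T n \<omega>\<bar> \<le> K)"
    using assms unfolding tight_seq_def by blast
  then have "\<forall>\<^sub>F n in sequentially. likely n \<eta> (\<lambda>\<omega>. \<bar>c * T n \<omega>\<bar> \<le> \<bar>c\<bar> * K)"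
    by eventually_elim (erule likely_mono, auto simp: abs_mult intro!: mult_left_mono)
  then show "\<exists>K. \<forall>\<^sub>F n in sequentially. likely n \<eta> (\<lambda>\<omega>. \<bar>c * T n \<omega>\<bar> \<le> K)" by blast
qed

lemma tight_add_small: 
  assumes "tight_seq R" "small (\<lambda>n \<omega>. T n \<omega> - R n \<omega>)"
  shows "tight_seq T"
  using tight_add[OF assms(1) small_imp_tight[OF assms(2)]] by simp

lemma likely_chebyshev:
  assumes N: "prob_space (M n)" and R: "R \<in> borel_measurable (M n)" "integrable (M n) (\<lambda>\<omega>. (R \<omega>)\<^sup>2)"
    and le: "(\<integral>\<omega>. (R \<omega>)\<^sup>2 \<partial>M n) \<le> \<eta> * \<epsilon>\<^sup>2" and "\<epsilon> > 0"
  shows "likely n \<eta> (\<lambda>\<omega>. \<bar>R \<omega>\<bar> \<le> \<epsilon>)"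
proof -
  interpret prob_space "M n" by fact
  note [measurable] = R(1)
  let ?B = "{\<omega>\<in>space (M n). \<epsilon> \<le> \<bar>R \<omega>\<bar>}"
  have "prob ?B \<le> expectation (\<lambda>\<omega>. (R \<omega>)\<^sup>2) / \<epsilon>\<^sup>2"
    using second_moment_method[OF R(1) R(2) \<open>\<epsilon> > 0\<close>] .
  also have "\<dots> \<le> \<eta>" using le \<open>\<epsilon> > 0\<close> by (simp add: divide_le_eq)
  finally have "prob ?B \<le> \<eta>" .
  moreover have "?B \<in> events" by measurable
  ultimately show ?thesis
    unfolding likely_def by (intro bexI[of _ "space (M n) - ?B"]) (auto simp: prob_compl)
qed

lemma small_of_second_moment:
  assumes "\<forall>\<^sub>F n in sequentially. R n \<in> borel_measurable (M n) \<and> integrable (M n) (\<lambda>\<omega>. (R n \<omega>)\<^sup>2) \<and>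
      (\<integral>\<omega>. (R n \<omega>)\<^sup>2 \<partial>M n) \<le> c n" and "c \<longlonglongrightarrow> 0"
  shows "small R"
  unfolding small_def whp_def
proof (intro allI impI)
  fix \<epsilon> \<eta> :: real assume "\<epsilon> > 0" "\<eta> > 0"
  then have "\<forall>\<^sub>F n in sequentially. c n < \<eta> * \<epsilon>\<^sup>2"
    by (intro order_tendstoD(2)[OF assms(2)]) auto
  with assms(1) ev_prob show "\<forall>\<^sub>F n in sequentially. likely n \<eta> (\<lambda>\<omega>. \<bar>R n \<omega>\<bar> \<le> \<epsilon>)"
    by eventually_elim (rule likely_chebyshev, use \<open>\<epsilon> > 0\<close> in auto)
qed

lemma tight_of_second_moment:
  assumes "\<forall>\<^sub>F n in sequentially. R n \<in> borel_measurable (M n) \<and> integrable (M n) (\<lambda>\<omega>. (R n \<omega>)\<^sup>2) \<and>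
      (\<integral>\<omega>. (R n \<omega>)\<^sup>2 \<partial>M n) \<le> c n" and "c \<longlonglongrightarrow> l"
  shows "tight_seq R"
  unfolding tight_seq_def
proof (intro allI impI)
  fix \<eta> :: real assume "\<eta> > 0"
  define K where "K = sqrt ((\<bar>l\<bar> + 1) / \<eta>)"
  have K: "K > 0" "\<eta> * K\<^sup>2 = \<bar>l\<bar> + 1" using \<open>\<eta> > 0\<close> by (auto simp: K_def)
  have "\<forall>\<^sub>F n in sequentially. c n < \<eta> * K\<^sup>2"
    unfolding K by (intro order_tendstoD(2)[OF assms(2)]) auto
  with assms(1) ev_prob have "\<forall>\<^sub>F n in sequentially. likely n \<eta> (\<lambda>\<omega>. \<bar>R n \<omega>\<bar> \<le> K)"
    by eventually_elim (rule likely_chebyshev, use K in auto)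
  then show "\<exists>K. \<forall>\<^sub>F n in sequentially. likely n \<eta> (\<lambda>\<omega>. \<bar>R n \<omega>\<bar> \<le> K)" by blast
qed

lemma iexp_diff_le: "cmod (iexp x - iexp y) \<le> \<bar>x - y\<bar>"
proof -
  have "iexp x - iexp y = iexp y * (iexp (x - y) - 1)"
    by (simp add: right_diff_distrib flip: exp_add)
  then have "cmod (iexp x - iexp y) = cmod (iexp (x - y) - 1)" by (simp add: norm_mult)
  also have "\<dots> \<le> \<bar>x - y\<bar>" using iexp_approx1[of "x - y" 0] by simp
  finally show ?thesis .
qed

text \<open>Slutsky's lemma on the level of characteristic functions. Since \<open>iexp\<close> is
  1-Lipschitz with values of modulus 1, the difference is at most \<epsilon> on the good event and 2
  on its complement, whose probability is at most \<epsilon>.\<close>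

lemma small_integral_iexp:
  assumes U: "\<forall>\<^sub>F n in sequentially. U n \<in> borel_measurable (M n)" "\<forall>\<^sub>F n in sequentially. W n \<in> borel_measurable (M n)"
    and s: "small (\<lambda>n \<omega>. U n \<omega> - W n \<omega>)"
    and W: "(\<lambda>n. \<integral>\<omega>. iexp (W n \<omega>) \<partial>M n) \<longlonglongrightarrow> l"
  shows "(\<lambda>n. \<integral>\<omega>. iexp (U n \<omega>) \<partial>M n) \<longlonglongrightarrow> l"
proof -
  have "(\<lambda>n. (\<integral>\<omega>. iexp (U n \<omega>) \<partial>M n) - (\<integral>\<omega>. iexp (W n \<omega>) \<partial>M n)) \<longlonglongrightarrow> 0"
    unfolding tendsto_iff
  proof (intro allI impI)
    fix e :: real assume "e > 0"
    define \<epsilon> where "\<epsilon> = e / 4"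
    have "\<epsilon> > 0" using \<open>e > 0\<close> by (simp add: \<epsilon>_def)
    have "\<forall>\<^sub>F n in sequentially. likely n \<epsilon> (\<lambda>\<omega>. \<bar>U n \<omega> - W n \<omega>\<bar> \<le> \<epsilon>)"
      using smallD[OF s \<open>\<epsilon> > 0\<close>] \<open>\<epsilon> > 0\<close> unfolding whp_def by blast
    with ev_prob U show "\<forall>\<^sub>F n in sequentially. dist ((\<integral>\<omega>. iexp (U n \<omega>) \<partial>M n) - (\<integral>\<omega>. iexp (W n \<omega>) \<partial>M n)) 0 < e"
    proof eventually_elim
      case (elim n)
      interpret prob_space "M n" by fact
      note [measurable] = elim(2,3)
      obtain A where A[measurable]: "A \<in> sets (M n)" and mA: "measure (M n) A \<ge> 1 - \<epsilon>" and AA: "\<And>\<omega>. \<omega> \<in> A \<Longrightarrow> \<bar>U n \<omega> - W n \<omega>\<bar> \<le> \<epsilon>"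
        using elim(4) unfolding likely_def by blast
      have i: "integrable (M n) (\<lambda>\<omega>. iexp (U n \<omega>))" "integrable (M n) (\<lambda>\<omega>. iexp (W n \<omega>))"
        by (auto intro!: integrable_const_bound[where B=1])
      have i0: "integrable (M n) (\<lambda>\<omega>. 2 * indicator (space (M n) - A) \<omega> :: real)"
        by (intro integrable_mult_right integrable_real_indicator) (auto simp: emeasure_eq_measure)
      then have i2: "integrable (M n) (\<lambda>\<omega>. \<epsilon> + 2 * indicator (space (M n) - A) \<omega>)"
        by (intro Bochner_Integration.integrable_add integrable_const)
      have "cmod ((\<integral>\<omega>. iexp (U n \<omega>) \<partial>M n) - (\<integral>\<omega>. iexp (W n \<omega>) \<partial>M n)) = cmod (\<integral>\<omega>. iexp (U n \<omega>) - iexp (W n \<omega>) \<partial>M n)"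
        using i by simp
      also have "\<dots> \<le> (\<integral>\<omega>. cmod (iexp (U n \<omega>) - iexp (W n \<omega>)) \<partial>M n)"
        by (rule integral_norm_bound)
      also have "\<dots> \<le> (\<integral>\<omega>. \<epsilon> + 2 * indicator (space (M n) - A) \<omega> \<partial>M n)"
      proof (rule integral_mono)
        fix \<omega> assume "\<omega> \<in> space (M n)"
        show "cmod (iexp (U n \<omega>) - iexp (W n \<omega>)) \<le> \<epsilon> + 2 * indicator (space (M n) - A) \<omega>"
        proof (cases "\<omega> \<in> A")
          case True
          then show ?thesis using AA[OF True] iexp_diff_le[of "U n \<omega>" "W n \<omega>"] by simp
        next
          case False
          have "cmod (iexp (U n \<omega>) - iexp (W n \<omega>)) \<le> cmod (iexp (U n \<omega>)) + cmod (iexp (W n \<omega>))"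
            by (rule norm_triangle_ineq4)
          then show ?thesis using False \<open>\<omega> \<in> space (M n)\<close> \<open>\<epsilon> > 0\<close> by simp
        qed
      qed (use i i2 in auto)
      also have "\<dots> = \<epsilon> + 2 * (1 - prob A)"
        using i0 by (subst Bochner_Integration.integral_add) (auto simp: prob_compl prob_space)
      also have "\<dots> \<le> 3 * \<epsilon>" using mA by simp
      also have "\<dots> < e" using \<open>e > 0\<close> by (simp add: \<epsilon>_def)
      finally show ?case by simp
    qed
  qed
  from tendsto_add[OF this W] show ?thesis by simp
qed

end

section \<open>Rows of independent variables with density proportional to \<open>q n\<close>:
  expectations, moments and the central limit theorem\<close>

locale iid_array = power_kernel lam d1 d2 th ell + prob_array M
  for lam d1 d2 :: real and th ell :: "nat \<Rightarrow> real" and M :: "nat \<Rightarrow> 'a measure" +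
  fixes Y :: "nat \<Rightarrow> nat \<Rightarrow> 'a \<Rightarrow> real"
  assumes ev_indep: "\<forall>\<^sub>F n in sequentially. prob_space.indep_vars (M n) (\<lambda>_. borel) (Y n) {1..n}"
    and ev_dens: "\<forall>\<^sub>F n in sequentially. \<forall>i\<in>{1..n}. 
      distributed (M n) lborel (Y n i) (\<lambda>y. ennreal (q n y / (\<integral>y. q n y \<partial>lborel)))"
begin

text \<open>Expectation under the alternative with index \<open>n\<close>. The normalising constant
  enters as an integral of \<open>q n\<close>, so the explicit constant of the density never has to
  be expanded.\<close>

definition Ex :: "nat \<Rightarrow> (real \<Rightarrow> real) \<Rightarrow> real" where
  "Ex n f = (\<integral>y. f y * q n y \<partial>lborel) / (\<integral>y. q n y \<partial>lborel)"

definition E0 :: "(real \<Rightarrow> real) \<Rightarrow> real" where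
  "E0 f = (\<integral>y. f y * pker lam y \<partial>lborel) / (\<integral>y. pker lam y \<partial>lborel)"

definition Sn :: "(real \<Rightarrow> real) \<Rightarrow> nat \<Rightarrow> 'a \<Rightarrow> real" where
  "Sn f n \<omega> = (\<Sum>i=1..n. f (Y n i \<omega>)) / sqrt (real n)"

lemma pker_integral_pos: "(\<integral>y. pker lam y \<partial>lborel) > 0"
proof -
  have a: "1 / lam > 0" "lam > 0" using lam by auto
  have "has_bochner_integral lborel (pker lam) (2 * lam powr (1 / lam - 1) * Gamma (1 / lam))"
    using has_bochner_integral_pker[of lam "\<lambda>_. 1"] Gamma_integral_set[OF a(1)] a(2) by simp
  then show ?thesis
    using a by (simp add: has_bochner_integral_integral_eq Gamma_real_pos)
qed

lemma integral_q_tendsto: "(\<lambda>n. \<integral>y. q n y \<partial>lborel) \<longlonglongrightarrow> (\<integral>y. pker lam y \<partial>lborel)"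
  using q_lim(1)[of "\<lambda>n y. 1" "\<lambda>y. 1" "\<lambda>y. 1"] poly_growth_const by simp

lemma Ex_tendsto:
  assumes "\<And>n. f n \<in> borel_measurable borel" "g \<in> borel_measurable borel"
    "poly_growth b" "\<forall>\<^sub>F n in sequentially. \<forall>y. \<bar>f n y\<bar> \<le> b y"
    "AE y in lborel. (\<lambda>n. f n y) \<longlonglongrightarrow> g y"
  shows "(\<lambda>n. Ex n (f n)) \<longlonglongrightarrow> E0 g"
  unfolding Ex_def E0_def
  using pker_integral_pos by (intro tendsto_divide q_lim(1)[OF assms] integral_q_tendsto) auto

lemma Ex_tendsto_E0:
  assumes "poly_growth f"
  shows "(\<lambda>n. Ex n f) \<longlonglongrightarrow> E0 f"
  by (rule Ex_tendsto[where b="\<lambda>y. \<bar>f y\<bar>"]) (use assms poly_growth_measurable in auto)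

text \<open>For a function centred under the null kernel, the first-order change of the normalising
  constant drops out and only the numerator contributes. For the same reason an additive constant in
  \<open>score\<close> has no effect here.\<close>

lemma sqrt_Ex_tendsto:
  assumes f: "poly_growth f" and 0: "E0 f = 0"
  shows "(\<lambda>n. sqrt (real n) * Ex n f) \<longlonglongrightarrow> E0 (\<lambda>y. f y * score y)"
proof -
  have [measurable]: "f \<in> borel_measurable borel" using f by (rule poly_growth_measurable)
  have z: "(\<integral>y. f y * pker lam y \<partial>lborel) = 0"
    using 0 pker_integral_pos by (simp add: E0_def)
  note L = q_lim[of "\<lambda>n. f" f "\<lambda>y. \<bar>f y\<bar>"]
  have "(\<lambda>n. sqrt (real n) * (\<integral>y. f y * (q n y - pker lam y) \<partial>lborel) / (\<integral>y. q n y \<partial>lborel)) \<longlonglongrightarrow> E0 (\<lambda>y. f y * score y)"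
    unfolding E0_def using pker_integral_pos
    by (intro tendsto_divide L(2) integral_q_tendsto) (use f in auto)
  moreover have "\<forall>\<^sub>F n in sequentially. integrable lborel (\<lambda>y. f y * q n y)"
    by (rule ev_integrable_q[where b="\<lambda>y. \<bar>f y\<bar>"]) (use f in auto)
  then have "\<forall>\<^sub>F n in sequentially. sqrt (real n) * (\<integral>y. f y * (q n y - pker lam y) \<partial>lborel) / (\<integral>y. q n y \<partial>lborel) =
      sqrt (real n) * Ex n f"
  proof eventually_elim
    case (elim n)
    have "(\<integral>y. f y * (q n y - pker lam y) \<partial>lborel) = (\<integral>y. f y * q n y \<partial>lborel)"
      using elim integrable_pker[OF f] z by (simp add: right_diff_distrib)
    then show ?case by (simp add: Ex_def)
  qed
  ultimately show ?thesis by (rule Lim_transform_eventually)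
qed

text \<open>Everything is bundled under one "eventually", so that a single threshold serves all
  \<open>i\<close> and all \<open>f\<close>.\<close>

lemma ev_Y:
  "\<forall>\<^sub>F n in sequentially. \<forall>i\<in>{1..n}. \<forall>f. f \<in> borel_measurable borel \<longrightarrow>
     Y n i \<in> borel_measurable (M n) \<and> (\<integral>\<omega>. f (Y n i \<omega>) \<partial>M n) = Ex n f \<and>
     (integrable lborel (\<lambda>y. f y * q n y) \<longrightarrow> integrable (M n) (\<lambda>\<omega>. f (Y n i \<omega>)))"
proof -
  have "\<forall>\<^sub>F n in sequentially. (\<integral>y. q n y \<partial>lborel) > 0"
    by (rule order_tendstoD(1)[OF integral_q_tendsto pker_integral_pos])
  with ev_dens show ?thesis
  proof eventually_elim
    case (elim n)
    show ?case
    proof (intro ballI allI impI)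
      fix i and f :: "real \<Rightarrow> real" assume i: "i \<in> {1..n}" and f: "f \<in> borel_measurable borel"
      define Z where "Z = (\<integral>y. q n y \<partial>lborel)"
      have Z: "Z > 0" using elim by (simp add: Z_def)
      have D: "distributed (M n) lborel (Y n i) (\<lambda>y. ennreal (q n y / Z))"
        using elim i by (simp add: Z_def)
      have nn: "0 \<le> q n y / Z" for y using Z by (simp add: q_def)
      have m: "Y n i \<in> borel_measurable (M n)"
        using distributed_measurable[OF D] by simp
      have "(\<integral>\<omega>. f (Y n i \<omega>) \<partial>M n) = (\<integral>y. q n y / Z * f y \<partial>lborel)"
        by (rule distributed_integral[OF D, symmetric]) (use f nn in auto)
      also have "\<dots> = (\<integral>y. (f y * q n y) / Z \<partial>lborel)" by (simp add: mult.commute)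
      also have "\<dots> = Ex n f" by (simp add: Ex_def Z_def)
      finally have e: "(\<integral>\<omega>. f (Y n i \<omega>) \<partial>M n) = Ex n f" .
      have "integrable (M n) (\<lambda>\<omega>. f (Y n i \<omega>))" if "integrable lborel (\<lambda>y. f y * q n y)"
      proof (rule distributed_integrable[OF D, THEN iffD1])
        have "(\<lambda>y. q n y / Z * f y) = (\<lambda>y. (f y * q n y) / Z)" by (simp add: mult.commute fun_eq_iff)
        then show "integrable lborel (\<lambda>y. q n y / Z * f y)" using that by simp
      qed (use f nn in auto)
      with m e show "Y n i \<in> borel_measurable (M n) \<and> (\<integral>\<omega>. f (Y n i \<omega>) \<partial>M n) = Ex n f \<and>
         (integrable lborel (\<lambda>y. f y * q n y) \<longrightarrow> integrable (M n) (\<lambda>\<omega>. f (Y n i \<omega>)))" by blast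
    qed
  qed
qed

lemma Sn_second_moment:
  assumes f [measurable]: "\<And>n. f n \<in> borel_measurable borel" 
    and bd: "poly_growth b" "\<forall>\<^sub>F n in sequentially. \<forall>y. \<bar>f n y\<bar> \<le> b y"
  shows "\<forall>\<^sub>F n in sequentially. (\<lambda>\<omega>. Sn (f n) n \<omega>) \<in> borel_measurable (M n) \<and>
     integrable (M n) (\<lambda>\<omega>. (Sn (f n) n \<omega>)\<^sup>2) \<and>
     (\<integral>\<omega>. (Sn (f n) n \<omega>)\<^sup>2 \<partial>M n) \<le> Ex n (\<lambda>y. (f n y)\<^sup>2) + (sqrt (real n) * Ex n (f n))\<^sup>2"
proof -
  \<comment> \<open>With the case distinction the bound by the square of \<open>b\<close> holds for
    every \<open>n\<close>; for large \<open>n\<close> the function is the plain square.\<close>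
  have "\<forall>\<^sub>F n in sequentially. integrable lborel (\<lambda>y. (if \<forall>y. \<bar>f n y\<bar> \<le> b y then (f n y)\<^sup>2 else 0) * q n y)"
  proof (rule ev_integrable_q[of _ "\<lambda>y. (b y)\<^sup>2"])
    show "\<forall>\<^sub>F n in sequentially. \<forall>y. \<bar>if \<forall>y. \<bar>f n y\<bar> \<le> b y then (f n y)\<^sup>2 else 0\<bar> \<le> (b y)\<^sup>2"
      by (intro always_eventually allI) (auto intro: abs_le_square_iff[THEN iffD1] order_trans[OF _ abs_ge_self])
  qed (use bd in auto)
  with bd(2) have i2: "\<forall>\<^sub>F n in sequentially. integrable lborel (\<lambda>y. (f n y)\<^sup>2 * q n y)"
    by eventually_elim simp
  show ?thesis
    using ev_prob ev_indep ev_Y i2 eventually_gt_at_top[of 0]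
  proof eventually_elim
    case (elim n)
    interpret prob_space "M n" by fact
    have Ym: "Y n i \<in> borel_measurable (M n)" if "i \<in> {1..n}" for i using elim(3) that f by blast
    note [measurable] = Ym
    have indep: "indep_vars (\<lambda>_. borel) (\<lambda>i \<omega>. f n (Y n i \<omega>)) {1..n}"
      by (rule indep_vars_compose2[OF elim(2)]) auto
    have f2: "(\<lambda>y. (f n y)\<^sup>2) \<in> borel_measurable borel" by measurable
    have mom: "integrable (M n) (\<lambda>\<omega>. (f n (Y n i \<omega>))\<^sup>2)" "expectation (\<lambda>\<omega>. f n (Y n i \<omega>)) = Ex n (f n)"
        "expectation (\<lambda>\<omega>. (f n (Y n i \<omega>))\<^sup>2) = Ex n (\<lambda>y. (f n y)\<^sup>2)" if "i \<in> {1..n}" for i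
      using elim(3)[rule_format, OF that, of "\<lambda>y. (f n y)\<^sup>2"] elim(3)[rule_format, OF that, of "f n"] elim(4) f2 by auto
    note S = second_moment_sum_iid[OF indep finite_atLeastAtMost mom]
    have S1: "integrable (M n) (\<lambda>\<omega>. (\<Sum>i=1..n. f n (Y n i \<omega>))\<^sup>2)"
      by (rule S(1))
    have S2: "expectation (\<lambda>\<omega>. (\<Sum>i=1..n. f n (Y n i \<omega>))\<^sup>2) \<le> real n * Ex n (\<lambda>y. (f n y)\<^sup>2) + (real n * Ex n (f n))\<^sup>2"
      using S(2) by simp
    have n: "real n > 0" using elim by simp
    have sq: "(Sn (f n) n \<omega>)\<^sup>2 = (\<Sum>i=1..n. f n (Y n i \<omega>))\<^sup>2 / real n" for \<omega>
      by (simp add: Sn_def power_divide)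
    have "(\<integral>\<omega>. (Sn (f n) n \<omega>)\<^sup>2 \<partial>M n) = expectation (\<lambda>\<omega>. (\<Sum>i=1..n. f n (Y n i \<omega>))\<^sup>2) / real n"
      unfolding sq by simp
    also have "\<dots> \<le> (real n * Ex n (\<lambda>y. (f n y)\<^sup>2) + (real n * Ex n (f n))\<^sup>2) / real n"
      using S2 n by (intro divide_right_mono) auto
    also have "\<dots> = Ex n (\<lambda>y. (f n y)\<^sup>2) + (sqrt (real n) * Ex n (f n))\<^sup>2"
      using n by (simp add: power_mult_distrib add_divide_distrib power2_eq_square)
    finally show ?case
      using S1 unfolding sq by (auto simp: Sn_def[abs_def])
  qed
qed

lemma Sn_tight:
  assumes f: "poly_growth f" and 0: "E0 f = 0"
  shows "tight_seq (Sn f)"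
proof (rule tight_of_second_moment)
  have [measurable]: "f \<in> borel_measurable borel" using f by (rule poly_growth_measurable)
  show "\<forall>\<^sub>F n in sequentially. Sn f n \<in> borel_measurable (M n) \<and> integrable (M n) (\<lambda>\<omega>. (Sn f n \<omega>)\<^sup>2) \<and>
     (\<integral>\<omega>. (Sn f n \<omega>)\<^sup>2 \<partial>M n) \<le> Ex n (\<lambda>y. (f y)\<^sup>2) + (sqrt (real n) * Ex n f)\<^sup>2"
    using Sn_second_moment[of "\<lambda>n. f" "\<lambda>y. \<bar>f y\<bar>"] f by auto
  show "(\<lambda>n. Ex n (\<lambda>y. (f y)\<^sup>2) + (sqrt (real n) * Ex n f)\<^sup>2) \<longlonglongrightarrow> E0 (\<lambda>y. (f y)\<^sup>2) + (E0 (\<lambda>y. f y * score y))\<^sup>2"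
    by (intro tendsto_intros Ex_tendsto_E0 sqrt_Ex_tendsto assms poly_growth_power)
qed

lemma Sn_small:
  assumes "\<And>n. f n \<in> borel_measurable borel" 
    and "poly_growth b" "\<forall>\<^sub>F n in sequentially. \<forall>y. \<bar>f n y\<bar> \<le> b y"
    and "(\<lambda>n. Ex n (\<lambda>y. (f n y)\<^sup>2)) \<longlonglongrightarrow> 0" "(\<lambda>n. sqrt (real n) * Ex n (f n)) \<longlonglongrightarrow> 0"
  shows "small (\<lambda>n. Sn (f n) n)"
proof (rule small_of_second_moment)
  show "\<forall>\<^sub>F n in sequentially. Sn (f n) n \<in> borel_measurable (M n) \<and> integrable (M n) (\<lambda>\<omega>. (Sn (f n) n \<omega>)\<^sup>2) \<and>
     (\<integral>\<omega>. (Sn (f n) n \<omega>)\<^sup>2 \<partial>M n) \<le> Ex n (\<lambda>y. (f n y)\<^sup>2) + (sqrt (real n) * Ex n (f n))\<^sup>2"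
    using Sn_second_moment[OF assms(1-3)] by simp
  show "(\<lambda>n. Ex n (\<lambda>y. (f n y)\<^sup>2) + (sqrt (real n) * Ex n (f n))\<^sup>2) \<longlonglongrightarrow> 0"
    using tendsto_add[OF assms(4) tendsto_power[OF assms(5), of 2]] by simp
qed

text \<open>Here \<open>phi n\<close> is the characteristic function of one scaled summand and n *
  (phi n - 1) tends to c = \<i> * m - v / 2: the mean of \<open>f\<close> is of order 1 / sqrt n,
  and bounded third absolute moments make the Taylor remainder vanish. To avoid a complex logarithm,
  phi n ^ n is compared with exp (c / n) ^ n, using that powers of numbers in the closed unit disc
  differ by at most \<open>n\<close> times the difference of the bases.\<close>

theorem Sn_clt:
  assumes f: "poly_growth f" and 0: "E0 f = 0"
  shows "(\<lambda>n. \<integral>\<omega>. iexp (Sn f n \<omega>) \<partial>M n) \<longlonglongrightarrow>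
     exp (\<i> * E0 (\<lambda>y. f y * score y) - E0 (\<lambda>y. (f y)\<^sup>2) / 2)"
proof -
  have [measurable]: "f \<in> borel_measurable borel" using f by (rule poly_growth_measurable)
  define m where "m = E0 (\<lambda>y. f y * score y)"
  define v where "v = E0 (\<lambda>y. (f y)\<^sup>2)"
  define c where "c = \<i> * complex_of_real m - complex_of_real (v / 2)"
  have v: "v \<ge> 0"
    unfolding v_def E0_def using pker_integral_pos
    by (intro divide_nonneg_pos Bochner_Integration.integral_nonneg) (auto simp: pker_pos less_imp_le)
  define phi where "phi n = (\<integral>\<omega>. iexp (f (Y n 1 \<omega>) / sqrt (real n)) \<partial>M n)" for n
  \<comment> \<open>The exact \<open>n\<close>-th root of the limit, with which \<open>phi n\<close>
    is compared.\<close>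
  define wn where "wn n = exp (c / of_nat n)" for n
  have i3: "\<forall>\<^sub>F n in sequentially. integrable lborel (\<lambda>y. f y ^ k * q n y)" for k
    by (rule ev_integrable_q[where b="\<lambda>y. \<bar>f y ^ k\<bar>"]) (use f in auto)
  have i3': "\<forall>\<^sub>F n in sequentially. integrable lborel (\<lambda>y. \<bar>f y\<bar> ^ 3 * q n y)"
    by (rule ev_integrable_q[where b="\<lambda>y. \<bar>\<bar>f y\<bar> ^ 3\<bar>"]) (use f in auto)
  define A where "A n = \<i> * (sqrt (real n) * Ex n f) - Ex n (\<lambda>y. (f y)\<^sup>2) / 2" for n
  have A: "A \<longlonglongrightarrow> c"
    unfolding A_def c_def m_def v_def of_real_divide
    by (intro tendsto_intros Ex_tendsto_E0 sqrt_Ex_tendsto assms poly_growth_power) simp_all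
  have approx: "\<forall>\<^sub>F n in sequentially. cmod (real n * (phi n - 1) - A n) \<le> Ex n (\<lambda>y. \<bar>f y\<bar> ^ 3) / sqrt (real n)"
    using ev_prob ev_Y i3[of 1] i3[of 2] i3' eventually_gt_at_top[of 0]
  proof eventually_elim
    case (elim n)
    interpret prob_space "M n" by fact
    have n: "real n > 0" "1 \<in> {1..n}" using elim(6) by auto
    define s where "s = sqrt (real n)"
    have s: "s > 0" "s\<^sup>2 = real n" using n by (auto simp: s_def)
    define X where "X = (\<lambda>\<omega>. f (Y n 1 \<omega>))"
    have X[measurable]: "X \<in> borel_measurable (M n)"
    proof -
      have [measurable]: "Y n 1 \<in> borel_measurable (M n)"
        using elim(2)[rule_format, OF n(2), of f] by simp
      show ?thesis unfolding X_def by measurable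
    qed
    have mom: "integrable (M n) (\<lambda>\<omega>. g (Y n 1 \<omega>))" "(\<integral>\<omega>. g (Y n 1 \<omega>) \<partial>M n) = Ex n g"
      if "g \<in> borel_measurable borel" "integrable lborel (\<lambda>y. g y * q n y)" for g
      using elim(2)[rule_format, OF n(2) that(1)] that(2) by auto
    have X1: "integrable (M n) X" "expectation X = Ex n f"
      using mom[of f] elim(3) by (auto simp: X_def)
    have X2: "integrable (M n) (\<lambda>\<omega>. (X \<omega>)\<^sup>2)" "expectation (\<lambda>\<omega>. (X \<omega>)\<^sup>2) = Ex n (\<lambda>y. (f y)\<^sup>2)"
      using mom[of "\<lambda>y. (f y)\<^sup>2"] elim(4) by (auto simp: X_def)
    have X3: "integrable (M n) (\<lambda>\<omega>. \<bar>X \<omega>\<bar> ^ 3)" "expectation (\<lambda>\<omega>. \<bar>X \<omega>\<bar> ^ 3) = Ex n (\<lambda>y. \<bar>f y\<bar> ^ 3)"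
      using mom[of "\<lambda>y. \<bar>f y\<bar> ^ 3"] elim(5) by (auto simp: X_def)
    have ie: "integrable (M n) (\<lambda>\<omega>. iexp (X \<omega> / s))"
      by (intro integrable_const_bound[where B=1]) auto
    define P where "P = (\<lambda>\<omega>. 1 + \<i> * complex_of_real (X \<omega>) / s - complex_of_real ((X \<omega>)\<^sup>2) / (2 * s\<^sup>2))"
    have Pi: "integrable (M n) P" unfolding P_def using X1 X2
      by (intro Bochner_Integration.integrable_add Bochner_Integration.integrable_diff integrable_const 
          integrable_divide_zero integrable_mult_right integrable_of_real) auto
    have Pe: "(\<integral>\<omega>. P \<omega> \<partial>M n) = 1 + \<i> * Ex n f / s - Ex n (\<lambda>y. (f y)\<^sup>2) / (2 * s\<^sup>2)"
      unfolding P_def using X1 X2 by (simp add: prob_space flip: of_real_power)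
    have "cmod (phi n - (\<integral>\<omega>. P \<omega> \<partial>M n)) = cmod (\<integral>\<omega>. iexp (X \<omega> / s) - P \<omega> \<partial>M n)"
      unfolding phi_def s_def[symmetric] X_def[symmetric] using ie Pi by (simp add: X_def)
    also have "\<dots> \<le> (\<integral>\<omega>. cmod (iexp (X \<omega> / s) - P \<omega>) \<partial>M n)" by (rule integral_norm_bound)
    also have "\<dots> \<le> (\<integral>\<omega>. \<bar>X \<omega>\<bar> ^ 3 / s ^ 3 \<partial>M n)"
    proof (rule integral_mono)
      fix \<omega>
      have "(\<Sum>k\<le>2. (\<i> * complex_of_real (X \<omega> / s)) ^ k / fact k) = P \<omega>"
        by (simp add: numeral_2_eq_2 P_def power2_eq_square field_simps)
      then have "cmod (iexp (X \<omega> / s) - P \<omega>) \<le> \<bar>X \<omega> / s\<bar> ^ 3 / fact 3"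
        using iexp_approx1[of "X \<omega> / s" 2] by (simp add: eval_nat_numeral)
      also have "\<dots> \<le> \<bar>X \<omega> / s\<bar> ^ 3" by (simp add: divide_le_eq fact_numeral)
      finally show "cmod (iexp (X \<omega> / s) - P \<omega>) \<le> \<bar>X \<omega>\<bar> ^ 3 / s ^ 3"
        using s by (simp add: power_divide)
    qed (use ie Pi X3 in auto)
    also have "\<dots> = Ex n (\<lambda>y. \<bar>f y\<bar> ^ 3) / s ^ 3" using X3 by simp
    finally have b: "cmod (phi n - (\<integral>\<omega>. P \<omega> \<partial>M n)) \<le> Ex n (\<lambda>y. \<bar>f y\<bar> ^ 3) / s ^ 3" .
    \<comment> \<open>The expected quadratic Taylor polynomial reproduces \<open>A n\<close> without
      error, so only the cubic remainder is left.\<close>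
    have "real n * (phi n - 1) - A n = real n * (phi n - (\<integral>\<omega>. P \<omega> \<partial>M n))"
    proof -
      have "real n * ((\<integral>\<omega>. P \<omega> \<partial>M n) - 1) = A n"
      proof -
        have nn: "complex_of_real (real n) = complex_of_real s * complex_of_real s"
          unfolding s(2)[symmetric] by (simp add: power2_eq_square)
        have aux: "z * z * (1 + \<i> * e / z - e' / (2 * z\<^sup>2) - 1) = \<i> * (z * e) - e' / 2"
          if "z \<noteq> 0" for z e e' :: complex
          using that by (simp add: right_diff_distrib power2_eq_square)
        show ?thesis
          unfolding Pe A_def s_def[symmetric] nn of_real_mult
          using aux[of "complex_of_real s" "Ex n f" "Ex n (\<lambda>y. (f y)\<^sup>2)"] s(1) by simp
      qed
      then show ?thesis by (simp add: algebra_simps)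
    qed
    then have "cmod (real n * (phi n - 1) - A n) = real n * cmod (phi n - (\<integral>\<omega>. P \<omega> \<partial>M n))"
      by (simp add: norm_mult)
    also have "\<dots> \<le> real n * (Ex n (\<lambda>y. \<bar>f y\<bar> ^ 3) / s ^ 3)"
      using b by (intro mult_left_mono) auto
    also have "\<dots> = Ex n (\<lambda>y. \<bar>f y\<bar> ^ 3) / s"
      using s(1) by (simp add: s(2)[symmetric] power2_eq_square power3_eq_cube)
    finally show ?case by (simp add: s_def)
  qed
  have nphi: "(\<lambda>n. real n * (phi n - 1)) \<longlonglongrightarrow> c"
  proof -
    have "(\<lambda>n. Ex n (\<lambda>y. \<bar>f y\<bar> ^ 3) / sqrt (real n)) \<longlonglongrightarrow> 0"
      by (rule tendsto_divide_0[OF Ex_tendsto_E0 filterlim_at_top_imp_at_infinity[OF filterlim_sqrt_nat]]) (use f in auto)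
    from tendsto_add[OF Lim_null_comparison[OF approx this] A] show ?thesis by simp
  qed
  have nwn: "(\<lambda>n. real n * (wn n - 1)) \<longlonglongrightarrow> c"
  proof -
    have "((\<lambda>z. exp (c * z)) has_field_derivative c) (at 0)"
      by (auto intro!: derivative_eq_intros)
    then have "((\<lambda>h. (exp (c * h) - 1) / h) \<longlongrightarrow> c) (at 0)" by (simp add: DERIV_def)
    moreover have "(\<lambda>n. inverse (of_nat (Suc n)) :: complex) \<longlonglongrightarrow> 0" by (rule LIMSEQ_Suc[OF lim_inverse_n])
    ultimately have "(\<lambda>n. (exp (c * inverse (of_nat (Suc n))) - 1) / inverse (of_nat (Suc n))) \<longlonglongrightarrow> c"
      unfolding tendsto_at_iff_sequentially comp_def by (auto simp del: of_nat_Suc)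
    then have "(\<lambda>n. real (Suc n) * (wn (Suc n) - 1)) \<longlonglongrightarrow> c"
      by (simp add: wn_def divide_inverse mult.commute del: of_nat_Suc)
    then show ?thesis by (rule LIMSEQ_imp_Suc)
  qed
  have pow: "\<forall>\<^sub>F n in sequentially. cmod ((\<integral>\<omega>. iexp (Sn f n \<omega>) \<partial>M n) - exp c) \<le> cmod (real n * (phi n - 1) - real n * (wn n - 1))"
    using ev_prob ev_indep ev_Y eventually_gt_at_top[of 0]
  proof eventually_elim
    case (elim n)
    interpret prob_space "M n" by fact
    have n: "n > 0" "1 \<in> {1..n}" using elim(4) by auto
    have Ym: "Y n i \<in> borel_measurable (M n)" if "i \<in> {1..n}" for i
      using elim(3)[rule_format, OF that, of f] by simp
    note [measurable] = Ym
    let ?X = "\<lambda>i \<omega>. f (Y n i \<omega>) / sqrt (real n)"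
    have indep: "indep_vars (\<lambda>_. borel) ?X {1..n}"
      by (rule indep_vars_compose2[OF elim(2), where Y="\<lambda>i y. f y / sqrt (real n)"]) auto
    have c1: "char (distr (M n) borel (?X i)) 1 = phi n" if i: "i \<in> {1..n}" for i
    proof -
      have "char (distr (M n) borel (?X i)) 1 = (\<integral>\<omega>. iexp (?X i \<omega>) \<partial>M n)"
        unfolding char_def using Ym[OF i] by (subst integral_distr) auto
      also have "\<dots> = phi n"
      proof -
        have *: "(\<integral>\<omega>. g (Y n i \<omega>) \<partial>M n) = (\<integral>\<omega>. g (Y n 1 \<omega>) \<partial>M n)" if "g \<in> borel_measurable borel" for g :: "real \<Rightarrow> real"
          using elim(3)[rule_format, OF i that] elim(3)[rule_format, OF n(2) that] by simp
        let ?g = "\<lambda>y. iexp (f y / sqrt (real n))"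
        have I: "integrable (M n) (\<lambda>\<omega>. ?g (Y n j \<omega>))" if "j \<in> {1..n}" for j
          using Ym[OF that] by (intro integrable_const_bound[where B=1]) auto
        show ?thesis
          unfolding phi_def
        proof (rule complex_eqI)
          show "Re (\<integral>\<omega>. ?g (Y n i \<omega>) \<partial>M n) = Re (\<integral>\<omega>. ?g (Y n 1 \<omega>) \<partial>M n)"
            using *[of "\<lambda>y. Re (?g y)"] integral_Re[OF I[OF i]] integral_Re[OF I[OF n(2)]] by simp
          show "Im (\<integral>\<omega>. ?g (Y n i \<omega>) \<partial>M n) = Im (\<integral>\<omega>. ?g (Y n 1 \<omega>) \<partial>M n)"
            using *[of "\<lambda>y. Im (?g y)"] integral_Im[OF I[OF i]] integral_Im[OF I[OF n(2)]] by simp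
        qed
      qed
      finally show ?thesis .
    qed
    have "(\<integral>\<omega>. iexp (Sn f n \<omega>) \<partial>M n) = char (distr (M n) borel (\<lambda>\<omega>. \<Sum>i=1..n. ?X i \<omega>)) 1"
      unfolding char_def by (subst integral_distr) (auto simp: Sn_def sum_divide_distrib)
    also have "\<dots> = (\<Prod>i=1..n. char (distr (M n) borel (?X i)) 1)" by (rule char_distr_sum[OF indep])
    also have "\<dots> = phi n ^ n" using c1 by simp
    finally have e1: "(\<integral>\<omega>. iexp (Sn f n \<omega>) \<partial>M n) = phi n ^ n" .
    have e2: "exp c = wn n ^ n"
      using n unfolding wn_def by (simp flip: exp_of_nat_mult)
    interpret D: real_distribution "distr (M n) borel (?X 1)"
      using Ym[OF n(2)] by (intro real_distribution_distr) auto
    have "cmod (phi n) \<le> 1" using D.cmod_char_le_1[of 1] c1[OF n(2)] by simp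
    moreover have "cmod (wn n) \<le> 1"
    proof -
      \<comment> \<open>Nonnegativity of the limiting variance keeps \<open>wn n\<close> in the unit
        disc.\<close>
      have "Re c \<le> 0" using v by (simp add: c_def)
      then have "Re (c / of_nat n) \<le> 0" by (simp add: divide_nonpos_nonneg Re_divide_of_nat)
      then show ?thesis by (simp add: wn_def norm_exp_eq_Re)
    qed
    ultimately have "cmod (phi n ^ n - wn n ^ n) \<le> real n * cmod (phi n - wn n)"
      by (intro norm_power_diff)
    also have "\<dots> = cmod (real n * (phi n - 1) - real n * (wn n - 1))"
      by (simp add: norm_mult flip: right_diff_distrib)
    finally show ?case unfolding e1 e2 .
  qed
  have "(\<lambda>n. cmod (real n * (phi n - 1) - real n * (wn n - 1))) \<longlonglongrightarrow> 0"
    using tendsto_norm[OF tendsto_diff[OF nphi nwn]] by simp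
  from Lim_null_comparison[OF pow this] have "(\<lambda>n. (\<integral>\<omega>. iexp (Sn f n \<omega>) \<partial>M n) - exp c) \<longlonglongrightarrow> 0" .
  then have "(\<lambda>n. \<integral>\<omega>. iexp (Sn f n \<omega>) \<partial>M n) \<longlonglongrightarrow> exp c" by (rule LIM_zero_cancel)
  then show ?thesis by (simp add: c_def m_def v_def)
qed

end

subsection \<open>Linearisation of monotone functionals\<close>

lemma poly_growth_shift_bound:
  fixes f :: "real \<Rightarrow> real"
  assumes "C \<ge> 0" "\<And>y. \<bar>f y\<bar> \<le> C * (1 + \<bar>y\<bar>) ^ k" "\<bar>h\<bar> \<le> c"
  shows "\<bar>f (y - h)\<bar> \<le> C * (1 + c) ^ k * (1 + \<bar>y\<bar>) ^ k"
proof -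
  have "\<bar>f (y - h)\<bar> \<le> C * (1 + \<bar>y - h\<bar>) ^ k" by (rule assms)
  also have "\<dots> \<le> C * ((1 + c) * (1 + \<bar>y\<bar>)) ^ k"
  proof (intro mult_left_mono power_mono)
    have "1 + \<bar>y - h\<bar> \<le> 1 + \<bar>y\<bar> + c" using assms(3) by linarith
    also have "\<dots> \<le> (1 + c) * (1 + \<bar>y\<bar>)" using assms(3) by (simp add: algebra_simps)
    finally show "1 + \<bar>y - h\<bar> \<le> (1 + c) * (1 + \<bar>y\<bar>)" .
  qed (use assms in auto)
  finally show ?thesis by (simp add: power_mult_distrib)
qed

lemma poly_growth_shift:
  assumes "poly_growth f"
  shows "poly_growth (\<lambda>y. f (y - h))"
proof -
  obtain C k where f: "C \<ge> 0" "\<And>y. \<bar>f y\<bar> \<le> C * (1 + \<bar>y\<bar>) ^ k"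
    using poly_growthE[OF assms] by metis
  have [measurable]: "f \<in> borel_measurable borel" using assms by (rule poly_growth_measurable)
  show ?thesis
    by (rule poly_growthI[of _ "C * (1 + \<bar>h\<bar>) ^ k" k]) (use poly_growth_shift_bound[OF f] in auto)
qed

lemma poly_growth_reflect:
  assumes "poly_growth f"
  shows "poly_growth (\<lambda>y. f (- y))"
proof -
  obtain C k where "\<And>y. \<bar>f y\<bar> \<le> C * (1 + \<bar>y\<bar>) ^ k" using poly_growthE[OF assms] by metis
  from this[of "- _"] show ?thesis
    using poly_growth_measurable[OF assms] by (intro poly_growthI[of _ C k]) auto
qed

context iid_array
begin

lemma E0_add:
  assumes "poly_growth f" "poly_growth g"
  shows "E0 (\<lambda>y. f y + g y) = E0 f + E0 g"
  using integrable_pker[OF assms(1)] integrable_pker[OF assms(2)]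
  by (simp add: E0_def distrib_right add_divide_distrib)

lemma E0_cmult: "E0 (\<lambda>y. c * f y) = c * E0 f"
  by (simp add: E0_def mult.assoc)

lemma E0_const: "E0 (\<lambda>y. c) = c"
  using pker_integral_pos by (simp add: E0_def)

lemma E0_diff:
  assumes "poly_growth f" "poly_growth g"
  shows "E0 (\<lambda>y. f y - g y) = E0 f - E0 g"
  using E0_add[OF assms(1) poly_growth_uminus[OF assms(2)]] E0_cmult[of "-1" g] by simp

lemma E0_odd:
  assumes "\<And>y. f (- y) = - f y"
  shows "E0 f = 0"
proof -
  have "(\<integral>y. f y * pker lam y \<partial>lborel) = (\<integral>y. f (- y) * pker lam (- y) \<partial>lborel)"
    by (subst lborel_integral_real_affine[where c="-1" and t=0]) auto
  also have "\<dots> = - (\<integral>y. f y * pker lam y \<partial>lborel)"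
    by (simp add: assms pker_def)
  finally show ?thesis by (simp add: E0_def)
qed

text \<open>The error of the linear expansion of a sum whose argument is shifted by t / sqrt n; the
  expected slope in \<open>t\<close> is minus the covariance of \<open>f\<close> with the location
  score.\<close>

definition rem :: "(real \<Rightarrow> real) \<Rightarrow> nat \<Rightarrow> 'a \<Rightarrow> real \<Rightarrow> real" where
  "rem f n \<omega> t = Sn (\<lambda>y. f (y - t / sqrt (real n))) n \<omega> - Sn f n \<omega> + E0 (\<lambda>y. f y * psi y) * t"

definition lin :: "(real \<Rightarrow> real) \<Rightarrow> bool" where
  "lin f \<longleftrightarrow> (\<forall>K. \<forall>\<epsilon>>0. whp (\<lambda>n \<omega>. \<forall>t. \<bar>t\<bar> \<le> K \<longrightarrow> \<bar>rem f n \<omega> t\<bar> \<le> \<epsilon>))"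

lemma linD: "lin f \<Longrightarrow> \<epsilon> > 0 \<Longrightarrow> whp (\<lambda>n \<omega>. \<forall>t. \<bar>t\<bar> \<le> K \<longrightarrow> \<bar>rem f n \<omega> t\<bar> \<le> \<epsilon>)"
  by (simp add: lin_def)

text \<open>The increment of \<open>f\<close> tends to \<open>0\<close>, so \<open>q n\<close> may be replaced by \<open>pker\<close> in the mean at the cost of \<open>o(1)\<close>.
  Only the smoothness of \<open>pker\<close> is then needed; for \<open>lam = 1\<close> the derivative of \<open>q n\<close> can be unbounded at \<open>0\<close>.\<close>

lemma lin_pointwise:
  assumes f: "poly_growth f" and cont: "AE y in lborel. isCont f y"
  shows "small (\<lambda>n \<omega>. rem f n \<omega> t)"
proof -
  have [measurable]: "f \<in> borel_measurable borel" using f by (rule poly_growth_measurable)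
  define b where "b = E0 (\<lambda>y. f y * psi y)"
  define h where "h = (\<lambda>n. t / sqrt (real n))"
  define d where "d = (\<lambda>n y. f (y - h n) - f y)"
  have [measurable]: "d n \<in> borel_measurable borel" for n unfolding d_def by measurable
  have sh: "(\<lambda>n. sqrt (real n) * h n) \<longlonglongrightarrow> t"
  proof (rule tendsto_eventually)
    show "\<forall>\<^sub>F n in sequentially. sqrt (real n) * h n = t"
      using eventually_gt_at_top[of 0] by eventually_elim (simp add: h_def)
  qed
  have h0: "h \<longlonglongrightarrow> 0"
    using delta_method(1)[OF DERIV_ident filterlim_sqrt_nat, of h 0 t] sh by simp
  have hb: "\<forall>\<^sub>F n in sequentially. \<bar>h n\<bar> \<le> 1"
    using tendstoD[OF h0, of 1] by (auto elim!: eventually_mono simp: dist_real_def)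
  obtain C k where Ck: "C \<ge> 0" "\<And>y. \<bar>f y\<bar> \<le> C * (1 + \<bar>y\<bar>) ^ k"
    using poly_growthE[OF f] by metis
  define B where "B = (\<lambda>y. C * 2 ^ k * (1 + \<bar>y\<bar>) ^ k + \<bar>f y\<bar>)"
  have "poly_growth (\<lambda>y. C * 2 ^ k * (1 + \<bar>y\<bar>) ^ k)"
    by (rule poly_growthI[of _ "C * 2 ^ k" k]) (use Ck in auto)
  then have B: "poly_growth B" unfolding B_def using f by (intro poly_growth_add poly_growth_abs)
  have dB: "\<forall>\<^sub>F n in sequentially. \<forall>y. \<bar>d n y\<bar> \<le> B y"
    using hb
  proof eventually_elim
    case (elim n)
    show ?case
    proof
      fix y
      have "\<bar>f (y - h n)\<bar> \<le> C * 2 ^ k * (1 + \<bar>y\<bar>) ^ k"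
        using poly_growth_shift_bound[OF Ck elim] by simp
      then show "\<bar>d n y\<bar> \<le> B y" unfolding d_def B_def by linarith
    qed
  qed
  have d0: "AE y in lborel. (\<lambda>n. d n y) \<longlonglongrightarrow> 0"
    using cont
  proof eventually_elim
    case (elim y)
    have "(\<lambda>n. y - h n) \<longlonglongrightarrow> y - 0" by (intro tendsto_intros h0)
    then have "(\<lambda>n. f (y - h n)) \<longlonglongrightarrow> f y" using isCont_tendsto_compose[OF elim] by simp
    then show ?case unfolding d_def by (simp add: LIM_zero)
  qed
  have dpg: "poly_growth (d n)" for n
    unfolding d_def by (intro poly_growth_diff poly_growth_shift f)
  have L1: "(\<lambda>n. sqrt (real n) * (\<integral>y. d n y * pker lam y \<partial>lborel)) \<longlonglongrightarrow> - t * (\<integral>y. f y * psi y * pker lam y \<partial>lborel)"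
    unfolding d_def by (rule shift_lim[OF f sh])
  have L2: "(\<lambda>n. sqrt (real n) * (\<integral>y. d n y * (q n y - pker lam y) \<partial>lborel)) \<longlonglongrightarrow> (\<integral>y. 0 * score y * pker lam y \<partial>lborel)"
    by (rule q_lim(2)[OF _ _ B dB d0]) measurable
  have L: "(\<lambda>n. (sqrt (real n) * (\<integral>y. d n y * pker lam y \<partial>lborel) + sqrt (real n) * (\<integral>y. d n y * (q n y - pker lam y) \<partial>lborel)) / (\<integral>y. q n y \<partial>lborel))
      \<longlonglongrightarrow> (- t * (\<integral>y. f y * psi y * pker lam y \<partial>lborel) + (\<integral>y. 0 * score y * pker lam y \<partial>lborel)) / (\<integral>y. pker lam y \<partial>lborel)"
    using pker_integral_pos by (intro tendsto_intros L1 L2 integral_q_tendsto) auto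
  have "\<forall>\<^sub>F n in sequentially. integrable lborel (\<lambda>y. d n y * q n y)"
    by (rule ev_integrable_q[OF _ B dB]) measurable
  then have ev: "\<forall>\<^sub>F n in sequentially. (sqrt (real n) * (\<integral>y. d n y * pker lam y \<partial>lborel) + sqrt (real n) * (\<integral>y. d n y * (q n y - pker lam y) \<partial>lborel)) / (\<integral>y. q n y \<partial>lborel)
     = sqrt (real n) * Ex n (d n)"
  proof eventually_elim
    case (elim n)
    have "(\<integral>y. d n y * (q n y - pker lam y) \<partial>lborel) = (\<integral>y. d n y * q n y \<partial>lborel) - (\<integral>y. d n y * pker lam y \<partial>lborel)"
      using elim integrable_pker[OF dpg[of n]] by (simp add: right_diff_distrib)
    then have "sqrt (real n) * (\<integral>y. d n y * pker lam y \<partial>lborel) + sqrt (real n) * (\<integral>y. d n y * (q n y - pker lam y) \<partial>lborel)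
        = sqrt (real n) * (\<integral>y. d n y * q n y \<partial>lborel)"
      by (simp only: right_diff_distrib) 
    then show ?case unfolding Ex_def by (simp only: times_divide_eq_right)
  qed
  have Ld: "(\<lambda>n. sqrt (real n) * Ex n (d n)) \<longlonglongrightarrow> - t * b"
    using Lim_transform_eventually[OF L ev] by (simp add: b_def E0_def)
  \<comment> \<open>Adding b * h n makes the mean of the increment o(1 / sqrt n), while its second
    moment still tends to 0; the second moment bound for sums then applies.\<close>
  define F where "F = (\<lambda>n y. d n y + b * h n)"
  have [measurable]: "F n \<in> borel_measurable borel" for n unfolding F_def by measurable
  have FB: "\<forall>\<^sub>F n in sequentially. \<forall>y. \<bar>F n y\<bar> \<le> B y + \<bar>b\<bar>"
    using dB hb
  proof eventually_elim
    case (elim n)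
    show ?case
    proof
      fix y
      have "\<bar>b * h n\<bar> \<le> \<bar>b\<bar>" using elim(2) by (simp add: abs_mult mult_left_le)
      then show "\<bar>F n y\<bar> \<le> B y + \<bar>b\<bar>" using elim(1)[rule_format, of y] unfolding F_def by linarith
    qed
  qed
  have B': "poly_growth (\<lambda>y. B y + \<bar>b\<bar>)" by (intro poly_growth_add B poly_growth_const)
  have "small (\<lambda>n. Sn (F n) n)"
  proof (rule Sn_small[OF _ B' FB])
    have "(\<lambda>n. Ex n (\<lambda>y. (F n y)\<^sup>2)) \<longlonglongrightarrow> E0 (\<lambda>y. 0)"
    proof (rule Ex_tendsto[where b="\<lambda>y. (B y + \<bar>b\<bar>)\<^sup>2"])
      show "\<forall>\<^sub>F n in sequentially. \<forall>y. \<bar>(F n y)\<^sup>2\<bar> \<le> (B y + \<bar>b\<bar>)\<^sup>2"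
        using FB by eventually_elim (auto intro!: abs_le_square_iff[THEN iffD1] order_trans[OF _ abs_ge_self])
      show "AE y in lborel. (\<lambda>n. (F n y)\<^sup>2) \<longlonglongrightarrow> 0"
        using d0
      proof eventually_elim
        case (elim y)
        have "(\<lambda>n. (F n y)\<^sup>2) \<longlonglongrightarrow> (0 + b * 0)\<^sup>2" unfolding F_def by (intro tendsto_intros elim h0)
        then show ?case by simp
      qed
    qed (use B' in auto)
    then show "(\<lambda>n. Ex n (\<lambda>y. (F n y)\<^sup>2)) \<longlonglongrightarrow> 0" by (simp add: E0_const)
    have "\<forall>\<^sub>F n in sequentially. (\<integral>y. q n y \<partial>lborel) > 0"
      by (rule order_tendstoD(1)[OF integral_q_tendsto pker_integral_pos])
    moreover have "\<forall>\<^sub>F n in sequentially. integrable lborel (\<lambda>y. 1 * q n y)"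
      by (rule ev_integrable_q[where b="\<lambda>_. 1"]) auto
    moreover have "\<forall>\<^sub>F n in sequentially. integrable lborel (\<lambda>y. d n y * q n y)"
      by (rule ev_integrable_q[OF _ B dB]) measurable
    ultimately have eqF: "\<forall>\<^sub>F n in sequentially. sqrt (real n) * Ex n (d n) + b * (sqrt (real n) * h n) = sqrt (real n) * Ex n (F n)"
    proof eventually_elim
      case (elim n)
      have "Ex n (F n) = Ex n (d n) + b * h n"
        unfolding Ex_def F_def using elim by (simp add: distrib_right add_divide_distrib)
      then show ?case by (simp add: algebra_simps)
    qed
    have "(\<lambda>n. sqrt (real n) * Ex n (d n) + b * (sqrt (real n) * h n)) \<longlonglongrightarrow> - t * b + b * t"
      by (rule tendsto_add[OF Ld tendsto_mult_left[OF sh]])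
    then have "(\<lambda>n. sqrt (real n) * Ex n (F n)) \<longlonglongrightarrow> - t * b + b * t"
      by (rule Lim_transform_eventually[OF _ eqF])
    then show "(\<lambda>n. sqrt (real n) * Ex n (F n)) \<longlonglongrightarrow> 0" by simp
  qed measurable
  then show ?thesis
  proof (rule small_cong)
    show "\<forall>\<^sub>F n in sequentially. \<forall>\<omega>\<in>space (M n). Sn (F n) n \<omega> = rem f n \<omega> t"
      using eventually_gt_at_top[of 0]
    proof eventually_elim
      case (elim n)
      then have "real n * (b * h n) / sqrt (real n) = b * t"
        by (simp add: h_def real_div_sqrt field_simps)
      then show ?case
        by (simp add: rem_def Sn_def F_def d_def h_def b_def sum.distrib sum_subtractf add_divide_distrib diff_divide_distrib)
    qed
  qed
qed

text \<open>Both terms of the remainder are monotone, so a fine finite grid controls it on \<open>[-K, K]\<close>.\<close>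

lemma lin_mono:
  assumes f: "poly_growth f" and mono: "mono f"
  shows "lin f"
  unfolding lin_def
proof (intro allI impI)
  fix K \<epsilon> :: real assume "\<epsilon> > 0"
  define b where "b = E0 (\<lambda>y. f y * psi y)"
  \<comment> \<open>Mesh of the grid: the linear term moves by at most \<epsilon> / 2 across a cell,
    and the other half is left for the remainder at the nodes.\<close>
  define \<delta> where "\<delta> = \<epsilon> / (2 * (\<bar>b\<bar> + 1))"
  have \<delta>: "\<delta> > 0" "\<bar>b\<bar> * \<delta> \<le> \<epsilon> / 2"
    using \<open>\<epsilon> > 0\<close> by (auto simp: \<delta>_def field_simps add_nonneg_pos)
  define J where "J = nat \<lceil>2 * \<bar>K\<bar> / \<delta>\<rceil> + 1"
  define g where "g = (\<lambda>j. - \<bar>K\<bar> + real j * \<delta>)"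
  have "AE y in lborel. isCont f y"
  proof -
    have "countable {a. \<not> isCont f a}" using mono by (rule mono_ctble_discont)
    then show ?thesis
      by (intro AE_I'[of "{a. \<not> isCont f a}"] countable_imp_null_set_lborel) auto
  qed
  from lin_pointwise[OF f this] have "whp (\<lambda>n \<omega>. \<forall>j\<in>{..J}. \<bar>rem f n \<omega> (g j)\<bar> \<le> \<epsilon> / 2)"
    using \<open>\<epsilon> > 0\<close> by (intro whp_ball smallD) auto
  then show "whp (\<lambda>n \<omega>. \<forall>t. \<bar>t\<bar> \<le> K \<longrightarrow> \<bar>rem f n \<omega> t\<bar> \<le> \<epsilon>)"
  proof (rule whp_mono, intro always_eventually allI ballI impI)
    fix n \<omega> t assume g: "\<forall>j\<in>{..J}. \<bar>rem f n \<omega> (g j)\<bar> \<le> \<epsilon> / 2" and t: "\<bar>t\<bar> \<le> K"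
    define j where "j = nat \<lfloor>(t + \<bar>K\<bar>) / \<delta>\<rfloor>"
    have nn: "(t + \<bar>K\<bar>) / \<delta> \<ge> 0" using t \<delta> by auto
    have j1: "real j \<le> (t + \<bar>K\<bar>) / \<delta>" "(t + \<bar>K\<bar>) / \<delta> < real j + 1"
      using nn unfolding j_def by linarith+
    then have j2: "g j \<le> t" "t \<le> g (j + 1)"
      using \<delta>(1) by (auto simp: g_def field_simps)
    have "(t + \<bar>K\<bar>) / \<delta> \<le> 2 * \<bar>K\<bar> / \<delta>" using t \<delta>(1) by (intro divide_right_mono) auto
    then have "real j \<le> 2 * \<bar>K\<bar> / \<delta>" using j1 by linarith
    then have "j + 1 \<le> J" unfolding J_def by linarith
    then have r: "\<bar>rem f n \<omega> (g j)\<bar> \<le> \<epsilon> / 2" "\<bar>rem f n \<omega> (g (j + 1))\<bar> \<le> \<epsilon> / 2" using g by auto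
    \<comment> \<open>Up to a summand free of \<open>t\<close>, rem f n \<omega> t - b * t is the
      shifted sum, which decreases in \<open>t\<close> because \<open>f\<close> increases.\<close>
    have dec: "rem f n \<omega> t' - b * t' \<le> rem f n \<omega> s - b * s" if "s \<le> t'" for s t'
    proof -
      have "s / sqrt (real n) \<le> t' / sqrt (real n)" using that by (intro divide_right_mono) auto
      then show ?thesis
        unfolding rem_def b_def Sn_def using mono by (auto intro!: divide_right_mono sum_mono simp: mono_def)
    qed
    have step: "\<bar>b * (t - g j)\<bar> \<le> \<epsilon> / 2" "\<bar>b * (g (j + 1) - t)\<bar> \<le> \<epsilon> / 2"
    proof -
      have "g (j + 1) = g j + \<delta>" by (simp add: g_def algebra_simps)
      then have le: "\<bar>t - g j\<bar> \<le> \<delta>" "\<bar>g (j + 1) - t\<bar> \<le> \<delta>" using j2 by auto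
      show "\<bar>b * (t - g j)\<bar> \<le> \<epsilon> / 2" "\<bar>b * (g (j + 1) - t)\<bar> \<le> \<epsilon> / 2"
        unfolding abs_mult
        by (rule order_trans[OF mult_left_mono[OF le(1) abs_ge_zero] \<delta>(2)],
            rule order_trans[OF mult_left_mono[OF le(2) abs_ge_zero] \<delta>(2)])
    qed
    show "\<bar>rem f n \<omega> t\<bar> \<le> \<epsilon>"
      using dec[OF j2(1)] dec[OF j2(2)] r step
      unfolding right_diff_distrib by linarith
  qed
qed

lemma lin_add:
  assumes f: "poly_growth f" "lin f" and g: "poly_growth g" "lin g"
  shows "lin (\<lambda>y. f y + g y)"
  unfolding lin_def
proof (intro allI impI)
  fix K \<epsilon> :: real assume "\<epsilon> > 0"
  then have h: "\<epsilon> / 2 > 0" by simp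
  have "E0 (\<lambda>y. (f y + g y) * psi y) = E0 (\<lambda>y. f y * psi y) + E0 (\<lambda>y. g y * psi y)"
    unfolding distrib_right by (intro E0_add poly_growth_mult f g poly_growth_psi)
  then have r: "rem (\<lambda>y. f y + g y) n \<omega> t = rem f n \<omega> t + rem g n \<omega> t" for n \<omega> t
    by (simp add: rem_def Sn_def sum.distrib add_divide_distrib algebra_simps)
  show "whp (\<lambda>n \<omega>. \<forall>t. \<bar>t\<bar> \<le> K \<longrightarrow> \<bar>rem (\<lambda>y. f y + g y) n \<omega> t\<bar> \<le> \<epsilon>)"
  proof (rule whp_mono2[OF linD[OF f(2) h, of K] linD[OF g(2) h, of K]], intro always_eventually allI ballI impI)
    fix n \<omega> t
    assume "\<forall>t. \<bar>t\<bar> \<le> K \<longrightarrow> \<bar>rem f n \<omega> t\<bar> \<le> \<epsilon> / 2" "\<forall>t. \<bar>t\<bar> \<le> K \<longrightarrow> \<bar>rem g n \<omega> t\<bar> \<le> \<epsilon> / 2" "\<bar>t\<bar> \<le> K"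
    then have "\<bar>rem f n \<omega> t\<bar> \<le> \<epsilon> / 2" "\<bar>rem g n \<omega> t\<bar> \<le> \<epsilon> / 2" by auto
    then show "\<bar>rem (\<lambda>y. f y + g y) n \<omega> t\<bar> \<le> \<epsilon>" unfolding r by linarith
  qed
qed

lemma lin_uminus:
  assumes "lin f"
  shows "lin (\<lambda>y. - f y)"
proof -
  have "rem (\<lambda>y. - f y) n \<omega> t = - rem f n \<omega> t" for n \<omega> t
    by (simp add: rem_def Sn_def sum_negf E0_def)
  then show ?thesis using assms by (simp add: lin_def)
qed

lemma lin_diff:
  assumes "poly_growth f" "lin f" "poly_growth g" "lin g"
  shows "lin (\<lambda>y. f y - g y)"
  using lin_add[OF assms(1,2) poly_growth_uminus[OF assms(3)] lin_uminus[OF assms(4)]] by simp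

lemma lin_antimono:
  assumes f: "poly_growth f" and mono: "antimono f"
  shows "lin f"
proof -
  have "lin (\<lambda>y. - f y)"
    using mono by (intro lin_mono poly_growth_uminus f) (auto simp: antimono_def mono_def)
  from lin_uminus[OF this] show ?thesis by simp
qed

lemma lin_subst:
  assumes f: "lin f" and \<tau>: "tight_seq \<tau>"
  shows "small (\<lambda>n \<omega>. rem f n \<omega> (\<tau> n \<omega>))"
proof (rule small_of_tight[OF \<tau>])
  fix K \<epsilon> :: real assume "\<epsilon> > 0"
  show "whp (\<lambda>n \<omega>. \<bar>\<tau> n \<omega>\<bar> \<le> K \<longrightarrow> \<bar>rem f n \<omega> (\<tau> n \<omega>)\<bar> \<le> \<epsilon>)"
    by (rule whp_mono[OF linD[OF f \<open>\<epsilon> > 0\<close>, of K]]) (simp add: always_eventually)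
qed

end

subsection \<open>Location estimators\<close>

definition loc_score :: "real \<Rightarrow> nat \<Rightarrow> (nat \<Rightarrow> real) \<Rightarrow> real \<Rightarrow> real" where
  "loc_score lam n x m = (\<Sum>i=1..n. \<bar>x i - m\<bar> powr (lam - 1) * sgn (x i - m))"

lemma mono_signed_powr:
  fixes a :: real
  assumes "a \<ge> 0"
  shows "mono (\<lambda>y. \<bar>y\<bar> powr a * sgn y)"
proof (rule monoI)
  fix x y :: real assume "x \<le> y"
  consider "x > 0" | "y < 0" | "x \<le> 0" "y \<ge> 0" by linarith
  then show "\<bar>x\<bar> powr a * sgn x \<le> \<bar>y\<bar> powr a * sgn y"
  proof cases
    case 1
    then show ?thesis using \<open>x \<le> y\<close> assms by (simp add: powr_mono2)
  next
    case 2
    then show ?thesis using \<open>x \<le> y\<close> assms by (simp add: powr_mono2)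
  next
    case 3
    then have "\<bar>x\<bar> powr a * sgn x \<le> 0" "\<bar>y\<bar> powr a * sgn y \<ge> 0"
      by (auto simp: sgn_if)
    then show ?thesis by linarith
  qed
qed

lemma signed_powr_strict_mono:
  fixes a x y :: real
  assumes "a > 0" "x < y"
  shows "\<bar>x\<bar> powr a * sgn x < \<bar>y\<bar> powr a * sgn y"
proof -
  consider "x \<ge> 0" | "y \<le> 0" | "x < 0" "y > 0" using assms by linarith
  then show ?thesis
  proof cases
    case 1
    then show ?thesis using assms by (cases "x = 0") (auto simp: powr_less_mono2)
  next
    case 2
    then have "\<bar>y\<bar> powr a < \<bar>x\<bar> powr a" using assms by (intro powr_less_mono2) auto
    then show ?thesis using 2 assms by (cases "y = 0") (auto simp: sgn_if)
  next
    case 3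
    then have "\<bar>x\<bar> powr a * sgn x < 0" "0 < \<bar>y\<bar> powr a * sgn y" by auto
    then show ?thesis by (rule less_trans)
  qed
qed

lemma loc_score_strict_antimono:
  assumes "lam > 1" "n \<ge> 1" "m < m'"
  shows "loc_score lam n x m' < loc_score lam n x m"
  unfolding loc_score_def
  using assms by (intro sum_strict_mono signed_powr_strict_mono) auto

lemma continuous_loc_score:
  assumes "lam > 1"
  shows "continuous_on UNIV (loc_score lam n x)"
proof -
  \<comment> \<open>The sign is discontinuous, but the signed power is a difference of powers of the
    positive and negative parts, which are continuous for a positive exponent.\<close>
  have "\<bar>y\<bar> powr (lam - 1) * sgn y = max y 0 powr (lam - 1) - max (- y) 0 powr (lam - 1)" for y :: real
    by (auto simp: sgn_if max_def)
  then have "loc_score lam n x = (\<lambda>m. \<Sum>i=1..n. max (x i - m) 0 powr (lam - 1) - max (- (x i - m)) 0 powr (lam - 1))"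
    by (simp add: loc_score_def fun_eq_iff)
  moreover have "continuous_on UNIV (\<lambda>m. max (x i - m) 0 powr (lam - 1))"
    "continuous_on UNIV (\<lambda>m. max (- (x i - m)) 0 powr (lam - 1))" for i
    using assms by (intro continuous_on_powr' continuous_on_max continuous_on_diff continuous_on_minus
      continuous_on_const continuous_on_id ballI impI; simp)+
  ultimately show ?thesis
    by (auto intro!: continuous_on_sum continuous_on_diff)
qed

text \<open>The estimating function is nonnegative at the sample minimum and nonpositive at the
  maximum; the intermediate value theorem yields a root and strict monotonicity its uniqueness. This
  gives the definite description in \<open>mu_hat\<close> its meaning.\<close>

lemma mu_hat_unique:
  assumes lam: "lam > 1" and n: "n \<ge> 1"
  shows "loc_score lam n x (mu_hat lam n x) = 0"
proof -
  let ?f = "loc_score lam n x"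
  define a where "a = Min (x ` {1..n})"
  define b where "b = Max (x ` {1..n})"
  have ab: "a \<le> x i" "x i \<le> b" if "i \<in> {1..n}" for i
    using that by (auto simp: a_def b_def)
  have "?f a \<ge> 0"
    unfolding loc_score_def using ab(1) by (intro sum_nonneg mult_nonneg_nonneg) auto
  moreover have "?f b \<le> 0"
    unfolding loc_score_def using ab(2) by (intro sum_nonpos mult_nonneg_nonpos) auto
  moreover have "a \<le> b" using ab[of 1] n by force
  ultimately obtain m where m: "?f m = 0"
    using IVT2'[of ?f b 0 a] continuous_on_subset[OF continuous_loc_score[OF lam]] by blast
  have "\<exists>!m. ?f m = 0"
  proof (rule ex1I[of "\<lambda>m. loc_score lam n x m = 0" m, OF m])
    fix m' assume "?f m' = 0"
    then show "m' = m" using m loc_score_strict_antimono[OF lam n, of m m' x] loc_score_strict_antimono[OF lam n, of m' m x]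
      by (cases m m' rule: linorder_cases) auto
  qed
  then have "?f (THE m. ?f m = 0) = 0" by (rule theI')
  then show ?thesis using lam by (simp add: mu_hat_def loc_score_def)
qed

text \<open>In a sorted list the positions of the entries up to \<open>c\<close> form an initial
  segment, so its length decides the question.\<close>

lemma sorted_nth_le_iff:
  fixes xs :: "real list"
  assumes "sorted xs" "k < length xs"
  shows "xs ! k \<le> c \<longleftrightarrow> k < length (filter (\<lambda>x. x \<le> c) xs)"
proof
  let ?A = "{i. i < length xs \<and> xs ! i \<le> c}"
  have card: "length (filter (\<lambda>x. x \<le> c) xs) = card ?A" by (simp add: length_filter_conv_card)
  show "k < length (filter (\<lambda>x. x \<le> c) xs)" if "xs ! k \<le> c"
  proof -
    have "{..k} \<subseteq> ?A" using assms that by (auto intro: order_trans[OF sorted_nth_mono])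
    then have "card {..k} \<le> card ?A" by (intro card_mono) auto
    then show ?thesis unfolding card by simp
  qed
  show "xs ! k \<le> c" if "k < length (filter (\<lambda>x. x \<le> c) xs)"
  proof (rule ccontr)
    assume "\<not> xs ! k \<le> c"
    then have "?A \<subseteq> {..<k}" using assms sorted_nth_mono[OF assms(1)] by (force simp: not_le)
    then have "card ?A \<le> k" using card_mono[of "{..<k}" ?A] by simp
    then show False using that unfolding card by simp
  qed
qed

lemma order_stat_le_iff:
  fixes x :: "nat \<Rightarrow> real"
  assumes "k < n"
  shows "sort (map x [1..<Suc n]) ! k \<le> c \<longleftrightarrow> k < card {i\<in>{1..n}. x i \<le> c}"
proof -
  have "sort (map x [1..<Suc n]) ! k \<le> c \<longleftrightarrow> k < length (filter (\<lambda>x. x \<le> c) (sort (map x [1..<Suc n])))"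
    using assms by (intro sorted_nth_le_iff) auto
  also have "length (filter (\<lambda>x. x \<le> c) (sort (map x [1..<Suc n]))) = length (filter (\<lambda>i. x i \<le> c) [1..<Suc n])"
    by (simp only: filter_sort length_sort filter_map length_map comp_def)
  also have "\<dots> = card (set (filter (\<lambda>i. x i \<le> c) [1..<Suc n]))"
    by (subst distinct_card) auto
  also have "set (filter (\<lambda>i. x i \<le> c) [1..<Suc n]) = {i\<in>{1..n}. x i \<le> c}" by auto
  finally show ?thesis .
qed

text \<open>The zero-based positions (n - 1) div 2 and n div 2 are the central ones and coincide for
  odd \<open>n\<close>; with them the parity of the sample size disappears from the later
  arguments.\<close>

lemma sample_median_bounds:
  fixes x :: "nat \<Rightarrow> real"
  assumes "n \<ge> 1"
  shows "sort (map x [1..<Suc n]) ! ((n - 1) div 2) \<le> sample_median n x"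
    and "sample_median n x \<le> sort (map x [1..<Suc n]) ! (n div 2)"
proof -
  let ?xs = "sort (map x [1..<Suc n])"
  have s: "sorted ?xs" "length ?xs = n" by auto
  have "?xs ! ((n - 1) div 2) \<le> sample_median n x \<and> sample_median n x \<le> ?xs ! (n div 2)"
  proof (cases "odd n")
    case True
    then have "(n - 1) div 2 = n div 2" by (auto elim!: oddE)
    then show ?thesis using True by (simp add: sample_median_def)
  next
    case False
    then have e: "(n - 1) div 2 = n div 2 - 1" using assms by (auto elim!: evenE)
    have "?xs ! (n div 2 - 1) \<le> ?xs ! (n div 2)"
      using s assms by (intro sorted_nth_mono) auto
    then show ?thesis using False e by (simp add: sample_median_def Let_def)
  qed
  then show "?xs ! ((n - 1) div 2) \<le> sample_median n x" "sample_median n x \<le> ?xs ! (n div 2)" by auto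
qed

lemma sum_if_count:
  "finite I \<Longrightarrow> (\<Sum>i\<in>I. if P i then - 1 else 1 :: real) = real (card I) - 2 * real (card {i\<in>I. P i})"
proof -
  assume I: "finite I"
  have "(\<Sum>i\<in>I. if P i then - 1 else 1 :: real) = (\<Sum>i\<in>I. 1 - 2 * (if P i then 1 else 0))"
    by (intro sum.cong) auto
  also have "\<dots> = real (card I) - 2 * real (card {i\<in>I. P i})"
    using I by (simp add: sum_subtractf sum.If_cases Int_def flip: sum_distrib_left)
  finally show ?thesis .
qed

text \<open>A sign change replaces the estimating equation, which may fail for the median, where the
  score jumps. In this form both kinds of estimator can be treated together.\<close>

lemma loc_score_mu_hat:
  assumes lam: "lam \<ge> 1" and n: "n \<ge> 1"
  shows "m < mu_hat lam n x \<Longrightarrow> loc_score lam n x m \<ge> 0"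
    and "m > mu_hat lam n x \<Longrightarrow> loc_score lam n x m \<le> 0"
proof -
  show "loc_score lam n x m \<ge> 0" if m: "m < mu_hat lam n x"
  proof (cases "lam = 1")
    case False
    then have "lam > 1" using lam by simp
    then show ?thesis using mu_hat_unique[OF _ n, of lam x] loc_score_strict_antimono[OF _ n m, of lam x] by simp
  next
    case True
    let ?k = "n div 2"
    have "m < sort (map x [1..<Suc n]) ! ?k"
      using m sample_median_bounds(2)[OF n, of x] True by (simp add: mu_hat_def)
    then have c: "card {i\<in>{1..n}. x i \<le> m} \<le> ?k"
      using order_stat_le_iff[of ?k n x m] n by (simp add: not_le[symmetric])
    have "0 \<le> real n - 2 * real (card {i\<in>{1..n}. x i \<le> m})" using c by linarith
    also have "\<dots> = (\<Sum>i=1..n. if x i \<le> m then - 1 else 1)" by (subst sum_if_count) auto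
    also have "\<dots> \<le> loc_score lam n x m"
      unfolding loc_score_def True by (intro sum_mono) (auto simp: sgn_if)
    finally show ?thesis .
  qed
  show "loc_score lam n x m \<le> 0" if m: "m > mu_hat lam n x"
  proof (cases "lam = 1")
    case False
    then have "lam > 1" using lam by simp
    then show ?thesis using mu_hat_unique[OF _ n, of lam x] loc_score_strict_antimono[OF _ n m, of lam x] by simp
  next
    case True
    let ?k = "(n - 1) div 2"
    define c where "c = sort (map x [1..<Suc n]) ! ?k"
    have cm: "c < m"
      using m sample_median_bounds(1)[OF n, of x] True by (simp add: mu_hat_def c_def)
    \<comment> \<open>More than (n - 1) div 2 observations lie at or below \<open>c\<close> and
      hence strictly below \<open>m\<close>; this is at least half of the sample for either
      parity.\<close>
    have "?k < card {i\<in>{1..n}. x i \<le> c}"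
      using order_stat_le_iff[of ?k n x c] n by (simp add: c_def)
    also have "\<dots> \<le> card {i\<in>{1..n}. x i < m}" using cm by (intro card_mono) auto
    finally have c: "?k < card {i\<in>{1..n}. x i < m}" .
    have "loc_score lam n x m \<le> (\<Sum>i=1..n. if x i < m then - 1 else 1)"
      unfolding loc_score_def True by (intro sum_mono) (auto simp: sgn_if)
    also have "\<dots> = real n - 2 * real (card {i\<in>{1..n}. x i < m})" by (subst sum_if_count) auto
    also have "\<dots> \<le> 0" using c by linarith
    finally show ?thesis .
  qed
qed

lemma borel_measurable_order_stat:
  fixes X :: "nat \<Rightarrow> 'a \<Rightarrow> real"
  assumes X: "\<And>i. i \<in> {1..n} \<Longrightarrow> X i \<in> borel_measurable M" and "k < n"
  shows "(\<lambda>\<omega>. sort (map (\<lambda>i. X i \<omega>) [1..<Suc n]) ! k) \<in> borel_measurable M"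
proof (subst borel_measurable_iff_le, intro allI)
  fix c
  note [measurable] = X
  have eq: "real (card {i\<in>{1..n}. X i \<omega> \<le> c}) = (\<Sum>i=1..n. if X i \<omega> \<le> c then 1 else 0)" for \<omega>
    by (simp add: sum.If_cases Int_def)
  have "{\<omega>\<in>space M. sort (map (\<lambda>i. X i \<omega>) [1..<Suc n]) ! k \<le> c} =
     {\<omega>\<in>space M. real k < (\<Sum>i=1..n. if X i \<omega> \<le> c then 1 else 0)}"
    unfolding order_stat_le_iff[OF \<open>k < n\<close>] eq[symmetric] of_nat_less_iff ..
  also have "\<dots> \<in> sets M" by measurable
  finally show "{\<omega>\<in>space M. sort (map (\<lambda>i. X i \<omega>) [1..<Suc n]) ! k \<le> c} \<in> sets M" .
qed

lemma borel_measurable_mu_hat: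
  fixes X :: "nat \<Rightarrow> 'a \<Rightarrow> real"
  assumes X: "\<And>i. i \<in> {1..n} \<Longrightarrow> X i \<in> borel_measurable M" and n: "n \<ge> 1" and lam: "lam \<ge> 1"
  shows "(\<lambda>\<omega>. mu_hat lam n (\<lambda>i. X i \<omega>)) \<in> borel_measurable M"
proof (cases "lam = 1")
  case True
  note [measurable] = borel_measurable_order_stat[OF X]
  show ?thesis
  proof (cases "odd n")
    case odd: True
    have "(\<lambda>\<omega>. sort (map (\<lambda>i. X i \<omega>) [1..<Suc n]) ! (n div 2)) \<in> borel_measurable M"
      using n by (intro borel_measurable_order_stat X) auto
    then show ?thesis using True odd by (simp add: mu_hat_def sample_median_def Let_def)
  next
    case odd: False
    have "(\<lambda>\<omega>. (sort (map (\<lambda>i. X i \<omega>) [1..<Suc n]) ! (n div 2 - 1) + sort (map (\<lambda>i. X i \<omega>) [1..<Suc n]) ! (n div 2)) / 2) \<in> borel_measurable M"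
      using n by (intro borel_measurable_divide borel_measurable_add borel_measurable_order_stat X borel_measurable_const) auto
    then show ?thesis using True odd by (simp add: mu_hat_def sample_median_def Let_def)
  qed
next
  case False
  then have lam1: "lam > 1" using lam by simp
  note [measurable] = X
  show ?thesis
  proof (subst borel_measurable_iff_less, intro allI)
    fix c
    \<comment> \<open>Strict monotonicity turns an event about an implicitly defined root into one
      about a finite sum at a fixed point.\<close>
    have "mu_hat lam n x < c \<longleftrightarrow> loc_score lam n x c < 0" for x
      using mu_hat_unique[OF lam1 n, of x] loc_score_strict_antimono[OF lam1 n, of c "mu_hat lam n x" x]
        loc_score_strict_antimono[OF lam1 n, of "mu_hat lam n x" c x]
      by (cases c "mu_hat lam n x" rule: linorder_cases) auto
    then have "{\<omega>\<in>space M. mu_hat lam n (\<lambda>i. X i \<omega>) < c} = {\<omega>\<in>space M. loc_score lam n (\<lambda>i. X i \<omega>) c < 0}" by simp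
    also have "\<dots> \<in> sets M" unfolding loc_score_def by measurable
    finally show "{\<omega>\<in>space M. mu_hat lam n (\<lambda>i. X i \<omega>) < c} \<in> sets M" .
  qed
qed

subsection \<open>Moments and influence functions\<close>

context iid_array
begin

text \<open>Under the null kernel \<open>T\<close> has the Gamma distribution with shape \<open>1 / lam\<close>.\<close>

definition T :: "real \<Rightarrow> real" where "T y = \<bar>y\<bar> powr lam / lam"

lemma T_nonneg: "T y \<ge> 0" using lam by (simp add: T_def)

lemma poly_growth_T: "poly_growth T"
proof -
  have "poly_growth (\<lambda>y. \<bar>y\<bar> powr lam * (1 / lam))"
    using lam by (intro poly_growth_mult poly_growth_powr poly_growth_const) auto
  then show ?thesis by (simp add: T_def[abs_def])
qed

text \<open>The source of all moments below: the constants of the substitution cancel between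
  numerator and denominator. The condition on \<open>p\<close> is integrability at the
  origin.\<close>

lemma E0_T_power:
  assumes p: "1 / lam + p > 0"
  shows "E0 (\<lambda>y. T y powr p * ln (T y) ^ j) = Gamma_ln j (1 / lam + p) / Gamma (1 / lam)"
proof -
  have a: "1 / lam > 0" "lam > 0" using lam by auto
  let ?F = "\<lambda>t. t powr p * ln t ^ j"
  have eq: "t powr (1 / lam - 1) * ?F t * exp (- t) = t powr (1 / lam + p - 1) * ln t ^ j * exp (- t)"
    if "t \<in> {0<..}" for t :: real
    using that by (simp add: algebra_simps flip: powr_add)
  have "set_integrable lborel {0<..} (\<lambda>t. t powr (1 / lam - 1) * ?F t * exp (- t))"
    by (subst set_integrable_cong[OF refl refl eq]) (use set_integrable_Gamma_ln[OF p] in auto)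
  from has_bochner_integral_pker[OF a(2) _ this]
  have 1: "(\<integral>y. ?F (T y) * pker lam y \<partial>lborel) = 2 * lam powr (1 / lam - 1) * (LINT t:{0<..}|lborel. t powr (1 / lam - 1) * ?F t * exp (- t))"
    by (simp add: has_bochner_integral_integral_eq T_def)
  have 2: "(LINT t:{0<..}|lborel. t powr (1 / lam - 1) * ?F t * exp (- t)) = Gamma_ln j (1 / lam + p)"
    unfolding Gamma_ln_def by (rule set_lebesgue_integral_cong) (use eq in auto)
  have 3: "(\<integral>y. pker lam y \<partial>lborel) = 2 * lam powr (1 / lam - 1) * Gamma (1 / lam)"
    using has_bochner_integral_pker[of lam "\<lambda>_. 1"] Gamma_integral_set[OF a(1)] a(2)
    by (simp add: has_bochner_integral_integral_eq)
  show ?thesis unfolding E0_def 1 2 3 using a by simp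
qed

lemma E0_cong: "(\<And>y. f y = g y) \<Longrightarrow> E0 f = E0 g"
  by (simp add: E0_def)

lemma abs_powr_T:
  assumes "p * lam = r"
  shows "\<bar>y\<bar> powr r = lam powr p * T y powr p"
proof -
  have "\<bar>y\<bar> powr r = (\<bar>y\<bar> powr lam) powr p"
    using assms by (simp add: powr_powr mult.commute)
  also have "\<bar>y\<bar> powr lam = lam * T y" using lam by (simp add: T_def)
  also have "\<dots> powr p = lam powr p * T y powr p"
    using lam T_nonneg by (simp add: powr_mult)
  finally show ?thesis .
qed

lemma hfun_T: "hfun y = T y * (ln lam + ln (T y))"
  using lam by (cases "y = 0") (auto simp: hfun_def T_def ln_div ln_powr)

abbreviation "ia \<equiv> 1 / lam"

lemma Gamma_ia_plus: "Gamma (ia + 1) = ia * Gamma ia" "Gamma (ia + 2) = (ia + 1) * ia * Gamma ia"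
proof -
  have np: "x \<notin> \<int>\<^sub>\<le>\<^sub>0" if "x > 0" for x :: real using that by (auto elim!: nonpos_Ints_cases)
  have p: "ia > 0" "ia + 1 > 0" using lam by (auto intro: add_pos_pos)
  show 1: "Gamma (ia + 1) = ia * Gamma ia" by (rule Gamma_plus1[OF np[OF p(1)]])
  show "Gamma (ia + 2) = (ia + 1) * ia * Gamma ia"
    using Gamma_plus1[OF np[OF p(2)]] 1 by (simp add: add.assoc)
qed

lemma Gamma_ia_nonzero: "Gamma ia \<noteq> 0"
proof -
  have "ia > 0" using lam by simp
  then show ?thesis using Gamma_real_pos by (simp add: less_imp_neq[symmetric])
qed

text \<open>The Fisher information for the location, which is also the slope of the estimating
  function; \<open>bg\<close> is the covariance of \<open>gfun\<close> with the location
  score.\<close>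

definition Dpsi :: real where "Dpsi = E0 (\<lambda>y. psi y * psi y)"
definition bg :: real where "bg = E0 (\<lambda>y. gfun y * psi y)"

lemma Dpsi_eq: "Dpsi = lam powr (2 - 2 * ia) * (Gamma (2 - ia) / Gamma ia)"
proof -
  have p: "ia + (2 - 2 * ia) = 2 - ia" "2 - ia > 0" using lam by (auto simp: divide_less_eq)
  have "psi y * psi y = lam powr (2 - 2 * ia) * (T y powr (2 - 2 * ia) * ln (T y) ^ 0)" for y
  proof -
    \<comment> \<open>For lam = 1 the exponent is 0, and at the origin the convention 0 powr 0 = 0
      agrees with psi 0 = 0.\<close>
    have "psi y * psi y = \<bar>y\<bar> powr (2 * lam - 2)"
      by (cases "y = 0") (auto simp: psi_def sgn_if simp flip: powr_add)
    also have "\<dots> = lam powr (2 - 2 * ia) * T y powr (2 - 2 * ia)"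
      by (rule abs_powr_T) (use lam in \<open>simp add: field_simps\<close>)
    finally show ?thesis by simp
  qed
  then have "Dpsi = lam powr (2 - 2 * ia) * E0 (\<lambda>y. T y powr (2 - 2 * ia) * ln (T y) ^ 0)"
    unfolding Dpsi_def by (simp add: E0_cmult)
  also have "\<dots> = lam powr (2 - 2 * ia) * (Gamma (2 - ia) / Gamma ia)"
    using p by (subst E0_T_power) (simp_all add: Gamma_ln_0)
  finally show ?thesis .
qed

lemma bg_eq: "bg = lam powr (2 - ia) / Gamma ia"
proof -
  have "gfun y * psi y = lam powr (2 - ia) * (T y powr (2 - ia) * ln (T y) ^ 0)" for y
  proof -
    have "gfun y * psi y = \<bar>y\<bar> powr (2 * lam - 1)"
      by (cases "y = 0") (auto simp: gfun_def psi_def sgn_if simp flip: powr_add)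
    also have "\<dots> = lam powr (2 - ia) * T y powr (2 - ia)"
      by (rule abs_powr_T) (use lam in \<open>simp add: field_simps\<close>)
    finally show ?thesis by simp
  qed
  then have "bg = lam powr (2 - ia) * E0 (\<lambda>y. T y powr (2 - ia) * ln (T y) ^ 0)"
    unfolding bg_def by (simp add: E0_cmult)
  also have "\<dots> = lam powr (2 - ia) * (Gamma 2 / Gamma ia)"
    using lam by (subst E0_T_power) (simp_all add: Gamma_ln_0)
  also have "Gamma 2 = (1::real)" using Gamma_fact[of 1] by simp
  finally show ?thesis by simp
qed

lemma Dpsi_pos: "Dpsi > 0" and bg_pos: "bg > 0"
proof -
  have "2 - ia > 0" "ia > 0" using lam by (auto simp: divide_less_eq)
  then show "Dpsi > 0" "bg > 0" using lam by (auto simp: Dpsi_eq bg_eq intro!: Gamma_real_pos divide_pos_pos mult_pos_pos)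
qed

lemma E0_T: "E0 T = ia"
proof -
  have "E0 T = E0 (\<lambda>y. T y powr 1 * ln (T y) ^ 0)" by (intro E0_cong) (simp add: T_nonneg)
  also have "\<dots> = ia" using lam Gamma_ia_nonzero by (subst E0_T_power) (simp_all add: Gamma_ln_0 Gamma_ia_plus add_pos_pos)
  finally show ?thesis .
qed

lemma T_powr_2: "T y powr 2 = (T y)\<^sup>2"
  using T_nonneg[of y] by simp

lemma E0_T2: "E0 (\<lambda>y. (T y)\<^sup>2) = ia * (ia + 1)"
proof -
  have "E0 (\<lambda>y. (T y)\<^sup>2) = E0 (\<lambda>y. T y powr 2 * ln (T y) ^ 0)" by (intro E0_cong) (simp add: T_powr_2)
  also have "\<dots> = ia * (ia + 1)" using lam Gamma_ia_nonzero by (subst E0_T_power) (simp_all add: Gamma_ln_0 Gamma_ia_plus add_pos_pos)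
  finally show ?thesis .
qed

lemma E0_TL: "E0 (\<lambda>y. T y * ln (T y)) = ia * Digamma (ia + 1)"
proof -
  have "E0 (\<lambda>y. T y * ln (T y)) = E0 (\<lambda>y. T y powr 1 * ln (T y) ^ 1)" by (intro E0_cong) (simp add: T_nonneg)
  also have "\<dots> = ia * Digamma (ia + 1)" using lam Gamma_ia_nonzero
    by (subst E0_T_power) (simp_all add: Gamma_ln_1[unfolded One_nat_def] Gamma_ia_plus add_pos_pos)
  finally show ?thesis .
qed

lemma E0_T2L: "E0 (\<lambda>y. (T y)\<^sup>2 * ln (T y)) = ia * (ia + 1) * Digamma (ia + 2)"
proof -
  have "E0 (\<lambda>y. (T y)\<^sup>2 * ln (T y)) = E0 (\<lambda>y. T y powr 2 * ln (T y) ^ 1)" by (intro E0_cong) (simp add: T_powr_2)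
  also have "\<dots> = ia * (ia + 1) * Digamma (ia + 2)" using lam Gamma_ia_nonzero
    by (subst E0_T_power) (simp_all add: Gamma_ln_1[unfolded One_nat_def] Gamma_ia_plus add_pos_pos)
  finally show ?thesis .
qed

lemma E0_T2L2: "E0 (\<lambda>y. (T y)\<^sup>2 * (ln (T y))\<^sup>2) = ia * (ia + 1) * ((Digamma (ia + 2))\<^sup>2 + Polygamma 1 (ia + 2))"
proof -
  have "E0 (\<lambda>y. (T y)\<^sup>2 * (ln (T y))\<^sup>2) = E0 (\<lambda>y. T y powr 2 * ln (T y) ^ 2)" by (intro E0_cong) (simp add: T_powr_2)
  also have "\<dots> = ia * (ia + 1) * ((Digamma (ia + 2))\<^sup>2 + Polygamma 1 (ia + 2))" using lam Gamma_ia_nonzero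
    by (subst E0_T_power) (simp_all add: Gamma_ln_2 Gamma_ia_plus add_pos_pos)
  finally show ?thesis .
qed

lemma poly_growth_TlnT: "poly_growth (\<lambda>y. T y * ln (T y))"
proof -
  have "poly_growth (\<lambda>y. hfun y - ln lam * T y)"
    by (intro poly_growth_diff poly_growth_mult poly_growth_const poly_growth_hfun poly_growth_T)
  then show ?thesis by (simp add: hfun_T algebra_simps)
qed

text \<open>The recurrence of the digamma function absorbs the summand \<open>lam\<close> into a
  shift of the argument by 1.\<close>

lemma E_K_eq: "E_K lam = ia * (ln lam + Digamma (ia + 1))"
  using lam Digamma_plus1[of ia] by (simp add: E_K_def field_simps)

lemma E0_hfun: "E0 hfun = E_K lam"
proof -
  have "E0 hfun = E0 (\<lambda>y. ln lam * T y + T y * ln (T y))" by (intro E0_cong) (simp add: hfun_T algebra_simps)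
  also have "\<dots> = E0 (\<lambda>y. ln lam * T y) + E0 (\<lambda>y. T y * ln (T y))"
    by (intro E0_add poly_growth_mult poly_growth_const poly_growth_T poly_growth_TlnT)
  also have "\<dots> = E_K lam" by (simp add: E0_cmult E0_T E0_TL E_K_eq algebra_simps)
  finally show ?thesis .
qed

lemma poly_growth_T2L: "poly_growth (\<lambda>y. (T y)\<^sup>2 * ln (T y))"
proof -
  have "poly_growth (\<lambda>y. T y * (T y * ln (T y)))"
    by (intro poly_growth_mult[OF poly_growth_T poly_growth_TlnT])
  then show ?thesis by (simp add: power2_eq_square mult.assoc)
qed

lemma poly_growth_T2L2: "poly_growth (\<lambda>y. (T y)\<^sup>2 * (ln (T y))\<^sup>2)"
  using poly_growth_power[OF poly_growth_TlnT, of 2] by (simp add: power_mult_distrib)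

lemma E0_hfun_T: "E0 (\<lambda>y. hfun y * T y) = ia * (ia + 1) * (ln lam + Digamma (ia + 2))"
proof -
  have "E0 (\<lambda>y. hfun y * T y) = E0 (\<lambda>y. ln lam * (T y)\<^sup>2 + (T y)\<^sup>2 * ln (T y))"
    by (intro E0_cong) (simp add: hfun_T algebra_simps power2_eq_square)
  also have "\<dots> = E0 (\<lambda>y. ln lam * (T y)\<^sup>2) + E0 (\<lambda>y. (T y)\<^sup>2 * ln (T y))"
    by (intro E0_add poly_growth_T2L poly_growth_mult[OF poly_growth_const] poly_growth_power poly_growth_T)
  also have "\<dots> = ia * (ia + 1) * (ln lam + Digamma (ia + 2))" unfolding E0_cmult E0_T2 E0_T2L by (simp add: algebra_simps)
  finally show ?thesis .
qed

lemma E0_hfun2: "E0 (\<lambda>y. (hfun y)\<^sup>2) = ia * (ia + 1) * ((ln lam + Digamma (ia + 2))\<^sup>2 + Polygamma 1 (ia + 2))"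
proof -
  have "E0 (\<lambda>y. (hfun y)\<^sup>2) = E0 (\<lambda>y. ((ln lam)\<^sup>2 * (T y)\<^sup>2 + (2 * ln lam) * ((T y)\<^sup>2 * ln (T y))) + (T y)\<^sup>2 * (ln (T y))\<^sup>2)"
    by (intro E0_cong) (simp add: hfun_T algebra_simps power2_eq_square)
  also have "\<dots> = E0 (\<lambda>y. (ln lam)\<^sup>2 * (T y)\<^sup>2) + E0 (\<lambda>y. (2 * ln lam) * ((T y)\<^sup>2 * ln (T y))) + E0 (\<lambda>y. (T y)\<^sup>2 * (ln (T y))\<^sup>2)"
    by (subst E0_add, intro poly_growth_add poly_growth_T2L poly_growth_mult[OF poly_growth_const] poly_growth_power poly_growth_T,
        rule poly_growth_T2L2, subst E0_add,
        intro poly_growth_T2L poly_growth_mult[OF poly_growth_const] poly_growth_power poly_growth_T,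
        intro poly_growth_T2L poly_growth_mult[OF poly_growth_const], rule refl)
  also have "\<dots> = ia * (ia + 1) * ((ln lam + Digamma (ia + 2))\<^sup>2 + Polygamma 1 (ia + 2))"
    unfolding E0_cmult E0_T2 E0_T2L E0_T2L2 by (simp add: algebra_simps power2_eq_square)
  finally show ?thesis .
qed

text \<open>The coefficient \<open>bg / Dpsi\<close> removes the projection on the location score \<open>psi\<close>, the coefficient \<open>kap0\<close>
  the one on the scale score \<open>Pfun\<close>.\<close>

definition sfun :: "real \<Rightarrow> real" where "sfun y = gfun y - bg / Dpsi * psi y"
definition kap0 :: real where "kap0 = E_K lam + ia"
definition Pfun :: "real \<Rightarrow> real" where "Pfun y = lam * T y - 1"
definition kfun :: "real \<Rightarrow> real" where "kfun y = (hfun y - E_K lam) - kap0 * Pfun y"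

lemma poly_growth_sfun: "poly_growth sfun"
  unfolding sfun_def by (intro poly_growth_diff poly_growth_gfun poly_growth_mult poly_growth_const poly_growth_psi)
lemma poly_growth_Pfun: "poly_growth Pfun"
  unfolding Pfun_def by (intro poly_growth_diff poly_growth_mult poly_growth_const poly_growth_T)
lemma poly_growth_kfun: "poly_growth kfun"
  unfolding kfun_def by (intro poly_growth_diff poly_growth_mult poly_growth_const poly_growth_hfun poly_growth_Pfun)

lemma odd_psi: "psi (- y) = - psi y" and odd_gfun: "gfun (- y) = - gfun y"
  and even_hfun: "hfun (- y) = hfun y" and even_T: "T (- y) = T y"
  by (simp_all add: psi_def gfun_def hfun_def T_def sgn_minus)

lemma odd_sfun: "sfun (- y) = - sfun y"
  by (simp add: sfun_def odd_psi odd_gfun)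
lemma even_kfun: "kfun (- y) = kfun y"
  by (simp add: kfun_def Pfun_def even_hfun even_T)

lemma E0_sfun: "E0 sfun = 0" by (rule E0_odd) (rule odd_sfun)
lemma E0_psi: "E0 psi = 0" by (rule E0_odd) (rule odd_psi)

lemma E0_Pfun: "E0 Pfun = 0"
  unfolding Pfun_def using lam
  by (subst E0_diff) (auto simp: E0_cmult E0_T E0_const intro: poly_growth_mult poly_growth_T)

lemma E0_hfun_centred: "E0 (\<lambda>y. hfun y - E_K lam) = 0"
  by (subst E0_diff) (auto simp: E0_hfun E0_const intro: poly_growth_hfun)

lemma E0_kfun: "E0 kfun = 0"
  unfolding kfun_def
  by (subst E0_diff) (auto simp: E0_cmult E0_Pfun E0_hfun_centred intro!: poly_growth_hfun poly_growth_Pfun)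

lemma E0_gfun2: "E0 (\<lambda>y. gfun y * gfun y) = 1 + lam"
proof -
  have "gfun y * gfun y = lam\<^sup>2 * (T y)\<^sup>2" for y
    using lam by (cases "y = 0") (auto simp: gfun_def T_def sgn_if power2_eq_square)
  then have "E0 (\<lambda>y. gfun y * gfun y) = lam\<^sup>2 * (ia * (ia + 1))" by (simp add: E0_cmult E0_T2)
  also have "\<dots> = 1 + lam" using lam by (simp add: field_simps power2_eq_square)
  finally show ?thesis .
qed

lemma bg2_Dpsi: "bg / Dpsi * bg = lam\<^sup>2 / (Gamma (2 - ia) * Gamma ia)"
proof -
  have pos: "Gamma ia > 0" "Gamma (2 - ia) > 0" using lam by (auto intro!: Gamma_real_pos simp: divide_less_eq)
  have "lam powr (2 - ia) * lam powr (2 - ia) = lam powr (2 - 2 * ia) * lam\<^sup>2"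
  proof -
    have "lam powr (2 - ia) * lam powr (2 - ia) = lam powr ((2 - 2 * ia) + 2)" by (simp flip: powr_add)
    also have "\<dots> = lam powr (2 - 2 * ia) * lam powr 2" by (rule powr_add)
    finally show ?thesis using lam by simp
  qed
  then show ?thesis unfolding bg_eq Dpsi_eq using pos lam by (simp add: field_simps)
qed

lemma E0_sfun_gfun: "E0 (\<lambda>y. sfun y * gfun y) = V_S lam"
proof -
  have "E0 (\<lambda>y. sfun y * gfun y) = E0 (\<lambda>y. gfun y * gfun y - bg / Dpsi * (gfun y * psi y))"
    by (intro E0_cong) (simp add: sfun_def algebra_simps)
  also have "\<dots> = E0 (\<lambda>y. gfun y * gfun y) - bg / Dpsi * bg"
    by (subst E0_diff, intro poly_growth_mult poly_growth_gfun,
        intro poly_growth_mult poly_growth_const poly_growth_gfun poly_growth_psi,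
        simp only: E0_cmult bg_def[symmetric])
  also have "\<dots> = V_S lam" unfolding E0_gfun2 bg2_Dpsi V_S_def ..
  finally show ?thesis .
qed

lemma E0_sfun2: "E0 (\<lambda>y. (sfun y)\<^sup>2) = V_S lam"
proof -
  \<comment> \<open>The residual is orthogonal to the location score, so its second moment equals
    its product moment with \<open>gfun\<close>.\<close>
  have z: "E0 (\<lambda>y. sfun y * psi y) = 0"
  proof -
    have "E0 (\<lambda>y. sfun y * psi y) = E0 (\<lambda>y. gfun y * psi y - bg / Dpsi * (psi y * psi y))"
      by (intro E0_cong) (simp add: sfun_def algebra_simps)
    also have "\<dots> = bg - bg / Dpsi * Dpsi"
      by (subst E0_diff, intro poly_growth_mult poly_growth_gfun poly_growth_psi,
          intro poly_growth_mult poly_growth_const poly_growth_psi,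
          simp only: E0_cmult bg_def[symmetric] Dpsi_def[symmetric])
    finally show ?thesis using Dpsi_pos by simp
  qed
  have "E0 (\<lambda>y. (sfun y)\<^sup>2) = E0 (\<lambda>y. sfun y * gfun y - bg / Dpsi * (sfun y * psi y))"
    by (intro E0_cong) (simp add: sfun_def algebra_simps power2_eq_square)
  also have "\<dots> = V_S lam"
    by (subst E0_diff, intro poly_growth_mult poly_growth_gfun poly_growth_sfun,
        intro poly_growth_mult poly_growth_const poly_growth_sfun poly_growth_psi,
        simp add: E0_cmult[of "bg / Dpsi"] z E0_sfun_gfun del: times_divide_eq_left)
  finally show ?thesis .
qed

lemma kap0_eq: "kap0 = ia * (ln lam + Digamma (ia + 1) + 1)"
  by (simp add: kap0_def E_K_eq algebra_simps)

lemma Digamma_ia_2: "Digamma (ia + 2) = Digamma (ia + 1) + 1 / (ia + 1)"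
  "Polygamma 1 (ia + 2) = Polygamma 1 (ia + 1) - 1 / (ia + 1)\<^sup>2"
proof -
  have "ia + 1 \<noteq> 0" using lam by (simp add: add_pos_pos less_imp_neq[symmetric])
  then show "Digamma (ia + 2) = Digamma (ia + 1) + 1 / (ia + 1)"
    "Polygamma 1 (ia + 2) = Polygamma 1 (ia + 1) - 1 / (ia + 1)\<^sup>2"
    using Digamma_plus1[of "ia + 1"] Polygamma_plus1[of "ia + 1" 1] by (simp_all add: add.assoc power2_eq_square)
qed

text \<open>Together with \<open>E0_Pfun2\<close> this identifies \<open>kap0\<close> as the
  regression coefficient of \<open>hfun\<close> on the scale score \<open>Pfun\<close>.\<close>

lemma E0_hfun_Pfun: "E0 (\<lambda>y. hfun y * Pfun y) = lam * kap0"
proof -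
  have "E0 (\<lambda>y. hfun y * Pfun y) = E0 (\<lambda>y. lam * (hfun y * T y) - hfun y)"
    by (intro E0_cong) (simp add: Pfun_def algebra_simps)
  also have "\<dots> = lam * (ia * (ia + 1) * (ln lam + Digamma (ia + 2))) - E_K lam"
    by (subst E0_diff) (auto simp: E0_cmult E0_hfun_T E0_hfun intro!: poly_growth_hfun poly_growth_T)
  also have "\<dots> = lam * kap0"
  proof -
    define e where "e = ln lam + Digamma (ia + 1)"
    have ne: "ia + 1 \<noteq> 0" using lam by (simp add: add_pos_pos less_imp_neq[symmetric])
    have l: "lam * (ia * x) = x" for x using lam by simp
    have "lam * (ia * (ia + 1) * (ln lam + Digamma (ia + 2))) = (ia + 1) * (e + 1 / (ia + 1))"
      unfolding Digamma_ia_2 e_def mult.assoc l by (simp add: add.assoc)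
    also have "\<dots> = (ia + 1) * e + 1" using ne by (simp add: distrib_left)
    finally show ?thesis unfolding kap0_eq E_K_eq e_def[symmetric] l by (simp add: algebra_simps)
  qed
  finally show ?thesis .
qed

lemma E0_Pfun2: "E0 (\<lambda>y. (Pfun y)\<^sup>2) = lam"
proof -
  have "E0 (\<lambda>y. (Pfun y)\<^sup>2) = E0 (\<lambda>y. lam\<^sup>2 * (T y)\<^sup>2 - (2 * lam * T y - 1))"
    by (intro E0_cong) (simp add: Pfun_def power2_eq_square algebra_simps)
  also have "\<dots> = lam\<^sup>2 * (ia * (ia + 1)) - (2 * lam * ia - 1)"
    by (subst E0_diff, force intro!: poly_growth_T, force intro!: poly_growth_T, subst E0_diff)
       (auto simp: E0_cmult E0_T2 E0_T E0_const intro!: poly_growth_T)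
  also have "\<dots> = lam" using lam by (simp add: field_simps power2_eq_square)
  finally show ?thesis .
qed

lemma E0_kfun_Pfun: "E0 (\<lambda>y. kfun y * Pfun y) = 0"
proof -
  have "E0 (\<lambda>y. kfun y * Pfun y) = E0 (\<lambda>y. (hfun y * Pfun y - E_K lam * Pfun y) - kap0 * (Pfun y)\<^sup>2)"
    by (intro E0_cong) (simp add: kfun_def power2_eq_square algebra_simps)
  also have "\<dots> = (lam * kap0 - E_K lam * 0) - kap0 * lam"
    by (subst E0_diff, force intro!: poly_growth_hfun poly_growth_Pfun, force intro!: poly_growth_Pfun, subst E0_diff)
       (auto simp: E0_cmult E0_hfun_Pfun E0_Pfun E0_Pfun2 intro!: poly_growth_hfun poly_growth_Pfun)
  finally show ?thesis by simp
qed

lemma E0_kfun_hfun: "E0 (\<lambda>y. kfun y * hfun y) = V_K lam"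
proof -
  have "E0 (\<lambda>y. kfun y * hfun y) = E0 (\<lambda>y. ((hfun y)\<^sup>2 - E_K lam * hfun y) - kap0 * (hfun y * Pfun y))"
    by (intro E0_cong) (simp add: kfun_def power2_eq_square algebra_simps)
  also have "\<dots> = (E0 (\<lambda>y. (hfun y)\<^sup>2) - E_K lam * E_K lam) - kap0 * (lam * kap0)"
    by (subst E0_diff, force intro!: poly_growth_hfun, force intro!: poly_growth_hfun poly_growth_Pfun, subst E0_diff)
       (auto simp: E0_cmult E0_hfun_Pfun E0_hfun intro!: poly_growth_hfun poly_growth_Pfun)
  also have "\<dots> = V_K lam"
  proof -
    \<comment> \<open>In terms of \<open>e\<close> the second moment, the squared mean and the
      projection are quadratic polynomials; all powers of \<open>e\<close> cancel and only the
      trigamma part remains.\<close>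
    define e where "e = ln lam + Digamma (ia + 1)"
    define p where "p = Polygamma 1 (ia + 1)"
    have ne: "ia + 1 \<noteq> 0" using lam by (simp add: add_pos_pos less_imp_neq[symmetric])
    have "(ln lam + Digamma (ia + 2))\<^sup>2 + Polygamma 1 (ia + 2) = e\<^sup>2 + 2 * e / (ia + 1) + p"
      unfolding Digamma_ia_2 e_def p_def using ne by (simp add: power2_sum power_divide add.assoc[symmetric])
    then have h2: "E0 (\<lambda>y. (hfun y)\<^sup>2) = ia * ((ia + 1) * e\<^sup>2 + 2 * e + (ia + 1) * p)"
    proof -
      have "(ia + 1) * (e\<^sup>2 + 2 * e / (ia + 1) + p) = (ia + 1) * e\<^sup>2 + 2 * e + (ia + 1) * p"
        using ne unfolding distrib_left[of "ia + 1"] by simp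
      then show ?thesis unfolding E0_hfun2 \<open>_ = e\<^sup>2 + 2 * e / (ia + 1) + p\<close> mult.assoc[of ia] by simp
    qed
    have l: "kap0 * (lam * kap0) = ia * (e + 1)\<^sup>2"
      unfolding kap0_eq e_def[symmetric] using lam by (simp add: power2_eq_square add.assoc)
    have EK: "E_K lam = ia * e" by (simp add: E_K_eq e_def)
    have "E0 (\<lambda>y. (hfun y)\<^sup>2) - E_K lam * E_K lam - kap0 * (lam * kap0) = ia * ((ia + 1) * p - 1)"
      unfolding h2 l EK by (simp add: power2_eq_square algebra_simps)
    also have "\<dots> = V_K lam" unfolding V_K_def p_def by (simp add: add.commute)
    finally show ?thesis .
  qed
  finally show ?thesis .
qed

lemma E0_kfun2: "E0 (\<lambda>y. (kfun y)\<^sup>2) = V_K lam"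
proof -
  have "E0 (\<lambda>y. (kfun y)\<^sup>2) = E0 (\<lambda>y. (kfun y * hfun y - E_K lam * kfun y) - kap0 * (kfun y * Pfun y))"
    by (intro E0_cong) (simp add: kfun_def power2_eq_square algebra_simps)
  also have "\<dots> = (V_K lam - E_K lam * 0) - kap0 * 0"
    by (subst E0_diff, force intro!: poly_growth_hfun poly_growth_kfun, force intro!: poly_growth_kfun poly_growth_Pfun, subst E0_diff)
       (auto simp: E0_cmult E0_kfun_hfun E0_kfun E0_kfun_Pfun intro!: poly_growth_hfun poly_growth_kfun)
  finally show ?thesis by simp
qed

text \<open>By parity the odd function \<open>sfun\<close> sees only the asymmetry part of the
  score; in the same way \<open>kfun\<close>, being even, sees only the exponent part.\<close>

lemma E0_sfun_score: "E0 (\<lambda>y. sfun y * score y) = - 2 * d1 * V_S lam"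
proof -
  have "E0 (\<lambda>y. sfun y * hfun y) = 0" by (rule E0_odd) (simp add: odd_sfun even_hfun)
  moreover have "E0 (\<lambda>y. sfun y * score y) = E0 (\<lambda>y. (- 2 * d1) * (sfun y * gfun y) - d2 / lam * (sfun y * hfun y))"
    by (intro E0_cong) (simp add: score_def algebra_simps)
  moreover have "\<dots> = E0 (\<lambda>y. (- 2 * d1) * (sfun y * gfun y)) - E0 (\<lambda>y. d2 / lam * (sfun y * hfun y))"
    by (intro E0_diff poly_growth_mult poly_growth_const poly_growth_sfun poly_growth_gfun poly_growth_hfun)
  ultimately show ?thesis unfolding E0_cmult E0_sfun_gfun by simp
qed

lemma E0_kfun_score: "E0 (\<lambda>y. kfun y * score y) = - (d2 / lam) * V_K lam"
proof -
  have "E0 (\<lambda>y. kfun y * gfun y) = 0" by (rule E0_odd) (simp add: odd_gfun even_kfun)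
  moreover have "E0 (\<lambda>y. kfun y * score y) = E0 (\<lambda>y. (- 2 * d1) * (kfun y * gfun y) - d2 / lam * (kfun y * hfun y))"
    by (intro E0_cong) (simp add: score_def algebra_simps)
  moreover have "\<dots> = E0 (\<lambda>y. (- 2 * d1) * (kfun y * gfun y)) - E0 (\<lambda>y. d2 / lam * (kfun y * hfun y))"
    by (intro E0_diff poly_growth_mult poly_growth_const poly_growth_kfun poly_growth_gfun poly_growth_hfun)
  ultimately show ?thesis unfolding E0_cmult E0_kfun_hfun by simp
qed

lemma E0_sfun_kfun: "E0 (\<lambda>y. sfun y * kfun y) = 0"
  by (rule E0_odd) (simp add: odd_sfun even_kfun)

lemma E0_square_pos:
  assumes f: "poly_growth f" and "r < s" and nz: "\<And>y. r < y \<Longrightarrow> y < s \<Longrightarrow> f y \<noteq> 0"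
  shows "E0 (\<lambda>y. (f y)\<^sup>2) > 0"
proof -
  have i: "integrable lborel (\<lambda>y. (f y)\<^sup>2 * pker lam y)" by (intro integrable_pker poly_growth_power f)
  have nn: "0 \<le> (f y)\<^sup>2 * pker lam y" for y using pker_pos[of lam y] by simp
  have "(\<integral>y. (f y)\<^sup>2 * pker lam y \<partial>lborel) \<noteq> 0"
  proof
    assume "(\<integral>y. (f y)\<^sup>2 * pker lam y \<partial>lborel) = 0"
    then have "AE y in lborel. (f y)\<^sup>2 * pker lam y = 0"
      using integral_nonneg_eq_0_iff_AE[OF i] nn by simp
    then have "AE y in lborel. y \<notin> {r<..<s}"
      by eventually_elim (use nz pker_pos[of lam] in \<open>auto simp: less_le\<close>)
    then have "emeasure lborel {r<..<s} = 0"
      by (subst (asm) AE_iff_measurable[of "{r<..<s}"]) auto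
    then show False using \<open>r < s\<close> by simp
  qed
  moreover have "(\<integral>y. (f y)\<^sup>2 * pker lam y \<partial>lborel) \<ge> 0"
    using nn by (intro Bochner_Integration.integral_nonneg) auto
  ultimately show ?thesis unfolding E0_def using pker_integral_pos by (intro divide_pos_pos) auto
qed

text \<open>\<open>V_S\<close> is the second moment of \<open>sfun\<close>, which on the positive
  axis is y powr (lam - 1) * (y - c) and thus has no zero between 0 and \<open>c\<close>. No
  inequality for Gamma values is involved.\<close>

lemma V_S_pos: "V_S lam > 0"
proof -
  define c where "c = bg / Dpsi"
  have c: "c > 0" using bg_pos Dpsi_pos by (simp add: c_def)
  have "E0 (\<lambda>y. (sfun y)\<^sup>2) > 0"
  proof (rule E0_square_pos[OF poly_growth_sfun c])
    fix y assume y: "0 < y" "y < c"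
    have "sfun y = y powr (lam - 1) * (y - c)"
    proof -
      have "y powr lam = y powr (lam - 1) * y" using y powr_add[of y "lam - 1" 1] by simp
      then show ?thesis using y by (simp add: sfun_def gfun_def psi_def c_def[symmetric] algebra_simps)
    qed
    then show "sfun y \<noteq> 0" using y by simp
  qed
  then show ?thesis by (simp add: E0_sfun2)
qed

text \<open>The influence function \<open>kfun\<close> tends to \<open>1 / lam\<close> at the origin, so it cannot vanish almost everywhere.\<close>

lemma V_K_pos: "V_K lam > 0"
proof -
  have l0: "((\<lambda>y::real. y powr lam) \<longlongrightarrow> 0) (at_right 0)"
    using lam by real_asymp
  have "((\<lambda>y::real. y powr lam * ln y) \<longlongrightarrow> 0) (at_right 0)"
    using lam by real_asymp
  then have "((\<lambda>y. (y powr lam * ln y - E_K lam) - kap0 * (y powr lam - 1)) \<longlongrightarrow> (0 - E_K lam) - kap0 * (0 - 1)) (at_right 0)"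
    by (intro tendsto_intros l0)
  moreover have "(0 - E_K lam) - kap0 * (0 - 1) > 0" using lam by (simp add: kap0_def)
  ultimately have "\<forall>\<^sub>F y in at_right 0. (y powr lam * ln y - E_K lam) - kap0 * (y powr lam - 1) > 0"
    by (rule order_tendstoD(1))
  then obtain r where r: "r > 0" "\<And>y. 0 < y \<Longrightarrow> y < r \<Longrightarrow> (y powr lam * ln y - E_K lam) - kap0 * (y powr lam - 1) > 0"
    by (auto simp: eventually_at_right_field)
  have "E0 (\<lambda>y. (kfun y)\<^sup>2) > 0"
  proof (rule E0_square_pos[OF poly_growth_kfun r(1)])
    fix y assume y: "0 < y" "y < r"
    then show "kfun y \<noteq> 0" using r(2)[OF y] lam by (simp add: kfun_def hfun_def Pfun_def T_def)
  qed
  then show ?thesis by (simp add: E0_kfun2)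
qed

end

section \<open>Linearisation of the summands and the delta method in probability\<close>

context iid_array
begin

lemma lin_const: "lin (\<lambda>y. c)"
  by (rule lin_mono) (auto simp: mono_def)

lemma lin_psi: "lin psi"
  using mono_signed_powr[of "lam - 1"] lam by (intro lin_mono poly_growth_psi) (simp add: psi_def[abs_def])

lemma lin_gfun: "lin gfun"
  using mono_signed_powr[of lam] lam by (intro lin_mono poly_growth_gfun) (simp add: gfun_def[abs_def])

text \<open>Even functions are not monotone, but many are a monotone function plus its reflection,
  and the reflection is antitone.\<close>

lemma lin_even:
  assumes mono: "mono a" and pg: "poly_growth a" and even: "\<And>y. f y = a y + a (- y)"
  shows "lin f"
proof -
  have "antimono (\<lambda>y. a (- y))" using mono by (auto simp: mono_def antimono_def)
  then have "lin (\<lambda>y. a y + a (- y))"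
    by (intro lin_add lin_mono lin_antimono pg poly_growth_reflect mono)
  moreover have "f = (\<lambda>y. a y + a (- y))" using even by (rule ext)
  ultimately show ?thesis by simp
qed

lemma lin_abs_powr: "lin (\<lambda>y. \<bar>y\<bar> powr lam)"
proof (rule lin_even)
  let ?a = "\<lambda>y. max y 0 powr lam"
  show "mono ?a" using lam by (auto simp: mono_def intro!: powr_mono2)
  show "\<bar>y\<bar> powr lam = ?a y + ?a (- y)" for y by (auto simp: max_def)
  show "poly_growth ?a"
    by (rule poly_growth_dominated[OF poly_growth_powr[of lam]]) (use lam in \<open>auto simp: max_def\<close>)
qed

lemma hfun_pos: "y > 0 \<Longrightarrow> hfun y = y powr lam * ln y"
  by (simp add: hfun_def)

lemma hfun_deriv:
  assumes "y > 0"
  shows "((\<lambda>y. y powr lam * ln y) has_real_derivative y powr (lam - 1) * (lam * ln y + 1)) (at y)"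
proof -
  have "y powr lam * (1 / y) = y powr (lam - 1)"
    using assms by (simp add: powr_diff)
  then show ?thesis using assms
    by (auto intro!: derivative_eq_intros simp: algebra_simps)
qed

text \<open>The minimiser of \<open>y powr lam * ln y\<close>.\<close>

definition ystar :: real where "ystar = exp (- ia)"

lemma ystar: "ystar > 0" "ln ystar = - ia" by (simp_all add: ystar_def)

lemma hfun_increasing:
  assumes "ystar \<le> x" "x \<le> y"
  shows "hfun x \<le> hfun y"
proof -
  have "x powr lam * ln x \<le> y powr lam * ln y"
  proof (rule DERIV_nonneg_imp_nondecreasing[OF assms(2)])
    fix z assume z: "x \<le> z" "z \<le> y"
    then have z0: "z > 0" using assms ystar by linarith
    have "ln ystar \<le> ln z" using z assms ystar(1) by (subst ln_le_cancel_iff) auto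
    then have "lam * - ia \<le> lam * ln z" using lam ystar by (intro mult_left_mono) auto
    then have "lam * ln z + 1 \<ge> 0" using lam by simp
    then show "\<exists>d. ((\<lambda>y. y powr lam * ln y) has_real_derivative d) (at z) \<and> 0 \<le> d"
      using hfun_deriv[OF z0] by (intro exI[of _ "z powr (lam - 1) * (lam * ln z + 1)"]) auto
  qed
  then show ?thesis using assms ystar by (simp add: hfun_pos)
qed

lemma hfun_decreasing:
  assumes "0 \<le> x" "x \<le> y" "y \<le> ystar"
  shows "hfun y \<le> hfun x"
proof (cases "x = 0")
  case True
  have "hfun y \<le> 0"
  proof (cases "y = 0")
    case False
    then have "ln y \<le> ln ystar" using assms True by simp
    also have "\<dots> \<le> 0" using ystar lam by simp
    finally show ?thesis using False assms True by (simp add: hfun_pos mult_nonneg_nonpos)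
  qed (simp add: hfun_def)
  then show ?thesis using True by (simp add: hfun_def)
next
  case False
  then have x0: "x > 0" using assms by simp
  have "y powr lam * ln y \<le> x powr lam * ln x"
  proof (rule DERIV_nonpos_imp_nonincreasing[OF assms(2)])
    fix z assume z: "x \<le> z" "z \<le> y"
    then have z0: "z > 0" using x0 by linarith
    have "ln z \<le> ln ystar" using z z0 assms ystar(1) by (subst ln_le_cancel_iff) auto
    then have "lam * ln z \<le> lam * - ia" using lam ystar by (intro mult_left_mono) auto
    then have "lam * ln z + 1 \<le> 0" using lam by simp
    then show "\<exists>d. ((\<lambda>y. y powr lam * ln y) has_real_derivative d) (at z) \<and> d \<le> 0"
      using hfun_deriv[OF z0] by (intro exI[of _ "z powr (lam - 1) * (lam * ln z + 1)"]) (auto intro: mult_nonneg_nonpos)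
  qed
  then show ?thesis using x0 assms by (simp add: hfun_pos)
qed

text \<open>On the positive axis \<open>hfun\<close> falls up to \<open>ystar\<close> and rises
  afterwards. \<open>?a\<close> collects the rise and \<open>?b\<close> the fall with its sign
  reversed, each extended by constants to a monotone function on the line; their symmetrisations
  differ by \<open>hfun\<close>.\<close>

lemma lin_hfun: "lin hfun"
proof -
  let ?a = "\<lambda>y. hfun (max y ystar) - hfun ystar" and ?b = "\<lambda>y. - hfun (min (max y 0) ystar)"
  have [measurable]: "hfun \<in> borel_measurable borel" using poly_growth_hfun by (rule poly_growth_measurable)
  have pg: "poly_growth (\<lambda>y. \<bar>hfun y\<bar> + 2 * \<bar>hfun ystar\<bar>)"
    by (intro poly_growth_add poly_growth_abs poly_growth_hfun poly_growth_const)
  have h0: "hfun 0 = 0" by (simp add: hfun_def)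
  have "mono ?a" by (auto simp: mono_def intro!: hfun_increasing)
  moreover have a: "poly_growth ?a"
    by (rule poly_growth_dominated[OF pg]) (auto simp: max_def)
  moreover have "mono ?b" using ystar(1) by (auto simp: mono_def intro!: hfun_decreasing)
  moreover have b: "poly_growth ?b"
    by (rule poly_growth_dominated[OF pg]) (auto simp: max_def min_def h0)
  ultimately have m: "mono (\<lambda>y. ?a y - 0)" "poly_growth ?a" "mono ?b" "poly_growth ?b" by simp_all
  have 1: "lin (\<lambda>y. ?a y + ?a (- y))" by (rule lin_even[of ?a]) (use m in simp_all)
  have 2: "lin (\<lambda>y. ?b y + ?b (- y))" by (rule lin_even[of ?b]) (use m in simp_all)
  have "lin (\<lambda>y. (?a y + ?a (- y)) - (?b y + ?b (- y)))"
    by (rule lin_diff[OF _ 1 _ 2]) (intro poly_growth_add a b poly_growth_reflect[OF a] poly_growth_reflect[OF b])+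
  also have "(\<lambda>y. (?a y + ?a (- y)) - (?b y + ?b (- y))) = hfun"
  proof
    fix y
    have "hfun (- y) = hfun y" by (rule even_hfun)
    then show "(?a y + ?a (- y)) - (?b y + ?b (- y)) = hfun y"
      using ystar(1) h0 by (cases "y \<ge> 0") (auto simp: max_def min_def)
  qed
  finally show ?thesis .
qed

lemma small_tendsto_0: 
  assumes "c \<longlonglongrightarrow> 0" 
  shows "small (\<lambda>n \<omega>. c n)"
  unfolding small_def
proof (intro allI impI)
  fix \<epsilon> :: real assume "\<epsilon> > 0"
  show "whp (\<lambda>n \<omega>. \<bar>c n\<bar> \<le> \<epsilon>)"
    by (rule whp_mono[OF whp_True])
       (use tendstoD[OF assms \<open>\<epsilon> > 0\<close>] in \<open>auto elim!: eventually_mono simp: dist_real_def\<close>)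
qed

lemma small_whp_cong:
  assumes "small R" "whp (\<lambda>n \<omega>. R' n \<omega> = R n \<omega>)"
  shows "small R'"
  unfolding small_def
proof (intro allI impI)
  fix \<epsilon> :: real assume "\<epsilon> > 0"
  show "whp (\<lambda>n \<omega>. \<bar>R' n \<omega>\<bar> \<le> \<epsilon>)"
    by (rule whp_mono2[OF smallD[OF assms(1) \<open>\<epsilon> > 0\<close>] assms(2)]) (simp add: always_eventually)
qed

text \<open>Once \<bar>V\<bar> \<le> K, the increment V / sqrt n is uniformly small and the
  definition of the derivative at 1 applies pointwise, with no further probability involved.\<close>

lemma delta_method_tight:
  fixes f :: "real \<Rightarrow> real"
  assumes V: "tight_seq V" and f: "(f has_real_derivative d) (at 1)"
  shows "small (\<lambda>n \<omega>. sqrt (real n) * (f (1 + V n \<omega> / sqrt (real n)) - f 1) - d * V n \<omega>)"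
proof (rule small_of_tight[OF V])
  fix K \<epsilon> :: real assume "\<epsilon> > 0"
  define e where "e = \<epsilon> / (\<bar>K\<bar> + 1)"
  have e: "e > 0" using \<open>\<epsilon> > 0\<close> by (simp add: e_def)
  obtain \<delta> where \<delta>: "\<delta> > 0" "\<And>y. \<bar>y - 1\<bar> < \<delta> \<Longrightarrow> \<bar>f y - f 1 - d * (y - 1)\<bar> \<le> e * \<bar>y - 1\<bar>"
    using f e unfolding has_field_derivative_def has_derivative_at_alt by (auto simp: mult.commute)
  have "(\<lambda>n. \<bar>K\<bar> / sqrt (real n)) \<longlonglongrightarrow> 0"
    by (rule tendsto_divide_0[OF tendsto_const filterlim_at_top_imp_at_infinity[OF filterlim_sqrt_nat]])
  then have "\<forall>\<^sub>F n in sequentially. \<bar>K\<bar> / sqrt (real n) < \<delta>" by (rule order_tendstoD) (rule \<delta>)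
  then have "\<forall>\<^sub>F n in sequentially. \<forall>\<omega>\<in>space (M n). True \<longrightarrow> (\<bar>V n \<omega>\<bar> \<le> K \<longrightarrow> \<bar>sqrt (real n) * (f (1 + V n \<omega> / sqrt (real n)) - f 1) - d * V n \<omega>\<bar> \<le> \<epsilon>)"
    using eventually_gt_at_top[of 0]
  proof eventually_elim
    case (elim n)
    show ?case
    proof (intro ballI impI)
      fix \<omega> assume VK: "\<bar>V n \<omega>\<bar> \<le> K"
      have n: "sqrt (real n) > 0" using elim by simp
      let ?h = "V n \<omega> / sqrt (real n)"
      have "\<bar>?h\<bar> \<le> \<bar>K\<bar> / sqrt (real n)" using VK n by (simp add: abs_divide divide_right_mono)
      then have "\<bar>f (1 + ?h) - f 1 - d * ?h\<bar> \<le> e * \<bar>?h\<bar>" using \<delta>(2)[of "1 + ?h"] elim by simp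
      then have "sqrt (real n) * \<bar>f (1 + ?h) - f 1 - d * ?h\<bar> \<le> sqrt (real n) * (e * \<bar>?h\<bar>)"
        by (rule mult_left_mono) simp
      also have "\<dots> = e * \<bar>V n \<omega>\<bar>" using n by (simp add: abs_divide)
      also have "\<dots> \<le> e * (\<bar>K\<bar> + 1)" using VK e by (intro mult_left_mono) auto
      also have "\<dots> = \<epsilon>" by (simp add: e_def)
      also have "sqrt (real n) * \<bar>f (1 + ?h) - f 1 - d * ?h\<bar> = \<bar>sqrt (real n) * (f (1 + ?h) - f 1 - d * ?h)\<bar>"
        by (simp add: abs_mult)
      also have "sqrt (real n) * (f (1 + ?h) - f 1 - d * ?h) = sqrt (real n) * (f (1 + ?h) - f 1) - d * V n \<omega>"
        using n by (simp add: right_diff_distrib)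
      finally show "\<bar>sqrt (real n) * (f (1 + ?h) - f 1) - d * V n \<omega>\<bar> \<le> \<epsilon>" .
    qed
  qed
  then show "whp (\<lambda>n \<omega>. \<bar>V n \<omega>\<bar> \<le> K \<longrightarrow> \<bar>sqrt (real n) * (f (1 + V n \<omega> / sqrt (real n)) - f 1) - d * V n \<omega>\<bar> \<le> \<epsilon>)"
    by (rule whp_mono[OF whp_True])
qed

lemma small_delta:
  fixes f :: "real \<Rightarrow> real"
  assumes V: "tight_seq V" and f: "(f has_real_derivative d) (at 1)"
  shows "small (\<lambda>n \<omega>. f (1 + V n \<omega> / sqrt (real n)) - f 1)"
proof -
  have t: "tight_seq (\<lambda>n \<omega>. sqrt (real n) * (f (1 + V n \<omega> / sqrt (real n)) - f 1))"
    by (rule tight_add_small[OF tight_cmult[OF V, of d] delta_method_tight[OF V f]])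
  have "(\<lambda>n. 1 / sqrt (real n)) \<longlonglongrightarrow> 0"
    by (rule tendsto_divide_0[OF tendsto_const filterlim_at_top_imp_at_infinity[OF filterlim_sqrt_nat]])
  from small_mult_tight[OF t small_tendsto_0[OF this]] show ?thesis
  proof (rule small_cong)
    show "\<forall>\<^sub>F n in sequentially. \<forall>\<omega>\<in>space (M n). sqrt (real n) * (f (1 + V n \<omega> / sqrt (real n)) - f 1) * (1 / sqrt (real n)) = f (1 + V n \<omega> / sqrt (real n)) - f 1"
      using eventually_gt_at_top[of 0] by eventually_elim simp
  qed
qed

lemma Sn_add: "Sn (\<lambda>y. f y + g y) n \<omega> = Sn f n \<omega> + Sn g n \<omega>"
  and Sn_diff: "Sn (\<lambda>y. f y - g y) n \<omega> = Sn f n \<omega> - Sn g n \<omega>"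
  and Sn_cmult: "Sn (\<lambda>y. c * f y) n \<omega> = c * Sn f n \<omega>"
  by (simp_all add: Sn_def sum.distrib sum_subtractf add_divide_distrib diff_divide_distrib flip: sum_distrib_left)

end

subsection \<open>Expansion of the estimators\<close>

text \<open>\<tau> stands for sqrt n times the standardised estimation error. Only a sign change of
  the estimating function at \<tau> is assumed, which holds for the median as well as for exact
  roots.\<close>

locale location_array = iid_array lam d1 d2 th ell M Y
  for lam d1 d2 :: real and th ell :: "nat \<Rightarrow> real" and M :: "nat \<Rightarrow> 'a measure" and Y :: "nat \<Rightarrow> nat \<Rightarrow> 'a \<Rightarrow> real" +
  fixes \<tau> :: "nat \<Rightarrow> 'a \<Rightarrow> real"
  assumes tau_less: "\<And>n t \<omega>. n \<ge> 1 \<Longrightarrow> t < \<tau> n \<omega> \<Longrightarrow> Sn (\<lambda>y. psi (y - t / sqrt (real n))) n \<omega> \<ge> 0"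
    and tau_greater: "\<And>n t \<omega>. n \<ge> 1 \<Longrightarrow> t > \<tau> n \<omega> \<Longrightarrow> Sn (\<lambda>y. psi (y - t / sqrt (real n))) n \<omega> \<le> 0"
begin

lemma rem_psi: "rem psi n \<omega> t = Sn (\<lambda>y. psi (y - t / sqrt (real n))) n \<omega> - Sn psi n \<omega> + Dpsi * t"
  by (simp add: rem_def Dpsi_def)

text \<open>At t = K the estimating function is about Sn psi - Dpsi * K, which is negative for large
  \<open>K\<close>; by the sign condition \<tau> cannot lie beyond \<open>K\<close>. The lower bound
  is symmetric.\<close>

lemma tau_tight: "tight_seq \<tau>"
  unfolding tight_seq_def
proof (intro allI impI)
  fix \<eta> :: real assume "\<eta> > 0"
  then have h: "\<eta> / 2 > 0" by simp
  obtain K0 where K0: "\<forall>\<^sub>F n in sequentially. likely n (\<eta> / 2) (\<lambda>\<omega>. \<bar>Sn psi n \<omega>\<bar> \<le> K0)"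
    using Sn_tight[OF poly_growth_psi E0_psi] h unfolding tight_seq_def by blast
  \<comment> \<open>Dpsi * K exceeds the bound on the sum by 2, of which the remainder consumes 1;
    the other 1 makes the sign strict.\<close>
  define K where "K = (\<bar>K0\<bar> + 2) / Dpsi"
  have K: "K \<ge> 0" "Dpsi * K = \<bar>K0\<bar> + 2" using Dpsi_pos by (auto simp: K_def)
  have "\<forall>\<^sub>F n in sequentially. likely n (\<eta> / 2) (\<lambda>\<omega>. \<forall>t. \<bar>t\<bar> \<le> K \<longrightarrow> \<bar>rem psi n \<omega> t\<bar> \<le> 1)"
    using linD[OF lin_psi, of 1 K] h unfolding whp_def by simp
  with ev_prob K0 eventually_ge_at_top[of 1]
  have "\<forall>\<^sub>F n in sequentially. likely n \<eta> (\<lambda>\<omega>. \<bar>\<tau> n \<omega>\<bar> \<le> K)"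
  proof eventually_elim
    case (elim n)
    show ?case
    proof (rule likely_combine[OF elim(1,2,4)])
      fix \<omega> assume s: "\<bar>Sn psi n \<omega>\<bar> \<le> K0" and b: "\<forall>t. \<bar>t\<bar> \<le> K \<longrightarrow> \<bar>rem psi n \<omega> t\<bar> \<le> 1"
      have "\<not> K < \<tau> n \<omega>"
        using tau_less[OF elim(3), of K \<omega>] b[rule_format, of K] K s unfolding rem_psi by auto
      moreover have "\<not> \<tau> n \<omega> < - K"
        using tau_greater[OF elim(3), of \<omega> "- K"] b[rule_format, of "- K"] K s unfolding rem_psi by auto
      ultimately show "\<bar>\<tau> n \<omega>\<bar> \<le> K" by linarith
    qed
  qed
  then show "\<exists>K. \<forall>\<^sub>F n in sequentially. likely n \<eta> (\<lambda>\<omega>. \<bar>\<tau> n \<omega>\<bar> \<le> K)" by blast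
qed

text \<open>The estimating function need not vanish at \<tau>, so it is evaluated at \<tau> -
  \<delta> and \<tau> + \<delta>, where its sign is known. Moving by \<delta> changes the linear
  term by \<epsilon> / 2, and the remainder accounts for the other half.\<close>

lemma tau_expansion: "small (\<lambda>n \<omega>. Sn psi n \<omega> - Dpsi * \<tau> n \<omega>)"
proof (rule small_of_tight[OF tau_tight])
  fix K \<epsilon> :: real assume "\<epsilon> > 0"
  then have h: "\<epsilon> / 2 > 0" by simp
  define \<delta> where "\<delta> = \<epsilon> / (2 * Dpsi)"
  have \<delta>: "\<delta> > 0" "Dpsi * \<delta> = \<epsilon> / 2" using \<open>\<epsilon> > 0\<close> Dpsi_pos by (auto simp: \<delta>_def)
  have "\<forall>\<^sub>F n in sequentially. \<forall>\<omega>\<in>space (M n). (\<forall>t. \<bar>t\<bar> \<le> K + \<delta> \<longrightarrow> \<bar>rem psi n \<omega> t\<bar> \<le> \<epsilon> / 2) \<longrightarrow>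
      \<bar>\<tau> n \<omega>\<bar> \<le> K \<longrightarrow> \<bar>Sn psi n \<omega> - Dpsi * \<tau> n \<omega>\<bar> \<le> \<epsilon>"
    using eventually_ge_at_top[of 1]
  proof eventually_elim
    case (elim n)
    show ?case
    proof (intro ballI impI)
      fix \<omega> assume b: "\<forall>t. \<bar>t\<bar> \<le> K + \<delta> \<longrightarrow> \<bar>rem psi n \<omega> t\<bar> \<le> \<epsilon> / 2" and \<tau>: "\<bar>\<tau> n \<omega>\<bar> \<le> K"
      have k: "\<bar>\<tau> n \<omega> - \<delta>\<bar> \<le> K + \<delta>" "\<bar>\<tau> n \<omega> + \<delta>\<bar> \<le> K + \<delta>" using \<tau> \<delta>(1) by linarith+
      have "Sn (\<lambda>y. psi (y - (\<tau> n \<omega> - \<delta>) / sqrt (real n))) n \<omega> \<ge> 0"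
        "Sn (\<lambda>y. psi (y - (\<tau> n \<omega> + \<delta>) / sqrt (real n))) n \<omega> \<le> 0"
        using \<delta>(1) by (auto intro: tau_less tau_greater elim)
      then show "\<bar>Sn psi n \<omega> - Dpsi * \<tau> n \<omega>\<bar> \<le> \<epsilon>"
        using b[rule_format, OF k(1)] b[rule_format, OF k(2)] \<delta>(2)
        unfolding rem_psi right_diff_distrib distrib_left by linarith
    qed
  qed
  then show "whp (\<lambda>n \<omega>. \<bar>\<tau> n \<omega>\<bar> \<le> K \<longrightarrow> \<bar>Sn psi n \<omega> - Dpsi * \<tau> n \<omega>\<bar> \<le> \<epsilon>)"
    by (rule whp_mono[OF linD[OF lin_psi h, of "K + \<delta>"]])
qed

text \<open>The normalised sum over observations centred by the estimated location, before division
  by the estimated scale.\<close>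

definition Nn :: "(real \<Rightarrow> real) \<Rightarrow> nat \<Rightarrow> 'a \<Rightarrow> real" where
  "Nn f n \<omega> = Sn (\<lambda>y. f (y - \<tau> n \<omega> / sqrt (real n))) n \<omega>"

text \<open>Orthogonality to the location score means that the estimated location has no first-order
  effect. For the even summands parity supplies the orthogonality.\<close>

lemma Nn_even:
  assumes "lin f" "E0 (\<lambda>y. f y * psi y) = 0"
  shows "small (\<lambda>n \<omega>. Nn f n \<omega> - Sn f n \<omega>)"
  using lin_subst[OF assms(1) tau_tight] by (simp add: rem_def Nn_def assms(2))

text \<open>The shift contributes - bg * \<tau>, and \<tau> is Sn psi / Dpsi up to a negligible
  term; this is how the residual \<open>sfun\<close> arises.\<close>

lemma Nn_gfun: "small (\<lambda>n \<omega>. Nn gfun n \<omega> - Sn sfun n \<omega>)"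
proof (rule small_cong)
  show "small (\<lambda>n \<omega>. (Nn gfun n \<omega> - Sn gfun n \<omega> + bg * \<tau> n \<omega>) + bg / Dpsi * (Sn psi n \<omega> - Dpsi * \<tau> n \<omega>))"
    unfolding Nn_def bg_def rem_def[symmetric]
    by (rule small_add[OF lin_subst[OF lin_gfun tau_tight] small_cmult[OF tau_expansion]])
  show "\<forall>\<^sub>F n in sequentially. \<forall>\<omega>\<in>space (M n). (Nn gfun n \<omega> - Sn gfun n \<omega> + bg * \<tau> n \<omega>) + bg / Dpsi * (Sn psi n \<omega> - Dpsi * \<tau> n \<omega>) = Nn gfun n \<omega> - Sn sfun n \<omega>"
  proof (intro always_eventually allI ballI)
    fix n \<omega>
    have "Sn sfun n \<omega> = Sn gfun n \<omega> - bg / Dpsi * Sn psi n \<omega>"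
      unfolding sfun_def[abs_def] by (simp only: Sn_diff Sn_cmult)
    then show "(Nn gfun n \<omega> - Sn gfun n \<omega> + bg * \<tau> n \<omega>) + bg / Dpsi * (Sn psi n \<omega> - Dpsi * \<tau> n \<omega>) = Nn gfun n \<omega> - Sn sfun n \<omega>"
      using Dpsi_pos by (simp add: right_diff_distrib)
  qed
qed

lemma Nn_Pfun: "small (\<lambda>n \<omega>. Nn Pfun n \<omega> - Sn Pfun n \<omega>)"
proof (rule Nn_even)
  have "lin (\<lambda>y. \<bar>y\<bar> powr lam - 1)"
    using lam by (intro lin_diff lin_abs_powr lin_const poly_growth_powr poly_growth_const) auto
  then show "lin Pfun" using lam by (simp add: Pfun_def[abs_def] T_def)
  show "E0 (\<lambda>y. Pfun y * psi y) = 0" by (rule E0_odd) (simp add: Pfun_def even_T odd_psi)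
qed

lemma Nn_hfun: "small (\<lambda>n \<omega>. Nn (\<lambda>y. hfun y - E_K lam) n \<omega> - Sn (\<lambda>y. hfun y - E_K lam) n \<omega>)"
proof (rule Nn_even)
  show "lin (\<lambda>y. hfun y - E_K lam)"
    by (intro lin_diff lin_hfun lin_const poly_growth_hfun poly_growth_const)
  show "E0 (\<lambda>y. (hfun y - E_K lam) * psi y) = 0" by (rule E0_odd) (simp add: even_hfun odd_psi)
qed

text \<open>As Pfun y = \<bar>y\<bar> powr lam - 1, this is the mean of the absolute
  \<open>lam\<close>-th powers of the centred observations; its \<open>lam\<close>-th root is the
  ratio of the estimated to the true scale.\<close>

definition Bn :: "nat \<Rightarrow> 'a \<Rightarrow> real" where
  "Bn n \<omega> = 1 + Nn Pfun n \<omega> / sqrt (real n)"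

lemma tight_Pfun: "tight_seq (Nn Pfun)"
  by (rule tight_add_small[OF Sn_tight[OF poly_growth_Pfun E0_Pfun] Nn_Pfun])

lemma whp_Bn_pos: "whp (\<lambda>n \<omega>. Bn n \<omega> > 0)"
proof -
  have "small (\<lambda>n \<omega>. Bn n \<omega> - 1)" unfolding Bn_def by (rule small_delta[OF tight_Pfun DERIV_ident])
  then have "whp (\<lambda>n \<omega>. \<bar>Bn n \<omega> - 1\<bar> \<le> 1 / 2)" by (rule smallD) simp
  then show ?thesis
  proof (rule whp_mono, intro always_eventually allI ballI impI)
    fix n \<omega> assume "\<bar>Bn n \<omega> - 1\<bar> \<le> 1 / 2"
    then show "Bn n \<omega> > 0" by linarith
  qed
qed

lemma d_inverse: "((\<lambda>x::real. 1 / x) has_real_derivative - 1) (at 1)"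
  by (auto intro!: derivative_eq_intros)

lemma d_ln: "(ln has_real_derivative 1) (at (1::real))"
  using DERIV_ln[of "1::real"] by simp

text \<open>The numerator is bounded in probability and \<open>Bn\<close> tends to 1, so dividing by
  the estimated scale costs only o(1) in probability.\<close>

lemma S_expansion: "small (\<lambda>n \<omega>. Nn gfun n \<omega> / Bn n \<omega> - Sn sfun n \<omega>)"
proof -
  have t: "tight_seq (Nn gfun)" by (rule tight_add_small[OF Sn_tight[OF poly_growth_sfun E0_sfun] Nn_gfun])
  have "small (\<lambda>n \<omega>. (Nn gfun n \<omega> - Sn sfun n \<omega>) + Nn gfun n \<omega> * (1 / Bn n \<omega> - 1 / 1))"
    unfolding Bn_def by (intro small_add Nn_gfun small_mult_tight[OF t] small_delta[OF tight_Pfun d_inverse])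
  then show ?thesis
    by (rule small_cong) (intro always_eventually allI ballI, simp add: right_diff_distrib)
qed

text \<open>Here the scale does matter. The expansion of 1 / Bn at 1 contributes - E_K times the
  fluctuation of \<open>Bn\<close>, that of - ln Bn / lam another - 1 / lam; together they give the
  coefficient - kap0 of \<open>Pfun\<close> in \<open>kfun\<close>.\<close>

lemma K_expansion:
  "small (\<lambda>n \<omega>. sqrt (real n) * ((E_K lam + Nn (\<lambda>y. hfun y - E_K lam) n \<omega> / sqrt (real n)) / Bn n \<omega> - ln (Bn n \<omega>) / lam - E_K lam)
     - Sn kfun n \<omega>)"
proof -
  let ?h = "\<lambda>y. hfun y - E_K lam"
  have pgh: "poly_growth ?h" by (intro poly_growth_diff poly_growth_hfun poly_growth_const)
  have t: "tight_seq (Nn ?h)" by (rule tight_add_small[OF Sn_tight[OF pgh E0_hfun_centred] Nn_hfun])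
  let ?V = "Nn Pfun"
  have 1: "small (\<lambda>n \<omega>. sqrt (real n) * (1 / Bn n \<omega> - 1 / 1) - - 1 * ?V n \<omega>)"
    unfolding Bn_def by (rule delta_method_tight[OF tight_Pfun d_inverse])
  have 2: "small (\<lambda>n \<omega>. sqrt (real n) * (ln (Bn n \<omega>) - ln 1) - 1 * ?V n \<omega>)"
    unfolding Bn_def by (rule delta_method_tight[OF tight_Pfun d_ln])
  have 3: "small (\<lambda>n \<omega>. Nn ?h n \<omega> * (1 / Bn n \<omega> - 1 / 1))"
    unfolding Bn_def by (intro small_mult_tight[OF t] small_delta[OF tight_Pfun d_inverse])
  have "small (\<lambda>n \<omega>. E_K lam * (sqrt (real n) * (1 / Bn n \<omega> - 1 / 1) - - 1 * ?V n \<omega>)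
     - ia * (sqrt (real n) * (ln (Bn n \<omega>) - ln 1) - 1 * ?V n \<omega>)
     + Nn ?h n \<omega> * (1 / Bn n \<omega> - 1 / 1) + (Nn ?h n \<omega> - Sn ?h n \<omega>) - kap0 * (?V n \<omega> - Sn Pfun n \<omega>))"
    by (intro small_add small_diff small_cmult 1 2 3 Nn_hfun Nn_Pfun)
  then show ?thesis
  proof (rule small_cong)
    show "\<forall>\<^sub>F n in sequentially. \<forall>\<omega>\<in>space (M n). E_K lam * (sqrt (real n) * (1 / Bn n \<omega> - 1 / 1) - - 1 * ?V n \<omega>)
     - ia * (sqrt (real n) * (ln (Bn n \<omega>) - ln 1) - 1 * ?V n \<omega>)
     + Nn ?h n \<omega> * (1 / Bn n \<omega> - 1 / 1) + (Nn ?h n \<omega> - Sn ?h n \<omega>) - kap0 * (?V n \<omega> - Sn Pfun n \<omega>)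
     = sqrt (real n) * ((E_K lam + Nn ?h n \<omega> / sqrt (real n)) / Bn n \<omega> - ln (Bn n \<omega>) / lam - E_K lam) - Sn kfun n \<omega>"
      using eventually_gt_at_top[of 0]
    proof eventually_elim
      case (elim n)
      show ?case
      proof
        fix \<omega>
        have k: "Sn kfun n \<omega> = Sn ?h n \<omega> - kap0 * Sn Pfun n \<omega>"
          unfolding kfun_def[abs_def] by (simp only: Sn_diff[of ?h "\<lambda>y. kap0 * Pfun y"] Sn_cmult)
        define s where "s = sqrt (real n)"
        define v where "v = 1 / Bn n \<omega>"
        have s: "s \<noteq> 0" using elim by (simp add: s_def)
        have "s * ((E_K lam + Nn ?h n \<omega> / s) * v - ln (Bn n \<omega>) / lam - E_K lam) =
           E_K lam * (s * (v - 1)) - ia * (s * ln (Bn n \<omega>)) + Nn ?h n \<omega> * v"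
          using s by (simp add: field_simps)
        then have e: "s * ((E_K lam + Nn ?h n \<omega> / s) / Bn n \<omega> - ln (Bn n \<omega>) / lam - E_K lam) =
           E_K lam * (s * (v - 1)) - ia * (s * ln (Bn n \<omega>)) + Nn ?h n \<omega> * v"
          by (simp add: v_def)
        show "E_K lam * (sqrt (real n) * (1 / Bn n \<omega> - 1 / 1) - - 1 * ?V n \<omega>)
     - ia * (sqrt (real n) * (ln (Bn n \<omega>) - ln 1) - 1 * ?V n \<omega>)
     + Nn ?h n \<omega> * (1 / Bn n \<omega> - 1 / 1) + (Nn ?h n \<omega> - Sn ?h n \<omega>) - kap0 * (?V n \<omega> - Sn Pfun n \<omega>)
     = sqrt (real n) * ((E_K lam + Nn ?h n \<omega> / sqrt (real n)) / Bn n \<omega> - ln (Bn n \<omega>) / lam - E_K lam) - Sn kfun n \<omega>"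
          unfolding s_def[symmetric] e k unfolding v_def[symmetric] kap0_def
          by (simp add: algebra_simps)
      qed
    qed
  qed
qed

end

subsection \<open>Characteristic function of the normal law\<close>

lemma integral_normal_density_iexp:
  shows "integrable lborel (\<lambda>t. normal_density \<mu> 1 t *\<^sub>R iexp (s * t))"
    and "(\<integral>t. normal_density \<mu> 1 t *\<^sub>R iexp (s * t) \<partial>lborel) = exp (\<i> * (s * \<mu>) - s\<^sup>2 / 2)"
proof -
  have i0: "integrable lborel (\<lambda>t. normal_density \<mu> 1 t *\<^sub>R iexp (s * t))" for \<mu>
  proof (rule Bochner_Integration.integrable_bound[OF integrable_normal_density[of 1 \<mu>]])
    show "AE t in lborel. norm (normal_density \<mu> 1 t *\<^sub>R iexp (s * t)) \<le> norm (normal_density \<mu> 1 t)"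
      by (intro AE_I2) simp
  qed auto
  then show "integrable lborel (\<lambda>t. normal_density \<mu> 1 t *\<^sub>R iexp (s * t))" .
  have "(\<integral>t. normal_density \<mu> 1 t *\<^sub>R iexp (s * t) \<partial>lborel) =
      (\<integral>t. normal_density \<mu> 1 (\<mu> + 1 * t) *\<^sub>R iexp (s * (\<mu> + 1 * t)) \<partial>lborel)"
    by (subst lborel_integral_real_affine[where c=1 and t=\<mu>]) auto
  also have "\<dots> = (\<integral>t. iexp (s * \<mu>) * (std_normal_density t *\<^sub>R iexp (s * t)) \<partial>lborel)"
  proof (intro Bochner_Integration.integral_cong refl)
    fix t :: real
    have 1: "normal_density \<mu> 1 (\<mu> + 1 * t) = std_normal_density t" by (simp add: normal_density_def)
    have 2: "iexp (s * (\<mu> + 1 * t)) = iexp (s * \<mu>) * iexp (s * t)" by (simp add: distrib_left exp_add)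
    show "normal_density \<mu> 1 (\<mu> + 1 * t) *\<^sub>R iexp (s * (\<mu> + 1 * t)) = iexp (s * \<mu>) * (std_normal_density t *\<^sub>R iexp (s * t))"
      unfolding 1 2 by (simp only: mult_scaleR_right)
  qed
  also have "\<dots> = iexp (s * \<mu>) * (\<integral>t. std_normal_density t *\<^sub>R iexp (s * t) \<partial>lborel)"
    by (rule integral_mult_right_zero)
  also have "(\<integral>t. std_normal_density t *\<^sub>R iexp (s * t) \<partial>lborel) = char std_normal_distribution s"
    unfolding char_def by (subst integral_density) auto
  also have "\<dots> = complex_of_real (exp (- (s\<^sup>2) / 2))"
    by (simp add: char_std_normal_distribution)
  also have "iexp (s * \<mu>) * complex_of_real (exp (- (s\<^sup>2) / 2)) = exp (\<i> * (s * \<mu>) - s\<^sup>2 / 2)"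
    unfolding exp_of_real[symmetric] exp_add[symmetric] by simp
  finally show "(\<integral>t. normal_density \<mu> 1 t *\<^sub>R iexp (s * t) \<partial>lborel) = exp (\<i> * (s * \<mu>) - s\<^sup>2 / 2)" .
qed

text \<open>With identity covariance both the density and the exponential are products over the
  coordinates, and Lebesgue measure is the image of a product measure, so the one-dimensional
  formula suffices.\<close>

lemma integral_mv_normal_iexp:
  fixes m a :: "real ^ 'n"
  shows "integrable lborel (\<lambda>x. (exp (- (norm (x - m))\<^sup>2 / 2) / sqrt ((2 * pi) ^ CARD('n))) *\<^sub>R iexp (a \<bullet> x))" (is ?int)
    and "(\<integral>x. iexp (a \<bullet> x) \<partial>mv_normal m (mat 1)) = exp (\<i> * (a \<bullet> m) - (a \<bullet> a) / 2)" (is ?eq)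
proof -
  let ?B = "Basis :: (real^'n) set"
  let ?D = "\<lambda>x. exp (- (norm (x - m))\<^sup>2 / 2) / sqrt ((2 * pi) ^ CARD('n))"
  let ?g = "\<lambda>b t. normal_density (m \<bullet> b) 1 t *\<^sub>R iexp ((a \<bullet> b) * t)"
  interpret product_sigma_finite "\<lambda>_::real^'n. lborel :: real measure" ..
  have D: "?D x = (\<Prod>b\<in>?B. normal_density (m \<bullet> b) 1 (x \<bullet> b))" for x
  proof -
    have "(\<Prod>b\<in>?B. normal_density (m \<bullet> b) 1 (x \<bullet> b)) = (\<Prod>b\<in>?B. exp (- ((x - m) \<bullet> b)\<^sup>2 / 2)) / (\<Prod>b\<in>?B. sqrt (2 * pi))"
      by (simp add: normal_density_def inner_diff_left prod_dividef prod.distrib)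
    also have "(\<Prod>b\<in>?B. exp (- ((x - m) \<bullet> b)\<^sup>2 / 2)) = exp (\<Sum>b\<in>?B. - ((x - m) \<bullet> b)\<^sup>2 / 2)"
      by (simp add: exp_sum)
    also have "(\<Sum>b\<in>?B. - ((x - m) \<bullet> b)\<^sup>2 / 2) = - (\<Sum>b\<in>?B. ((x - m) \<bullet> b)\<^sup>2) / 2"
      by (simp add: sum_negf sum_divide_distrib)
    also have "(\<Sum>b\<in>?B. ((x - m) \<bullet> b)\<^sup>2) = (norm (x - m))\<^sup>2"
      unfolding power2_norm_eq_inner euclidean_inner[of "x - m" "x - m"] by (simp add: power2_eq_square)
    also have "(\<Prod>b\<in>?B. sqrt (2 * pi)) = sqrt ((2 * pi) ^ CARD('n))"
      by (simp only: prod_constant real_sqrt_power DIM_cart DIM_real mult_1_right)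
    finally show ?thesis by simp
  qed
  have I: "iexp (a \<bullet> x) = (\<Prod>b\<in>?B. iexp ((a \<bullet> b) * (x \<bullet> b)))" for x
    unfolding euclidean_inner[of a x] by (simp add: exp_sum sum_distrib_left)
  have fx: "?D x *\<^sub>R iexp (a \<bullet> x) = (\<Prod>b\<in>?B. ?g b (x \<bullet> b))" for x
    unfolding D I by (simp add: scaleR_conv_of_real prod.distrib)
  have comp: "(\<Sum>c\<in>?B. f c *\<^sub>R c) \<bullet> b = f b" if "b \<in> ?B" for f b
    using that by (simp add: inner_sum_left inner_Basis if_distrib sum.delta cong: if_cong)
  have [measurable]: "(\<lambda>f. \<Sum>b\<in>?B. f b *\<^sub>R b) \<in> (\<Pi>\<^sub>M b\<in>?B. lborel) \<rightarrow>\<^sub>M borel" by measurable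
  have m1: "(\<lambda>x. \<Prod>b\<in>?B. ?g b (x \<bullet> b)) \<in> borel_measurable borel" by measurable
  have pc: "(\<lambda>f. \<Prod>b\<in>?B. ?g b ((\<Sum>c\<in>?B. f c *\<^sub>R c) \<bullet> b)) = (\<lambda>f. \<Prod>b\<in>?B. ?g b (f b))"
    by (intro ext prod.cong refl) (simp only: comp)
  have "integrable (\<Pi>\<^sub>M b\<in>?B. lborel) (\<lambda>f. \<Prod>b\<in>?B. ?g b (f b))"
    by (rule product_integrable_prod[OF finite_Basis integral_normal_density_iexp(1)])
  then show int: ?int
    unfolding fx by (subst lborel_eq, subst integrable_distr_eq) (use m1 in \<open>simp_all add: pc\<close>)
  have "(\<integral>x. iexp (a \<bullet> x) \<partial>mv_normal m (mat 1)) = (\<integral>x. ?D x *\<^sub>R iexp (a \<bullet> x) \<partial>lborel)"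
    unfolding mv_normal_mat_1 by (subst integral_density) auto
  also have "\<dots> = (\<integral>f. (\<Prod>b\<in>?B. ?g b (f b)) \<partial>(\<Pi>\<^sub>M b\<in>?B. lborel))"
    unfolding fx by (subst lborel_eq, subst integral_distr) (use m1 in \<open>simp_all add: pc\<close>)
  also have "\<dots> = (\<Prod>b\<in>?B. (\<integral>t. ?g b t \<partial>lborel))"
    by (rule product_integral_prod[OF finite_Basis integral_normal_density_iexp(1)])
  also have "\<dots> = (\<Prod>b\<in>?B. exp (\<i> * ((a \<bullet> b) * (m \<bullet> b)) - (a \<bullet> b)\<^sup>2 / 2))"
    by (simp only: integral_normal_density_iexp(2))
  also have "\<dots> = exp (\<Sum>b\<in>?B. \<i> * ((a \<bullet> b) * (m \<bullet> b)) - (a \<bullet> b)\<^sup>2 / 2)"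
    by (simp add: exp_sum)
  also have "(\<Sum>b\<in>?B. \<i> * ((a \<bullet> b) * (m \<bullet> b)) - (a \<bullet> b)\<^sup>2 / 2) = \<i> * (a \<bullet> m) - (a \<bullet> a) / 2"
    unfolding euclidean_inner[of a m] euclidean_inner[of a a]
    by (simp add: sum_subtractf sum_distrib_left sum_divide_distrib power2_eq_square)
  finally show ?eq .
qed

lemma sets_mv_normal: "sets (mv_normal m C) = sets borel"
  by (simp add: mv_normal_def)

text \<open>The total mass is read off from the preceding integral at a = 0.\<close>

lemma prob_space_mv_normal:
  fixes m :: "real ^ 'n"
  shows "prob_space (mv_normal m (mat 1))"
proof
  let ?D = "\<lambda>x. exp (- (norm (x - m))\<^sup>2 / 2) / sqrt ((2 * pi) ^ CARD('n))"
  have i: "integrable lborel (\<lambda>x. complex_of_real (?D x))"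
    using integral_mv_normal_iexp(1)[of m 0] by (simp add: scaleR_conv_of_real)
  have "(\<integral>x. complex_of_real (?D x) \<partial>lborel) = (\<integral>x. iexp (0 \<bullet> x) \<partial>mv_normal m (mat 1))"
    unfolding mv_normal_mat_1 by (subst integral_density) (auto simp: scaleR_conv_of_real)
  also have "\<dots> = 1" using integral_mv_normal_iexp(2)[of m 0] by simp
  finally have "complex_of_real (\<integral>x. ?D x \<partial>lborel) = 1" by simp
  then have 1: "(\<integral>x. ?D x \<partial>lborel) = 1" by (metis of_real_eq_1_iff)
  have ir: "integrable lborel ?D" using i by (simp only: complex_of_real_integrable_eq)
  have "emeasure (mv_normal m (mat 1)) (space (mv_normal m (mat 1))) = (\<integral>\<^sup>+x. ennreal (?D x) \<partial>lborel)"
    unfolding mv_normal_mat_1 by (subst emeasure_density) auto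
  also have "\<dots> = ennreal (\<integral>x. ?D x \<partial>lborel)"
    by (rule nn_integral_eq_integral[OF ir]) auto
  also have "\<dots> = 1" by (simp only: 1 ennreal_1)
  finally show "emeasure (mv_normal m (mat 1)) (space (mv_normal m (mat 1))) = 1" .
qed

section \<open>Joint characteristic function of the two statistics\<close>

context location_array
begin

text \<open>For fixed c1 and c2 the combination is, up to o(1) in probability, the normalised sum of
  the single function f = \<alpha> * sfun + \<beta> * kfun, with the standardisation absorbed into
  \<alpha> and \<beta>. The univariate limit theorem therefore suffices, and no mixed term appears
  because \<open>sfun\<close> and \<open>kfun\<close> are uncorrelated.\<close>

theorem joint_char:
  assumes S: "small (\<lambda>n \<omega>. R n \<omega> - Sn sfun n \<omega>)" and K: "small (\<lambda>n \<omega>. Q n \<omega> - Sn kfun n \<omega>)"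
    and meas: "\<forall>\<^sub>F n in sequentially. R n \<in> borel_measurable (M n) \<and> Q n \<in> borel_measurable (M n)"
  shows "(\<lambda>n. \<integral>\<omega>. iexp (c1 * (V_S lam powr (- 1 / 2) * R n \<omega>) + c2 * (V_K lam powr (- 1 / 2) * Q n \<omega>)) \<partial>M n) \<longlonglongrightarrow>
    exp (\<i> * (c1 * (- d1 * sqrt (V1 lam)) + c2 * (- d2 * sqrt (V2 lam))) - (c1\<^sup>2 + c2\<^sup>2) / 2)"
proof -
  define vS where "vS = sqrt (V_S lam)"
  define vK where "vK = sqrt (V_K lam)"
  have vS: "vS > 0" "vS * vS = V_S lam" and vK: "vK > 0" "vK * vK = V_K lam"
    using V_S_pos V_K_pos by (auto simp: vS_def vK_def)
  have pS: "V_S lam powr (- 1 / 2) = 1 / vS" and pK: "V_K lam powr (- 1 / 2) = 1 / vK"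
  proof -
    have *: "v powr (- 1 / 2) = 1 / sqrt v" if "v > 0" for v :: real
    proof -
      have "v powr (- 1 / 2) = v powr (- (1 / 2))" by simp
      also have "\<dots> = inverse (v powr (1 / 2))" by (rule powr_minus)
      also have "\<dots> = 1 / sqrt v" using that by (simp only: powr_half_sqrt inverse_eq_divide less_imp_le)
      finally show ?thesis .
    qed
    show "V_S lam powr (- 1 / 2) = 1 / vS" "V_K lam powr (- 1 / 2) = 1 / vK"
      unfolding vS_def vK_def by (rule *[OF V_S_pos], rule *[OF V_K_pos])
  qed
  define \<alpha> where "\<alpha> = c1 / vS"
  define \<beta> where "\<beta> = c2 / vK"
  define f where "f = (\<lambda>y. \<alpha> * sfun y + \<beta> * kfun y)"
  have f: "poly_growth f"
    unfolding f_def by (intro poly_growth_add poly_growth_mult poly_growth_const poly_growth_sfun poly_growth_kfun)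
  have f0: "E0 f = 0"
    unfolding f_def
    by (subst E0_add, intro poly_growth_mult poly_growth_const poly_growth_sfun,
        intro poly_growth_mult poly_growth_const poly_growth_kfun, simp add: E0_cmult E0_sfun E0_kfun)
  have fu: "E0 (\<lambda>y. f y * score y) = c1 * (- d1 * sqrt (V1 lam)) + c2 * (- d2 * sqrt (V2 lam))"
  proof -
    have "E0 (\<lambda>y. f y * score y) = E0 (\<lambda>y. \<alpha> * (sfun y * score y) + \<beta> * (kfun y * score y))"
      by (intro E0_cong) (simp add: f_def algebra_simps)
    also have "\<dots> = E0 (\<lambda>y. \<alpha> * (sfun y * score y)) + E0 (\<lambda>y. \<beta> * (kfun y * score y))"
      by (intro E0_add poly_growth_mult poly_growth_const poly_growth_sfun poly_growth_kfun poly_growth_score)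
    also have "\<dots> = \<alpha> * (- 2 * d1 * V_S lam) + \<beta> * (- (d2 / lam) * V_K lam)"
      unfolding E0_cmult E0_sfun_score E0_kfun_score ..
    also have "\<alpha> * (- 2 * d1 * V_S lam) = c1 * (- d1 * (2 * vS))"
      unfolding \<alpha>_def vS(2)[symmetric] using vS(1) by simp
    also have "\<beta> * (- (d2 / lam) * V_K lam) = c2 * (- d2 * (vK / lam))"
      unfolding \<beta>_def vK(2)[symmetric] using vK(1) by simp
    also have "2 * vS = sqrt (V1 lam)"
    proof -
      have "V1 lam = 2\<^sup>2 * V_S lam" by (simp add: V1_def V_S_def algebra_simps)
      then have "sqrt (V1 lam) = sqrt (2\<^sup>2) * sqrt (V_S lam)" by (simp only: real_sqrt_mult)
      then show ?thesis by (simp add: vS_def)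
    qed
    also have "vK / lam = sqrt (V2 lam)"
    proof -
      have "V2 lam = V_K lam / lam\<^sup>2" by (simp add: V2_def V_K_def power2_eq_square power3_eq_cube)
      then have "sqrt (V2 lam) = sqrt (V_K lam) / sqrt (lam\<^sup>2)" by (simp only: real_sqrt_divide)
      then show ?thesis using lam by (simp add: vK_def)
    qed
    finally show ?thesis .
  qed
  have f2: "E0 (\<lambda>y. (f y)\<^sup>2) = c1\<^sup>2 + c2\<^sup>2"
  proof -
    have "E0 (\<lambda>y. (f y)\<^sup>2) = E0 (\<lambda>y. (\<alpha>\<^sup>2 * (sfun y)\<^sup>2 + 2 * \<alpha> * \<beta> * (sfun y * kfun y)) + \<beta>\<^sup>2 * (kfun y)\<^sup>2)"
      by (intro E0_cong) (simp add: f_def power2_eq_square algebra_simps)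
    also have "\<dots> = E0 (\<lambda>y. \<alpha>\<^sup>2 * (sfun y)\<^sup>2 + 2 * \<alpha> * \<beta> * (sfun y * kfun y)) + E0 (\<lambda>y. \<beta>\<^sup>2 * (kfun y)\<^sup>2)"
      by (rule E0_add) (intro poly_growth_add poly_growth_mult poly_growth_const poly_growth_power poly_growth_sfun poly_growth_kfun)+
    also have "E0 (\<lambda>y. \<alpha>\<^sup>2 * (sfun y)\<^sup>2 + 2 * \<alpha> * \<beta> * (sfun y * kfun y)) = E0 (\<lambda>y. \<alpha>\<^sup>2 * (sfun y)\<^sup>2) + E0 (\<lambda>y. 2 * \<alpha> * \<beta> * (sfun y * kfun y))"
      by (rule E0_add) (intro poly_growth_add poly_growth_mult poly_growth_const poly_growth_power poly_growth_sfun poly_growth_kfun)+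
    also have "E0 (\<lambda>y. \<alpha>\<^sup>2 * (sfun y)\<^sup>2) + E0 (\<lambda>y. 2 * \<alpha> * \<beta> * (sfun y * kfun y)) + E0 (\<lambda>y. \<beta>\<^sup>2 * (kfun y)\<^sup>2) = \<alpha>\<^sup>2 * V_S lam + \<beta>\<^sup>2 * V_K lam"
      unfolding E0_cmult E0_sfun2 E0_kfun2 E0_sfun_kfun by simp
    also have "\<alpha>\<^sup>2 * V_S lam = c1\<^sup>2" unfolding \<alpha>_def vS(2)[symmetric] using vS(1) by (simp add: power2_eq_square)
    also have "\<beta>\<^sup>2 * V_K lam = c2\<^sup>2" unfolding \<beta>_def vK(2)[symmetric] using vK(1) by (simp add: power2_eq_square)
    finally show ?thesis .
  qed
  have clt: "(\<lambda>n. \<integral>\<omega>. iexp (Sn f n \<omega>) \<partial>M n) \<longlonglongrightarrow>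
      exp (\<i> * (c1 * (- d1 * sqrt (V1 lam)) + c2 * (- d2 * sqrt (V2 lam))) - (c1\<^sup>2 + c2\<^sup>2) / 2)"
    using Sn_clt[OF f f0] unfolding fu f2 by simp
  have sm: "small (\<lambda>n \<omega>. (c1 * (V_S lam powr (- 1 / 2) * R n \<omega>) + c2 * (V_K lam powr (- 1 / 2) * Q n \<omega>)) - Sn f n \<omega>)"
  proof (rule small_cong[OF small_add[OF small_cmult[OF S, of \<alpha>] small_cmult[OF K, of \<beta>]]])
    have "Sn f n \<omega> = \<alpha> * Sn sfun n \<omega> + \<beta> * Sn kfun n \<omega>" for n \<omega>
      unfolding f_def by (simp only: Sn_add Sn_cmult)
    then show "\<forall>\<^sub>F n in sequentially. \<forall>\<omega>\<in>space (M n). \<alpha> * (R n \<omega> - Sn sfun n \<omega>) + \<beta> * (Q n \<omega> - Sn kfun n \<omega>) =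
      (c1 * (V_S lam powr (- 1 / 2) * R n \<omega>) + c2 * (V_K lam powr (- 1 / 2) * Q n \<omega>)) - Sn f n \<omega>"
      unfolding pS pK by (intro always_eventually) (simp add: \<alpha>_def \<beta>_def algebra_simps)
  qed
  show ?thesis
  proof (rule small_integral_iexp[OF _ _ sm clt])
    show "\<forall>\<^sub>F n in sequentially. (\<lambda>\<omega>. c1 * (V_S lam powr (- 1 / 2) * R n \<omega>) + c2 * (V_K lam powr (- 1 / 2) * Q n \<omega>)) \<in> borel_measurable (M n)"
      using meas
    proof eventually_elim
      case (elim n)
      then have [measurable]: "R n \<in> borel_measurable (M n)" "Q n \<in> borel_measurable (M n)" by auto
      show ?case by measurable
    qed
    have fm: "f \<in> borel_measurable borel" using f by (rule poly_growth_measurable)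
    show "\<forall>\<^sub>F n in sequentially. Sn f n \<in> borel_measurable (M n)"
    proof -
      have "\<forall>\<^sub>F n in sequentially. \<forall>y. \<bar>f y\<bar> \<le> \<bar>f y\<bar>" by simp
      from Sn_second_moment[of "\<lambda>n. f", OF fm poly_growth_abs[OF f] this] show ?thesis
        by eventually_elim simp
    qed
  qed
qed

end

subsection \<open>From the data to the standardised array\<close>

text \<open>The estimated scale is \<open>sig\<close> times the \<open>lam\<close>-th root of
  \<open>B\<close>, so \<open>sig\<close> cancels in the standardised observations. In the second
  statistic the logarithm of that root factors out with total weight 1, because the powers of
  \<open>z\<close> average to \<open>B\<close>.\<close>

lemma stats_standardised:
  fixes x z :: "nat \<Rightarrow> real" and lam sig :: real
  assumes n: "n \<ge> 1" and lam: "lam \<ge> 1" and sig: "sig > 0"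
    and xz: "\<And>i. i \<in> {1..n} \<Longrightarrow> x i - mu_hat lam n x = sig * z i"
    and B: "B = (\<Sum>i=1..n. \<bar>z i\<bar> powr lam) / real n" "B > 0"
  shows "S_stat lam n x = (\<Sum>i=1..n. \<bar>z i\<bar> powr lam * sgn (z i)) / real n / B"
    and "K_stat lam n x = (\<Sum>i=1..n. \<bar>z i\<bar> powr lam * ln \<bar>z i\<bar>) / real n / B - ln B / lam"
proof -
  have "(\<Sum>i=1..n. \<bar>x i - mu_hat lam n x\<bar> powr lam) = (\<Sum>i=1..n. sig powr lam * \<bar>z i\<bar> powr lam)"
    using sig by (intro sum.cong refl) (simp add: xz abs_mult powr_mult)
  also have "\<dots> = sig powr lam * (B * real n)" using n by (simp add: B sum_distrib_left)
  finally have "sigma_hat lam n x = (sig powr lam * B) powr (1 / lam)"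
    using n by (simp add: sigma_hat_def)
  also have "\<dots> = sig * B powr (1 / lam)"
    using sig B(2) lam by (simp add: powr_mult powr_powr)
  finally have sh: "sigma_hat lam n x = sig * B powr (1 / lam)" .
  define b where "b = B powr (1 / lam)"
  have b: "b > 0" "b powr lam = B" "ln b = ln B / lam"
    using B(2) lam by (auto simp: b_def powr_powr ln_powr)
  have Yh: "Y_hat lam n x i = z i / b" if "i \<in> {1..n}" for i
    using sig by (simp add: Y_hat_def xz[OF that] sh b_def)
  have pw: "\<bar>Y_hat lam n x i\<bar> powr lam = \<bar>z i\<bar> powr lam / B" if "i \<in> {1..n}" for i
    using b by (simp add: Yh[OF that] abs_divide powr_divide)
  have "(\<Sum>i=1..n. \<bar>Y_hat lam n x i\<bar> powr lam * sgn (Y_hat lam n x i)) = (\<Sum>i=1..n. \<bar>z i\<bar> powr lam * sgn (z i) / B)"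
    using b(1) by (intro sum.cong refl) (simp add: pw, simp add: Yh sgn_divide)
  then show "S_stat lam n x = (\<Sum>i=1..n. \<bar>z i\<bar> powr lam * sgn (z i)) / real n / B"
    by (simp add: S_stat_def sum_divide_distrib[symmetric])
  have "(\<Sum>i=1..n. \<bar>Y_hat lam n x i\<bar> powr lam * ln \<bar>Y_hat lam n x i\<bar>) =
      (\<Sum>i=1..n. \<bar>z i\<bar> powr lam * ln \<bar>z i\<bar> / B - \<bar>z i\<bar> powr lam * (ln B / lam / B))"
  proof (intro sum.cong refl)
    fix i assume i: "i \<in> {1..n}"
    show "\<bar>Y_hat lam n x i\<bar> powr lam * ln \<bar>Y_hat lam n x i\<bar> = \<bar>z i\<bar> powr lam * ln \<bar>z i\<bar> / B - \<bar>z i\<bar> powr lam * (ln B / lam / B)"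
    \<comment> \<open>The logarithm of the quotient splits only for nonzero \<open>z i\<close>; at 0
      the power makes both sides vanish.\<close>
    proof (cases "z i = 0")
      case False
      then have "ln \<bar>Y_hat lam n x i\<bar> = ln \<bar>z i\<bar> - ln B / lam"
        using b by (simp add: Yh[OF i] abs_divide ln_div)
      then show ?thesis unfolding pw[OF i] by (simp add: right_diff_distrib diff_divide_distrib)
    qed (simp add: pw[OF i])
  qed
  also have "\<dots> = (\<Sum>i=1..n. \<bar>z i\<bar> powr lam * ln \<bar>z i\<bar>) / B - (\<Sum>i=1..n. \<bar>z i\<bar> powr lam) * (ln B / lam / B)"
    by (simp only: sum_subtractf sum_divide_distrib[symmetric] sum_distrib_right[symmetric])
  also have "(\<Sum>i=1..n. \<bar>z i\<bar> powr lam) = B * real n" using n by (simp add: B(1))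
  finally show "K_stat lam n x = (\<Sum>i=1..n. \<bar>z i\<bar> powr lam * ln \<bar>z i\<bar>) / real n / B - ln B / lam"
    using n B(2) by (simp add: K_stat_def diff_divide_distrib)
qed

lemma borel_measurable_S_stat_K_stat:
  fixes X :: "nat \<Rightarrow> 'a \<Rightarrow> real"
  assumes X: "\<And>i. i \<in> {1..n} \<Longrightarrow> X i \<in> borel_measurable M" and n: "n \<ge> 1" and lam: "lam \<ge> 1"
  shows "(\<lambda>\<omega>. S_stat lam n (\<lambda>i. X i \<omega>)) \<in> borel_measurable M"
    and "(\<lambda>\<omega>. K_stat lam n (\<lambda>i. X i \<omega>)) \<in> borel_measurable M"
proof -
  note [measurable] = X borel_measurable_mu_hat[OF X n lam]
  have sg [measurable]: "(\<lambda>\<omega>. sigma_hat lam n (\<lambda>i. X i \<omega>)) \<in> borel_measurable M"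
    unfolding sigma_hat_def by measurable
  have [measurable]: "(\<lambda>\<omega>. Y_hat lam n (\<lambda>i. X i \<omega>) i) \<in> borel_measurable M" if "i \<in> {1..n}" for i
    unfolding Y_hat_def using that by measurable
  show "(\<lambda>\<omega>. S_stat lam n (\<lambda>i. X i \<omega>)) \<in> borel_measurable M"
    unfolding S_stat_def by measurable
  show "(\<lambda>\<omega>. K_stat lam n (\<lambda>i. X i \<omega>)) \<in> borel_measurable M"
    unfolding K_stat_def by measurable
qed

context power_kernel
begin

text \<open>For y < 0 the quotient of \<open>apd_delta\<close> and \<open>apd_A\<close> is 2 / (1 +
  r) with r the odds raised to the power \<open>t2\<close>; for y > 0 the odds are inverted. Both
  are logistic in t2 times the log-odds, which is the form of \<open>kap\<close>. All factors free
  of \<open>y\<close> go into \<open>C\<close>.\<close>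

lemma apd_density_q:
  assumes t: "0 < t1" "t1 < 1" and e: "ell n = ln (t1 / (1 - t1))" "th n = t2" and sig: "sig > 0"
  shows "\<exists>C. \<forall>y. sig * apd_density lam t1 t2 mu sig (mu + sig * y) = C * q n y"
proof (intro exI allI)
  fix y
  have p: "t1 powr t2 > 0" "(1 - t1) powr t2 > 0" using t by auto
  have r: "exp (th n * ell n) = t1 powr t2 / (1 - t1) powr t2"
  proof -
    have "exp (th n * ell n) = (t1 / (1 - t1)) powr t2" using t by (simp add: e powr_def)
    also have "\<dots> = t1 powr t2 / (1 - t1) powr t2" by (rule powr_divide)
    finally show ?thesis .
  qed
  have alg: "2 / (1 + A / B) = 2 * A * B / (A + B) / A" if "A > 0" "B > 0" for A B :: real
  proof -
    have "1 + A / B = (A + B) / B" using that by (simp add: field_simps)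
    then show ?thesis using that by simp
  qed
  have k: "apd_delta t1 t2 / apd_A t1 t2 y * \<bar>y\<bar> powr t2 = kap n y * \<bar>y\<bar> powr th n"
  proof -
    consider "y < 0" | "y = 0" | "y > 0" by linarith
    then show ?thesis
    proof cases
      case 1
      then have "kap n y = 2 / (1 + t1 powr t2 / (1 - t1) powr t2)" by (simp add: kap_def r)
      also have "\<dots> = apd_delta t1 t2 / apd_A t1 t2 y"
        using alg[OF p] 1 by (simp add: apd_delta_def apd_A_def)
      finally show ?thesis by (simp add: e)
    next
      case 3
      then have "kap n y = 2 / (1 + inverse (t1 powr t2 / (1 - t1) powr t2))" by (simp add: kap_def r exp_minus)
      also have "\<dots> = apd_delta t1 t2 / apd_A t1 t2 y"
        using alg[OF p(2,1)] 3 by (simp add: apd_delta_def apd_A_def add.commute mult_ac)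
      finally show ?thesis by (simp add: e)
    qed simp
  qed
  have y: "(mu + sig * y - mu) / sig = y" using sig by simp
  have k2: "- (1 / lam) * (apd_delta t1 t2 / apd_A t1 t2 y) * \<bar>y\<bar> powr t2 = - (kap n y * \<bar>y\<bar> powr th n / lam)"
    by (simp only: mult.assoc k) simp
  show "sig * apd_density lam t1 t2 mu sig (mu + sig * y) =
      (sig * ((apd_delta t1 t2 / lam) powr (1 / t2) / (sig * Gamma (1 + 1 / t2)))) * q n y"
    unfolding apd_density_def Let_def q_def y k2 by (simp only: mult.assoc)
qed

lemma distributed_standardised:
  assumes t: "0 < t1" "t1 < 1" "0 < t2" and e: "ell n = ln (t1 / (1 - t1))" "th n = t2" and sig: "sig > 0"
    and N: "prob_space N" and D: "distributed N lborel X (\<lambda>x. ennreal (apd_density lam t1 t2 mu sig x))"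
  shows "distributed N lborel (\<lambda>\<omega>. (X \<omega> - mu) / sig) (\<lambda>y. ennreal (q n y / (\<integral>y. q n y \<partial>lborel)))"
proof -
  interpret prob_space N by fact
  obtain C where C: "\<And>y. sig * apd_density lam t1 t2 mu sig (mu + sig * y) = C * q n y"
    using apd_density_q[OF t(1,2) e sig] by blast
  have nn: "apd_density lam t1 t2 mu sig x \<ge> 0" for x
  proof -
    have "1 + 1 / t2 > 0" using t(3) by (simp add: add_pos_pos)
    then show ?thesis using sig by (auto simp: apd_density_def Let_def Gamma_real_pos less_imp_le)
  qed
  have "distributed N lborel (\<lambda>\<omega>. (- mu / sig) + (1 / sig) * X \<omega>) 
      (\<lambda>y. ennreal (apd_density lam t1 t2 mu sig ((y - (- mu / sig)) / (1 / sig))) / ennreal \<bar>1 / sig\<bar>)"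
    using sig by (intro distributed_affine[OF D]) auto
  also have "(\<lambda>\<omega>. (- mu / sig) + (1 / sig) * X \<omega>) = (\<lambda>\<omega>. (X \<omega> - mu) / sig)"
    by (simp add: fun_eq_iff diff_divide_distrib)
  also have "(\<lambda>y. ennreal (apd_density lam t1 t2 mu sig ((y - (- mu / sig)) / (1 / sig))) / ennreal \<bar>1 / sig\<bar>) = (\<lambda>y. ennreal (C * q n y))"
  proof
    fix y
    have "(y - (- mu / sig)) / (1 / sig) = mu + sig * y" using sig by (simp add: field_simps)
    then show "ennreal (apd_density lam t1 t2 mu sig ((y - (- mu / sig)) / (1 / sig))) / ennreal \<bar>1 / sig\<bar> = ennreal (C * q n y)"
      using sig nn by (simp add: divide_ennreal C[symmetric] mult.commute)
  qed
  finally have D': "distributed N lborel (\<lambda>\<omega>. (X \<omega> - mu) / sig) (\<lambda>y. ennreal (C * q n y))" .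
  have Cq: "C * q n y \<ge> 0" for y using C[of y] nn sig by (metis mult_nonneg_nonneg less_imp_le)
  \<comment> \<open>The constant is not computed but forced by total mass 1.\<close>
  have "(\<integral>y. C * q n y * 1 \<partial>lborel) = (\<integral>\<omega>. 1 \<partial>N)"
    by (rule distributed_integral[OF D']) (use Cq in auto)
  then have "C * (\<integral>y. q n y \<partial>lborel) = 1" by (simp add: prob_space)
  then have "C = 1 / (\<integral>y. q n y \<partial>lborel)" by (metis mult_zero_right nonzero_eq_divide_eq zero_neq_one)
  with D' show ?thesis by (simp add: divide_inverse mult.commute)
qed

end

text \<open>Standardising multiplies the estimating function by a positive factor only, so sign
  conditions pass from the data to the standardised observations.\<close>

lemma Sn_psi_shift_sign:
  fixes x :: "nat \<Rightarrow> real"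
  assumes "sig > 0" "n \<ge> 1"
  shows "(\<Sum>i=1..n. \<bar>(x i - mu) / sig - s\<bar> powr a * sgn ((x i - mu) / sig - s)) =
     (\<Sum>i=1..n. \<bar>x i - (mu + sig * s)\<bar> powr a * sgn (x i - (mu + sig * s))) / sig powr a"
  unfolding sum_divide_distrib
proof (intro sum.cong refl)
  fix i
  have e: "(x i - mu) / sig - s = (x i - (mu + sig * s)) / sig" using assms by (simp add: field_simps)
  show "\<bar>(x i - mu) / sig - s\<bar> powr a * sgn ((x i - mu) / sig - s) =
      \<bar>x i - (mu + sig * s)\<bar> powr a * sgn (x i - (mu + sig * s)) / sig powr a"
    unfolding e using assms by (simp add: abs_divide powr_divide sgn_divide)
qed

section \<open>Limit laws of the standardised statistics under local alternatives\<close>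

theorem theorem3p10:
  fixes lam mu sig d1 d2 :: real
    and t1 t2 r1 r2 :: "nat \<Rightarrow> real"
    and M :: "nat \<Rightarrow> 'a measure"
    and X :: "nat \<Rightarrow> nat \<Rightarrow> 'a \<Rightarrow> real"
  assumes "lam \<ge> 1" and "sig > 0"
    and "r1 \<longlonglongrightarrow> 0" and "r2 \<longlonglongrightarrow> 0"
    and "\<And>n. n \<ge> 1 \<Longrightarrow> t1 n = 1 / 2 + d1 / sqrt (real n) * (1 + r1 n)"
    and "\<And>n. n \<ge> 1 \<Longrightarrow> t2 n = lam + d2 / sqrt (real n) * (1 + r2 n)"
    and "\<And>n. n \<ge> 1 \<Longrightarrow> 0 < t1 n \<Longrightarrow> t1 n < 1 \<Longrightarrow> 0 < t2 n \<Longrightarrow>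
           apd_sample (M n) n (X n) lam (t1 n) (t2 n) mu sig"
  shows "weak_conv_vec
           (\<lambda>n. distr (M n) borel
              (\<lambda>\<omega>. vector [Z_S lam n (\<lambda>i. X n i \<omega>), Z_K lam n (\<lambda>i. X n i \<omega>)] :: real ^ 2))
           (mv_normal (vector [- d1 * sqrt (V1 lam), - d2 * sqrt (V2 lam)]) (mat 1))
       \<and> weak_conv_m
           (\<lambda>n. distr (M n) borel
              (\<lambda>\<omega>. (Z_S lam n (\<lambda>i. X n i \<omega>))\<^sup>2 + (Z_K lam n (\<lambda>i. X n i \<omega>))\<^sup>2))
           (noncentral_chisq2 (d1\<^sup>2 * V1 lam + d2\<^sup>2 * V2 lam))"
proof -
  note lam = assms(1) and sig = assms(2)
  define ell where "ell = (\<lambda>n. ln (t1 n / (1 - t1 n)))"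
  define Y where "Y = (\<lambda>n i \<omega>. (X n i \<omega> - mu) / sig)"
  define \<tau> where "\<tau> = (\<lambda>n \<omega>. sqrt (real n) * ((mu_hat lam n (\<lambda>i. X n i \<omega>) - mu) / sig))"

  have st2: "(\<lambda>n. sqrt (real n) * (t2 n - lam)) \<longlonglongrightarrow> d2"
  proof -
    have "(\<lambda>n. d2 * (1 + r2 n)) \<longlonglongrightarrow> d2 * (1 + 0)" by (intro tendsto_intros assms(4))
    moreover have "\<forall>\<^sub>F n in sequentially. d2 * (1 + r2 n) = sqrt (real n) * (t2 n - lam)"
      using eventually_ge_at_top[of 1] by eventually_elim (simp add: assms(6))
    ultimately show ?thesis using Lim_transform_eventually by fastforce
  qed
  have st1: "(\<lambda>n. sqrt (real n) * (t1 n - 1 / 2)) \<longlonglongrightarrow> d1"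
  proof -
    have "(\<lambda>n. d1 * (1 + r1 n)) \<longlonglongrightarrow> d1 * (1 + 0)" by (intro tendsto_intros assms(3))
    moreover have "\<forall>\<^sub>F n in sequentially. d1 * (1 + r1 n) = sqrt (real n) * (t1 n - 1 / 2)"
      using eventually_ge_at_top[of 1] by eventually_elim (simp add: assms(5))
    ultimately show ?thesis using Lim_transform_eventually by fastforce
  qed
  \<comment> \<open>The derivative 1 / t + 1 / (1 - t) of the log-odds takes the value 4 at 1 /
    2.\<close>
  have dl: "((\<lambda>t. ln (t / (1 - t))) has_real_derivative 4) (at (1 / 2))"
    by (auto intro!: derivative_eq_intros)
  have sell: "(\<lambda>n. sqrt (real n) * ell n) \<longlonglongrightarrow> 4 * d1"
    using delta_method(2)[OF dl filterlim_sqrt_nat st1] by (simp add: ell_def)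
  have t1lim: "t1 \<longlonglongrightarrow> 1 / 2" by (rule delta_method(1)[OF dl filterlim_sqrt_nat st1])

  interpret P: power_kernel lam d1 d2 t2 ell
    by unfold_locales (fact lam st2 sell)+

  have good: "\<forall>\<^sub>F n in sequentially. n \<ge> 1 \<and> 0 < t1 n \<and> t1 n < 1 \<and> 0 < t2 n"
    using eventually_ge_at_top[of 1] order_tendstoD(1)[OF t1lim, of 0] order_tendstoD(2)[OF t1lim, of 1]
      order_tendstoD(1)[OF P.th_tendsto, of 0] lam
    by (auto simp: eventually_conj_iff)
  have sample: "\<forall>\<^sub>F n in sequentially. n \<ge> 1 \<and> 0 < t1 n \<and> t1 n < 1 \<and> 0 < t2 n \<and> apd_sample (M n) n (X n) lam (t1 n) (t2 n) mu sig"
    using good by eventually_elim (use assms(7) in blast)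

  interpret A: iid_array lam d1 d2 t2 ell M Y
  proof unfold_locales
    show "\<forall>\<^sub>F n in sequentially. prob_space (M n)"
      using sample by eventually_elim (simp add: apd_sample_def)
    show "\<forall>\<^sub>F n in sequentially. prob_space.indep_vars (M n) (\<lambda>_. borel) (Y n) {1..n}"
      using sample
    proof eventually_elim
      case (elim n)
      then interpret prob_space "M n" by (simp add: apd_sample_def)
      have "indep_vars (\<lambda>_. borel) (X n) {1..n}" using elim by (simp add: apd_sample_def)
      then show ?case unfolding Y_def
        by (rule indep_vars_compose2[where Y="\<lambda>i x. (x - mu) / sig"]) auto
    qed
    show "\<forall>\<^sub>F n in sequentially. \<forall>i\<in>{1..n}. distributed (M n) lborel (Y n i) (\<lambda>y. ennreal (P.q n y / (\<integral>y. P.q n y \<partial>lborel)))"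
      using sample
    proof eventually_elim
      case (elim n)
      show ?case
      proof
        fix i assume "i \<in> {1..n}"
        then have "distributed (M n) lborel (X n i) (\<lambda>x. ennreal (apd_density lam (t1 n) (t2 n) mu sig x))" "prob_space (M n)"
          using elim by (auto simp: apd_sample_def)
        then show "distributed (M n) lborel (Y n i) (\<lambda>y. ennreal (P.q n y / (\<integral>y. P.q n y \<partial>lborel)))"
          unfolding Y_def using elim sig by (intro P.distributed_standardised[of "t1 n" "t2 n"]) (auto simp: ell_def)
      qed
    qed
  qed

  have sn_sign: "A.Sn (\<lambda>y. P.psi (y - t / sqrt (real n))) n \<omega> =
      loc_score lam n (\<lambda>i. X n i \<omega>) (mu + sig * (t / sqrt (real n))) / (sig powr (lam - 1) * sqrt (real n))" if "n \<ge> 1" for n t \<omega>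
    unfolding A.Sn_def P.psi_def loc_score_def unfolding Y_def
    using Sn_psi_shift_sign[OF sig that, of "\<lambda>i. X n i \<omega>" mu "t / sqrt (real n)" "lam - 1"] by simp
  have loc: "(t < \<tau> n \<omega> \<longleftrightarrow> mu + sig * (t / sqrt (real n)) < mu_hat lam n (\<lambda>i. X n i \<omega>)) \<and>
      (t > \<tau> n \<omega> \<longleftrightarrow> mu + sig * (t / sqrt (real n)) > mu_hat lam n (\<lambda>i. X n i \<omega>))" if "n \<ge> 1" for n t \<omega>
  proof -
    have "sqrt (real n) > 0" using that by simp
    then show ?thesis using sig by (auto simp: \<tau>_def field_simps)
  qed
  interpret L: location_array lam d1 d2 t2 ell M Y \<tau>
  proof unfold_locales
    fix n t \<omega> assume n: "(1::nat) \<le> n"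
    show "0 \<le> A.Sn (\<lambda>y. P.psi (y - t / sqrt (real n))) n \<omega>" if "t < \<tau> n \<omega>"
      unfolding sn_sign[OF n] using loc[OF n] that loc_score_mu_hat(1)[OF lam n] by (intro divide_nonneg_nonneg) auto
    show "A.Sn (\<lambda>y. P.psi (y - t / sqrt (real n))) n \<omega> \<le> 0" if "\<tau> n \<omega> < t"
      unfolding sn_sign[OF n] using loc[OF n] that loc_score_mu_hat(2)[OF lam n] by (intro divide_nonpos_nonneg) auto
  qed

  \<comment> \<open>Exact identities on the event that \<open>Bn\<close> is positive, whose
    probability tends to 1; off this event, for instance when all observations coincide, nothing is
    claimed.\<close>
  have stats: "sqrt (real n) * S_stat lam n (\<lambda>i. X n i \<omega>) = L.Nn P.gfun n \<omega> / L.Bn n \<omega> \<and>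
      K_stat lam n (\<lambda>i. X n i \<omega>) = (E_K lam + L.Nn (\<lambda>y. P.hfun y - E_K lam) n \<omega> / sqrt (real n)) / L.Bn n \<omega> - ln (L.Bn n \<omega>) / lam"
    if n: "n \<ge> 1" and B: "L.Bn n \<omega> > 0" for n \<omega>
  proof -
    have sn: "sqrt (real n) > 0" "sqrt (real n) * sqrt (real n) = real n" "real n > 0" using n by auto
    define z where "z = (\<lambda>i. Y n i \<omega> - \<tau> n \<omega> / sqrt (real n))"
    have xz: "X n i \<omega> - mu_hat lam n (\<lambda>i. X n i \<omega>) = sig * z i" for i
    proof -
      have "\<tau> n \<omega> / sqrt (real n) = (mu_hat lam n (\<lambda>i. X n i \<omega>) - mu) / sig" using sn by (simp add: \<tau>_def)
      then have "z i = (X n i \<omega> - mu_hat lam n (\<lambda>i. X n i \<omega>)) / sig"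
        by (simp add: z_def Y_def diff_divide_distrib)
      then show ?thesis using sig by simp
    qed
    have Nn: "L.Nn f n \<omega> = (\<Sum>i=1..n. f (z i)) / sqrt (real n)" for f
      by (simp add: L.Nn_def A.Sn_def z_def)
    have Nn': "L.Nn f n \<omega> / sqrt (real n) = (\<Sum>i=1..n. f (z i)) / real n" for f
      unfolding Nn divide_divide_eq_left sn(2) ..
    have Beq: "L.Bn n \<omega> = (\<Sum>i=1..n. \<bar>z i\<bar> powr lam) / real n"
    proof -
      have "A.Pfun y = \<bar>y\<bar> powr lam - 1" for y using lam by (simp add: A.Pfun_def A.T_def)
      then show ?thesis unfolding L.Bn_def Nn' using sn by (simp add: sum_subtractf diff_divide_distrib)
    qed
    note st = stats_standardised[OF n lam sig xz Beq B]
    have "sqrt (real n) * S_stat lam n (\<lambda>i. X n i \<omega>) = sqrt (real n) * ((\<Sum>i=1..n. P.gfun (z i)) / real n / L.Bn n \<omega>)"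
      unfolding st(1) by (simp add: P.gfun_def)
    also have "\<dots> = L.Nn P.gfun n \<omega> / L.Bn n \<omega>"
    proof -
      have "s * (x / (s * s) / b) = x / s / b" if "s > 0" for s x b :: real using that by simp
      from this[OF sn(1)] show ?thesis unfolding sn(2) Nn .
    qed
    finally have 1: "sqrt (real n) * S_stat lam n (\<lambda>i. X n i \<omega>) = L.Nn P.gfun n \<omega> / L.Bn n \<omega>" .
    have "E_K lam + L.Nn (\<lambda>y. P.hfun y - E_K lam) n \<omega> / sqrt (real n) = (\<Sum>i=1..n. P.hfun (z i)) / real n"
      unfolding Nn' using sn by (simp add: sum_subtractf diff_divide_distrib)
    then have 2: "K_stat lam n (\<lambda>i. X n i \<omega>) = (E_K lam + L.Nn (\<lambda>y. P.hfun y - E_K lam) n \<omega> / sqrt (real n)) / L.Bn n \<omega> - ln (L.Bn n \<omega>) / lam"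
      unfolding st(2) by (simp add: P.hfun_def)
    from 1 2 show ?thesis by blast
  qed
  define R where "R = (\<lambda>n \<omega>. sqrt (real n) * S_stat lam n (\<lambda>i. X n i \<omega>))"
  define Q where "Q = (\<lambda>n \<omega>. sqrt (real n) * (K_stat lam n (\<lambda>i. X n i \<omega>) - E_K lam))"
  have R: "A.small (\<lambda>n \<omega>. R n \<omega> - A.Sn A.sfun n \<omega>)"
  proof (rule A.small_whp_cong[OF L.S_expansion A.whp_mono[OF L.whp_Bn_pos]])
    show "\<forall>\<^sub>F n in sequentially. \<forall>\<omega>\<in>space (M n). 0 < L.Bn n \<omega> \<longrightarrow> R n \<omega> - A.Sn A.sfun n \<omega> = L.Nn P.gfun n \<omega> / L.Bn n \<omega> - A.Sn A.sfun n \<omega>"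
      using eventually_ge_at_top[of 1] by eventually_elim (use stats in \<open>simp add: R_def\<close>)
  qed
  have Q: "A.small (\<lambda>n \<omega>. Q n \<omega> - A.Sn A.kfun n \<omega>)"
  proof (rule A.small_whp_cong[OF L.K_expansion A.whp_mono[OF L.whp_Bn_pos]])
    show "\<forall>\<^sub>F n in sequentially. \<forall>\<omega>\<in>space (M n). 0 < L.Bn n \<omega> \<longrightarrow> Q n \<omega> - A.Sn A.kfun n \<omega> =
       sqrt (real n) * ((E_K lam + L.Nn (\<lambda>y. P.hfun y - E_K lam) n \<omega> / sqrt (real n)) / L.Bn n \<omega> - ln (L.Bn n \<omega>) / lam - E_K lam) - A.Sn A.kfun n \<omega>"
      using eventually_ge_at_top[of 1] by eventually_elim (use stats in \<open>simp add: Q_def\<close>)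
  qed
  have meas: "\<forall>\<^sub>F n in sequentially. R n \<in> borel_measurable (M n) \<and> Q n \<in> borel_measurable (M n)"
    using sample
  proof eventually_elim
    case (elim n)
    have X: "X n i \<in> borel_measurable (M n)" if "i \<in> {1..n}" for i
    proof -
      have "distributed (M n) lborel (X n i) (\<lambda>x. ennreal (apd_density lam (t1 n) (t2 n) mu sig x))"
        using elim that by (auto simp: apd_sample_def)
      from distributed_measurable[OF this] show ?thesis by simp
    qed
    have n: "n \<ge> 1" using elim by simp
    note [measurable] = borel_measurable_S_stat_K_stat[OF X n lam]
    show ?case unfolding R_def Q_def by (intro conjI) measurable
  qed

  define W where "W = (\<lambda>n \<omega>. vector [Z_S lam n (\<lambda>i. X n i \<omega>), Z_K lam n (\<lambda>i. X n i \<omega>)] :: real ^ 2)"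
  define m where "m = (vector [- d1 * sqrt (V1 lam), - d2 * sqrt (V2 lam)] :: real ^ 2)"
  have W: "W n \<omega> $ 1 = V_S lam powr (- 1 / 2) * R n \<omega>" "W n \<omega> $ 2 = V_K lam powr (- 1 / 2) * Q n \<omega>" for n \<omega>
    by (simp_all add: W_def R_def Q_def Z_S_def Z_K_def)
  have inner2: "a \<bullet> x = a $ 1 * x $ 1 + a $ 2 * x $ 2" for a x :: "real ^ 2"
    by (simp add: inner_vec_def UNIV_2)
  have Wm: "\<forall>\<^sub>F n in sequentially. W n \<in> borel_measurable (M n)"
    using meas
  proof eventually_elim
    case (elim n)
    have [measurable]: "R n \<in> borel_measurable (M n)" "Q n \<in> borel_measurable (M n)" using elim by auto
    have "(\<lambda>\<omega>. W n \<omega> \<bullet> axis i 1) \<in> borel_measurable (M n)" for i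
      using exhaust_2[of i] by (auto simp: W inner_axis)
    then show ?case by (subst borel_measurable_euclidean_space) (auto simp: Basis_vec_def)
  qed
  \<comment> \<open>The criteria for weak convergence ask for probability laws at every index, so
    the sequence is started at \<open>N\<close> and the shift is undone afterwards.\<close>
  obtain N where N: "\<And>n. n \<ge> N \<Longrightarrow> prob_space (M n) \<and> W n \<in> borel_measurable (M n)"
    using eventually_conj[OF A.ev_prob Wm] by (auto simp: eventually_sequentially)
  have shifted: "weak_conv_vec (\<lambda>n. distr (M (n + N)) borel (W (n + N))) (mv_normal m (mat 1))"
  proof (rule weak_conv_vec_charI)
    show "prob_space (distr (M (n + N)) borel (W (n + N)))" for n
      using N[of "n + N"] by (intro prob_space.prob_space_distr) auto
    fix a :: "real ^ 2"
    have e: "(\<integral>x. iexp (a \<bullet> x) \<partial>distr (M (n + N)) borel (W (n + N))) =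
       (\<integral>\<omega>. iexp (a $ 1 * (V_S lam powr (- 1 / 2) * R (n + N) \<omega>) + a $ 2 * (V_K lam powr (- 1 / 2) * Q (n + N) \<omega>)) \<partial>M (n + N))" for n
    proof -
      have im: "(\<lambda>x::real^2. iexp (a \<bullet> x)) \<in> borel_measurable borel" by measurable
      have "(\<integral>x. iexp (a \<bullet> x) \<partial>distr (M (n + N)) borel (W (n + N))) = (\<integral>\<omega>. iexp (a \<bullet> W (n + N) \<omega>) \<partial>M (n + N))"
        by (rule integral_distr[OF conjunct2[OF N[OF le_add2]] im])
      then show ?thesis unfolding inner2 W .
    qed
    have "(\<lambda>n. \<integral>\<omega>. iexp (a $ 1 * (V_S lam powr (- 1 / 2) * R n \<omega>) + a $ 2 * (V_K lam powr (- 1 / 2) * Q n \<omega>)) \<partial>M n) \<longlonglongrightarrow>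
       exp (\<i> * (a $ 1 * (- d1 * sqrt (V1 lam)) + a $ 2 * (- d2 * sqrt (V2 lam))) - ((a $ 1)\<^sup>2 + (a $ 2)\<^sup>2) / 2)"
      by (rule L.joint_char[OF R Q meas])
    also have "exp (\<i> * (a $ 1 * (- d1 * sqrt (V1 lam)) + a $ 2 * (- d2 * sqrt (V2 lam))) - ((a $ 1)\<^sup>2 + (a $ 2)\<^sup>2) / 2) =
        exp (\<i> * (a \<bullet> m) - (a \<bullet> a) / 2)"
      by (simp add: inner2 m_def power2_eq_square)
    also have "\<dots> = (\<integral>x. iexp (a \<bullet> x) \<partial>mv_normal m (mat 1))"
      by (rule integral_mv_normal_iexp(2)[symmetric])
    finally have "(\<lambda>n. \<integral>\<omega>. iexp (a $ 1 * (V_S lam powr (- 1 / 2) * R n \<omega>) + a $ 2 * (V_K lam powr (- 1 / 2) * Q n \<omega>)) \<partial>M n) \<longlonglongrightarrow>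
       (\<integral>x. iexp (a \<bullet> x) \<partial>mv_normal m (mat 1))" .
    from LIMSEQ_ignore_initial_segment[OF this, of N]
    show "(\<lambda>n. \<integral>x. iexp (a \<bullet> x) \<partial>distr (M (n + N)) borel (W (n + N))) \<longlonglongrightarrow> (\<integral>x. iexp (a \<bullet> x) \<partial>mv_normal m (mat 1))"
      unfolding e .
  qed (auto simp: prob_space_mv_normal sets_mv_normal)
  have vec: "weak_conv_vec (\<lambda>n. distr (M n) borel (W n)) (mv_normal m (mat 1))"
    unfolding weak_conv_vec_def
  proof (intro allI impI)
    fix f :: "real ^ 2 \<Rightarrow> real" assume "continuous_on UNIV f" "bounded (range f)"
    then have "(\<lambda>n. \<integral>x. f x \<partial>distr (M (n + N)) borel (W (n + N))) \<longlonglongrightarrow> (\<integral>x. f x \<partial>mv_normal m (mat 1))"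
      using shifted unfolding weak_conv_vec_def by blast
    then show "(\<lambda>n. \<integral>x. f x \<partial>distr (M n) borel (W n)) \<longlonglongrightarrow> (\<integral>x. f x \<partial>mv_normal m (mat 1))"
      by (rule LIMSEQ_offset)
  qed

  have "V1 lam = 4 * V_S lam" by (simp add: V1_def V_S_def)
  then have V1: "V1 lam \<ge> 0" using A.V_S_pos by simp
  have "V2 lam = V_K lam / lam\<^sup>2" by (simp add: V2_def V_K_def power2_eq_square power3_eq_cube)
  then have V2: "V2 lam \<ge> 0" using A.V_K_pos by simp
  have nm: "(norm m)\<^sup>2 = d1\<^sup>2 * V1 lam + d2\<^sup>2 * V2 lam"
    unfolding power2_norm_eq_inner inner2 using V1 V2 by (simp add: m_def power2_eq_square mult_ac)
  \<comment> \<open>The mean \<open>m\<close> is not the one fixed in the definition of the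
    noncentral law; rotation invariance makes only its norm relevant.\<close>
  have chi: "noncentral_chisq2 (d1\<^sup>2 * V1 lam + d2\<^sup>2 * V2 lam) = distr (mv_normal m (mat 1)) borel (\<lambda>x. (norm x)\<^sup>2)"
    using distr_norm_squared_mv_normal[of m] by (simp add: nm)
  have nW: "(Z_S lam n (\<lambda>i. X n i \<omega>))\<^sup>2 + (Z_K lam n (\<lambda>i. X n i \<omega>))\<^sup>2 = (norm (W n \<omega>))\<^sup>2" for n \<omega>
    unfolding power2_norm_eq_inner inner2 by (simp add: W_def power2_eq_square)
  have meas_norm [measurable]: "(\<lambda>x::real^2. (norm x)\<^sup>2) \<in> borel_measurable borel" by measurable
  have mv_meas: "(\<lambda>x::real^2. (norm x)\<^sup>2) \<in> borel_measurable (mv_normal m (mat 1))"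
    unfolding measurable_cong_sets[OF sets_mv_normal refl] by (rule meas_norm)
  have nWm: "(\<lambda>\<omega>. (norm (W n \<omega>))\<^sup>2) \<in> borel_measurable (M n)" if "n \<ge> N" for n
    using measurable_compose[OF conjunct2[OF N[OF that]] meas_norm] .
  \<comment> \<open>Continuous mapping: a bounded continuous function of the squared norm is a
    bounded continuous function on the plane.\<close>
  have "weak_conv_m (\<lambda>n. distr (M (n + N)) borel (\<lambda>\<omega>. (norm (W (n + N) \<omega>))\<^sup>2)) (distr (mv_normal m (mat 1)) borel (\<lambda>x. (norm x)\<^sup>2))"
  proof (rule integral_bdd_continuous_conv_imp_weak_conv)
    show "real_distribution (distr (M (n + N)) borel (\<lambda>\<omega>. (norm (W (n + N) \<omega>))\<^sup>2))" for n
      using N[of "n + N"] nWm[of "n + N"] by (intro prob_space.real_distribution_distr) auto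
    show "real_distribution (distr (mv_normal m (mat 1)) borel (\<lambda>x. (norm x)\<^sup>2))"
      by (rule prob_space.real_distribution_distr[OF prob_space_mv_normal mv_meas])
    fix f :: "real \<Rightarrow> real" assume c: "\<And>x. isCont f x" and b: "\<And>x. \<bar>f x\<bar> \<le> 1"
    have fm: "f \<in> borel_measurable borel"
      using c by (intro borel_measurable_continuous_onI continuous_at_imp_continuous_on) auto
    have fc: "continuous_on UNIV (\<lambda>x::real^2. f ((norm x)\<^sup>2))"
      using continuous_on_compose2[OF continuous_at_imp_continuous_on[of UNIV f], of UNIV "\<lambda>x::real^2. (norm x)\<^sup>2"] c
      by (auto intro!: continuous_intros)
    have "bounded (range (\<lambda>x::real^2. f ((norm x)\<^sup>2)))" using b by (auto simp: bounded_iff)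
    with shifted fc have L: "(\<lambda>n. \<integral>x. f ((norm x)\<^sup>2) \<partial>distr (M (n + N)) borel (W (n + N))) \<longlonglongrightarrow> (\<integral>x. f ((norm x)\<^sup>2) \<partial>mv_normal m (mat 1))"
      unfolding weak_conv_vec_def by blast
    have fnm: "(\<lambda>x::real^2. f ((norm x)\<^sup>2)) \<in> borel_measurable borel"
      by (rule measurable_compose[OF meas_norm fm])
    have e1: "(\<integral>x. f x \<partial>distr (M (n + N)) borel (\<lambda>\<omega>. (norm (W (n + N) \<omega>))\<^sup>2)) = (\<integral>x. f ((norm x)\<^sup>2) \<partial>distr (M (n + N)) borel (W (n + N)))" for n
      using N[of "n + N"] by (simp add: integral_distr[OF nWm fm] integral_distr[OF _ fnm])
    have e2: "(\<integral>x. f x \<partial>distr (mv_normal m (mat 1)) borel (\<lambda>x. (norm x)\<^sup>2)) = (\<integral>x. f ((norm x)\<^sup>2) \<partial>mv_normal m (mat 1))"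
      by (rule integral_distr[OF mv_meas fm])
    show "(\<lambda>n. \<integral>x. f x \<partial>distr (M (n + N)) borel (\<lambda>\<omega>. (norm (W (n + N) \<omega>))\<^sup>2)) \<longlonglongrightarrow> (\<integral>x. f x \<partial>distr (mv_normal m (mat 1)) borel (\<lambda>x. (norm x)\<^sup>2))"
      unfolding e1 e2 by (rule L)
  qed
  then have "weak_conv_m (\<lambda>n. distr (M n) borel (\<lambda>\<omega>. (norm (W n \<omega>))\<^sup>2)) (distr (mv_normal m (mat 1)) borel (\<lambda>x. (norm x)\<^sup>2))"
    unfolding weak_conv_m_def weak_conv_def
    using LIMSEQ_offset[where k=N and f="\<lambda>n. cdf (distr (M n) borel (\<lambda>\<omega>. (norm (W n \<omega>))\<^sup>2)) _"] by blast
  then show ?thesis using vec unfolding chi nW W_def m_def by blast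
qed

end
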